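(* Fix an integer $d\ge 2$ and positive integers $m_1,\dots,m_{d-1}$. Then there is a polynomial time algorithm that, given a positive integer $l$, an integer objective $c\in\mathbb{Z}^{m_1\times\cdots\times m_{d-1}\times l}$, and integer line-sums $(u_{i_2,\dots,i_d}),\ (u_{i_1,i_3,\dots,i_d}),\ \dots,\ (u_{i_1,\dots,i_{d-1}})$, solves the long multiway transportation problem $$\min\Big\{\,cx\ :\ x\in\mathbb{N}^{m_1\times\cdots\times m_{d-1}\times l}\,,\ \sum_{i_1}x_{i_1,\dots,i_d}=u_{i_2,\dots,i_d}\,,\ \sum_{i_2}x_{i_1,\dots,i_d}=u_{i_1,i_3,\dots,i_d}\,,\ \dots\,,\ \sum_{i_d}x_{i_1,\dots,i_d}=u_{i_1,\dots,i_{d-1}}\,\Big\}.$$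
   Context: $\mathbb{N}$ denotes the set of nonnegative integers. Indices range over $1\le i_t\le m_t$ for $t=1,\dots,d-1$ and $1\le i_d\le l$. For each $t=1,\dots,d$ there is a given integer array of line-sums, indexed by all the indices $i_1,\dots,i_d$ except $i_t$, and the constraint "sum over $i_t$" is imposed for every choice of the other $d-1$ indices; the arrays for different $t$ are independent input data. Here $cx=\sum c_{i_1,\dots,i_d}x_{i_1,\dots,i_d}$. Solving an integer program means that the algorithm concludes with precisely one of the following correct outputs: it asserts that there is no feasible solution, or it asserts that the objective function is unbounded on the feasible set, or it returns an optimal solution. The numbers $d,m_1,\dots,m_{d-1}$ are fixed and not part of the input. The input size is $l$ (its value) plus the bit size of the integers in $c$ and in the line-sums (binary encoding); polynomial time means polynomial in this input size. *)

theory Defs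
  imports "HOL-Computational_Algebra.Polynomial" "HOL-Library.Log_Nat"
begin

section \<open>A random access machine with logarithmic cost\<close>

text \<open>
  The model of computation is the random access machine with arithmetic on integers of unbounded
  length under the logarithmic cost criterion (Cook--Reckhow; Aho, Hopcroft and Ullman), written
  as structured programs. It is polynomially equivalent to Turing machines. Memory consists of
  arrays of integer cells; array names are constants in the program text, so a program uses only
  finitely many of them, whereas cell addresses are computed at run time. All of memory outside
  the input is initially zero.
\<close>

text \<open>Number of binary digits, plus a sign bit; in particular \<open>bits 0 = 1\<close>.\<close>

definition bits :: "int \<Rightarrow> nat" where
  "bits z = nat (bitlen \<bar>z\<bar>) + 1"

type_synonym memory = "nat \<Rightarrow> int \<Rightarrow> int"

datatype aexp =
    Const int
  | Cell nat aexp
  | Add aexp aexp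
  | Sub aexp aexp
  | Mul aexp aexp
  | Div aexp aexp

fun aval :: "aexp \<Rightarrow> memory \<Rightarrow> int" where
  "aval (Const z) s = z"
| "aval (Cell a e) s = s a (aval e s)"
| "aval (Add e f) s = aval e s + aval f s"
| "aval (Sub e f) s = aval e s - aval f s"
| "aval (Mul e f) s = aval e s * aval f s"
| "aval (Div e f) s = aval e s div aval f s"

text \<open>
  Every node of an expression is charged the length of its value. Thus a memory access pays for
  both the address and the content, and an operation for its operands and its result.
\<close>

fun acost :: "aexp \<Rightarrow> memory \<Rightarrow> nat" where
  "acost (Const z) s = bits z"
| "acost (Cell a e) s = acost e s + bits (aval (Cell a e) s)"
| "acost (Add e f) s = acost e s + acost f s + bits (aval (Add e f) s)"
| "acost (Sub e f) s = acost e s + acost f s + bits (aval (Sub e f) s)"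
| "acost (Mul e f) s = acost e s + acost f s + bits (aval (Mul e f) s)"
| "acost (Div e f) s = acost e s + acost f s + bits (aval (Div e f) s)"

text \<open>
  \<open>Assign a e f\<close> is \<open>a[e] := f\<close>; the tests of \<open>Cond\<close> and \<open>While\<close> succeed iff the value of the
  expression is positive.
\<close>

datatype com =
    Skip
  | Assign nat aexp aexp
  | Seq com com
  | Cond aexp com com
  | While aexp com

text \<open>\<open>exec P s t s'\<close>: started in \<open>s\<close>, program \<open>P\<close> halts in \<open>s'\<close> after time exactly \<open>t\<close>.\<close>

inductive exec :: "com \<Rightarrow> memory \<Rightarrow> nat \<Rightarrow> memory \<Rightarrow> bool" where
  exec_Skip: "exec Skip s 1 s"
| exec_Assign:
    "exec (Assign a e f) s (acost e s + acost f s) (s(a := (s a)(aval e s := aval f s)))"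
| exec_Seq: "exec P s t s' \<Longrightarrow> exec Q s' t' s'' \<Longrightarrow> exec (Seq P Q) s (t + t') s''"
| exec_CondT: "aval e s > 0 \<Longrightarrow> exec P s t s' \<Longrightarrow> exec (Cond e P Q) s (acost e s + t) s'"
| exec_CondF: "\<not> aval e s > 0 \<Longrightarrow> exec Q s t s' \<Longrightarrow> exec (Cond e P Q) s (acost e s + t) s'"
| exec_WhileF: "\<not> aval e s > 0 \<Longrightarrow> exec (While e P) s (acost e s) s"
| exec_WhileT:
    "aval e s > 0 \<Longrightarrow> exec P s t s' \<Longrightarrow> exec (While e P) s' t' s'' \<Longrightarrow>
      exec (While e P) s (acost e s + t + t') s''"

lemma exec_deterministic:
  "exec P s t s' \<Longrightarrow> exec P s t' s'' \<Longrightarrow> t' = t \<and> s'' = s'"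
proof (induction arbitrary: t' s'' rule: exec.induct)
  case (exec_Seq P s t s' Q t1 s1)
  from exec_Seq.prems show ?case
    by (cases rule: exec.cases) (use exec_Seq.IH in blast)+
next
  case (exec_WhileT e s P t s' t1 s1)
  from exec_WhileT.prems show ?case
    by (cases rule: exec.cases) (use exec_WhileT.IH exec_WhileT.hyps in blast)+
qed (erule exec.cases; fastforce)+

text \<open>
  Input and output are lists of integers: cell 0 of the array holds the length of the list and the
  cells from 1 on hold its entries. The input is in array 0, the output is left in array 1.
\<close>

definition load_input :: "int list \<Rightarrow> memory" where
  "load_input xs = (\<lambda>a i.
     if a = 0 \<and> i = 0 then int (length xs)
     else if a = 0 \<and> 1 \<le> i \<and> i \<le> int (length xs) then xs ! (nat i - 1)
     else 0)"

definition read_output :: "memory \<Rightarrow> int list" where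
  "read_output s = map (\<lambda>j. s 1 (int j + 1)) [0..<nat (s 1 0)]"

definition computes_in_time :: "com \<Rightarrow> int list \<Rightarrow> nat \<Rightarrow> int list \<Rightarrow> bool" where
  "computes_in_time P xs t ys \<longleftrightarrow> (\<exists>s. exec P (load_input xs) t s \<and> read_output s = ys)"


section \<open>Solving an integer program\<close>

datatype 'a answer = Infeasible | Unbounded | Optimal 'a

fun correct_answer :: "'a set \<Rightarrow> ('a \<Rightarrow> int) \<Rightarrow> 'a answer \<Rightarrow> bool" where
  "correct_answer F f Infeasible \<longleftrightarrow> F = {}"
| "correct_answer F f Unbounded \<longleftrightarrow> (\<forall>B. \<exists>x\<in>F. f x < B)"
| "correct_answer F f (Optimal x) \<longleftrightarrow> x \<in> F \<and> (\<forall>y\<in>F. f x \<le> f y)"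


section \<open>Multiway tables\<close>

text \<open>
  A multi-index is a list of numbers, counted from 0, and a table is a function on multi-indices.
  For a list \<open>ns\<close> of dimensions, \<open>multi_indices ns\<close> lists in lexicographic order all \<open>is\<close> with
  \<open>is ! t < ns ! t\<close> for every position \<open>t\<close>. Only the values at these multi-indices matter.
\<close>

definition multi_indices :: "nat list \<Rightarrow> nat list list" where
  "multi_indices ns = product_lists (map (\<lambda>n. [0..<n]) ns)"

definition delete_at :: "nat \<Rightarrow> 'a list \<Rightarrow> 'a list" where
  "delete_at t xs = take t xs @ drop (Suc t) xs"

definition insert_at :: "nat \<Rightarrow> 'a \<Rightarrow> 'a list \<Rightarrow> 'a list" where
  "insert_at t x xs = take t xs @ x # drop t xs"

text \<open>
  \<open>u t js\<close> is the prescribed sum along direction \<open>t\<close>, where \<open>js\<close> consists of the indices other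
  than the one at position \<open>t\<close>.
\<close>

definition transport_feasible ::
    "nat list \<Rightarrow> (nat \<Rightarrow> nat list \<Rightarrow> int) \<Rightarrow> (nat list \<Rightarrow> nat) set" where
  "transport_feasible ns u =
     {x. \<forall>t<length ns. \<forall>js\<in>set (multi_indices (delete_at t ns)).
           (\<Sum>k<ns ! t. int (x (insert_at t k js))) = u t js}"

definition transport_cost :: "nat list \<Rightarrow> (nat list \<Rightarrow> int) \<Rightarrow> (nat list \<Rightarrow> nat) \<Rightarrow> int" where
  "transport_cost ns c x = (\<Sum>i\<in>set (multi_indices ns). c i * int (x i))"

text \<open>The integers in the objective and, direction by direction, in the line-sums.\<close>

definition transport_data ::
    "nat list \<Rightarrow> (nat list \<Rightarrow> int) \<Rightarrow> (nat \<Rightarrow> nat list \<Rightarrow> int) \<Rightarrow> int list" where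
  "transport_data ns c u =
     map c (multi_indices ns) @
     concat (map (\<lambda>t. map (u t) (multi_indices (delete_at t ns))) [0..<length ns])"

text \<open>
  In the long transportation problem only the last dimension \<open>l\<close> is part of the input; it
  contributes its value, not its length, to the input size.
\<close>

definition long_transport_input ::
    "nat list \<Rightarrow> nat \<Rightarrow> (nat list \<Rightarrow> int) \<Rightarrow> (nat \<Rightarrow> nat list \<Rightarrow> int) \<Rightarrow> int list" where
  "long_transport_input ms l c u = int l # transport_data (ms @ [l]) c u"

definition long_transport_size ::
    "nat list \<Rightarrow> nat \<Rightarrow> (nat list \<Rightarrow> int) \<Rightarrow> (nat \<Rightarrow> nat list \<Rightarrow> int) \<Rightarrow> nat" where
  "long_transport_size ms l c u = l + sum_list (map bits (transport_data (ms @ [l]) c u))"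

fun encode_answer :: "nat list \<Rightarrow> (nat list \<Rightarrow> nat) answer \<Rightarrow> int list" where
  "encode_answer ns Infeasible = [0]"
| "encode_answer ns Unbounded = [1]"
| "encode_answer ns (Optimal x) = 2 # map (\<lambda>i. int (x i)) (multi_indices ns)"

end

theory Submission
  imports Defs "HOL-Library.Multiset"
begin

text \<open>
  Cut the table into \<open>l\<close> layers along the last index. With a slack variable for every line-sum, the
  problem is an n-fold integer program: the line-sums in the first \<open>d - 1\<close> directions constrain each
  layer separately, those in the last direction link the layers. Since the slack
  variables are charged a weight \<open>W\<close> exceeding the variation of the objective, the table \<open>0\<close> is a
  feasible start unless a line-sum is negative, and at a minimum the slack vanishes iff the original
  problem is feasible.

  By Dickson's lemma, applied first to a single layer and then to multisets of layer vectors together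
  with their sum, there is a finite list of tuples of layer vectors, independent of \<open>l\<close>, such that the
  difference of any two feasible points is a sum of sign-compatible moves, each of which puts the
  vectors of one tuple into some layers. As tuples have bounded length, only polynomially many, say
  \<open>K\<close>, moves exist. So if a point exceeds the optimum by \<open>G\<close>, some move \<open>h\<close> with multiplicity \<open>m\<close>
  gains \<open>G / K\<close>, and rounding \<open>m\<close> down to one of \<open>T, T div 2, T div 4, \<dots>\<close> loses a factor of at most
  two. The program performs moves that gain at least \<open>D\<close> until none is left, then halves \<open>D\<close>; every
  value of \<open>D\<close> admits \<open>O(K)\<close> moves, and \<open>D\<close> is halved as often as its length allows.
\<close>

section \<open>Conformal decompositions\<close>

text \<open>Dickson's lemma is applied twice because the layers interact only through the linking
  constraints. Recording how often each minimal layer vector occurs, and not where, is what removes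
  \<open>l\<close>. The second application also records the positive and negative parts of the
  total: up to sign the total is the change of the linking slack, which must split sign-compatibly
  too. The lemma gives finiteness without a bound; this suffices, since the list of tuples enters
  the program text as a constant.

  Sign-compatibility serves two purposes. The multiplicity of a move with a nonzero entry is at most
  the bound \<open>T\<close> on the entries of feasible points, so it can be approximated by a
  halving sequence starting at \<open>T\<close>; and a shorter step along a move leading to an
  optimum keeps the point nonnegative.

  Since coefficients are nonnegative and every line-sum has its slack, feasible points are bounded
  by the data. Hence the answer \<open>Unbounded\<close> never arises, and at loop heads all numbers
  in memory stay within a fixed \<open>2 ^ \<beta>\<close>. The logarithmic cost criterion makes
  this essential: with the lengths under control, bounding time reduces to counting
  iterations.\<close>

lemma dickson:
  fixes \<phi> :: "'x \<Rightarrow> 'i \<Rightarrow> nat"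
  assumes "finite I"
  shows "\<exists>T. finite T \<and> T \<subseteq> S \<and> (\<forall>x\<in>S. \<exists>y\<in>T. \<forall>i\<in>I. \<phi> y i \<le> \<phi> x i)"
  using assms
proof (induction I arbitrary: S rule: finite_induct)
  case empty
  show ?case
  proof (cases "S = {}")
    case False
    then obtain x where "x \<in> S" by blast
    then show ?thesis by (intro exI[of _ "{x}"]) auto
  qed auto
next
  case (insert a I)
  obtain T where T: "finite T" "T \<subseteq> S" "\<forall>x\<in>S. \<exists>y\<in>T. \<forall>i\<in>I. \<phi> y i \<le> \<phi> x i"
    using insert.IH[of S] by auto
  \<comment> \<open>Elements whose coordinate \<open>a\<close> is at least \<open>n\<close> are
    dominated by members of \<open>T\<close>; each of the finitely many smaller values is a slice
    handled by the induction hypothesis.\<close>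
  define n where "n = Max (insert 0 ((\<lambda>y. \<phi> y a) ` T))"
  have n: "\<phi> y a \<le> n" if "y \<in> T" for y
    unfolding n_def using that T(1) by (intro Max_ge) auto
  have "\<forall>c. \<exists>U. finite U \<and> U \<subseteq> {x \<in> S. \<phi> x a = c} \<and>
      (\<forall>x\<in>{x \<in> S. \<phi> x a = c}. \<exists>y\<in>U. \<forall>i\<in>I. \<phi> y i \<le> \<phi> x i)"
    by (intro allI insert.IH)
  then obtain U where U: "\<And>c. finite (U c)" "\<And>c. U c \<subseteq> {x \<in> S. \<phi> x a = c}"
      "\<And>c. \<forall>x\<in>{x \<in> S. \<phi> x a = c}. \<exists>y\<in>U c. \<forall>i\<in>I. \<phi> y i \<le> \<phi> x i"
    by metis
  show ?case
  proof (intro exI[of _ "T \<union> (\<Union>c<n. U c)"] conjI ballI)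
    show "finite (T \<union> (\<Union>c<n. U c))" using T(1) U(1) by auto
    show "T \<union> (\<Union>c<n. U c) \<subseteq> S" using T(2) U(2) by blast
    fix x assume x: "x \<in> S"
    show "\<exists>y\<in>T \<union> (\<Union>c<n. U c). \<forall>i\<in>insert a I. \<phi> y i \<le> \<phi> x i"
    proof (cases "\<phi> x a < n")
      case True
      obtain y where "y \<in> U (\<phi> x a)" "\<forall>i\<in>I. \<phi> y i \<le> \<phi> x i" using U(3) x by blast
      moreover have "\<phi> y a = \<phi> x a" using calculation(1) U(2) by blast
      ultimately show ?thesis using True by (intro bexI[of _ y]) auto
    next
      case False
      obtain y where "y \<in> T" "\<forall>i\<in>I. \<phi> y i \<le> \<phi> x i" using T(3) x by blast
      moreover have "\<phi> y a \<le> \<phi> x a" using n[OF calculation(1)] False by simp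
      ultimately show ?thesis by (intro bexI[of _ y]) auto
    qed
  qed
qed

text \<open>The sign-compatible partial order behind Graver bases, used entrywise on
  vectors.\<close>

definition conformal :: "int \<Rightarrow> int \<Rightarrow> bool" where
  "conformal a b \<longleftrightarrow> (0 \<le> a \<and> a \<le> b) \<or> (b \<le> a \<and> a \<le> 0)"

text \<open>Splitting into positive and negative parts turns the order into a product order on
  naturals, the form to which \<open>dickson\<close> applies.\<close>

lemma conformal_iff_nat: "conformal a b \<longleftrightarrow> nat a \<le> nat b \<and> nat (- a) \<le> nat (- b)"
  unfolding conformal_def by linarith

lemma conformal_refl [simp]: "conformal a a"
  unfolding conformal_def by linarith

lemma conformal_trans: "conformal a b \<Longrightarrow> conformal b c \<Longrightarrow> conformal a c"
  unfolding conformal_def by linarith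

text \<open>With transitivity, this lets the remainder be decomposed further into pieces conformal
  to the original whole.\<close>

lemma conformal_diff: "conformal a b \<Longrightarrow> conformal (b - a) b"
  unfolding conformal_def by linarith

text \<open>A sub-multiset found after forgetting the layers is traced back to vectors that still
  carry their layer.\<close>

lemma image_mset_subset_lift:
  assumes "N \<subseteq># image_mset f L"
  shows "\<exists>L'. L' \<subseteq># L \<and> image_mset f L' = N"
  using assms by (metis image_mset_eq_plusD mset_subset_eq_add_left subset_mset.le_iff_add)

lemma image_mset_eq_mset_lift:
  assumes "image_mset f L = mset ys"
  shows "\<exists>xs. mset xs = L \<and> map f xs = ys"
  using assms
proof (induction ys arbitrary: L)
  case (Cons y ys)
  then obtain x L' where "L = add_mset x L'" "f x = y" "image_mset f L' = mset ys"
    by (metis msed_map_invR mset.simps(2))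
  moreover obtain xs where "mset xs = L'" "map f xs = ys" using Cons.IH calculation(3) by blast
  ultimately show ?case by (intro exI[of _ "x # xs"]) auto
qed auto

text \<open>\<open>T\<close> is chosen for multisets of bare vectors and only then transported to
  labelled ones; hence it does not depend on the number of labels, that is, of layers. The induction
  splits off one member of \<open>T\<close> at a time.\<close>

lemma decompose_zero_sum:
  fixes V :: "(nat \<Rightarrow> int) set"
  assumes "finite V"
  shows "\<exists>T. finite T \<and> (\<forall>N\<in>T. N \<noteq> {#} \<and> set_mset N \<subseteq> V) \<and>
    (\<forall>L :: ('k \<times> (nat \<Rightarrow> int)) multiset. snd ` set_mset L \<subseteq> V \<longrightarrow>
      (\<exists>Ls. \<Sum>\<^sub># Ls = L \<and> (\<forall>L'\<in>#Ls. image_mset snd L' \<in> T \<and>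
        (\<forall>i<M. conformal (\<Sum>p\<in>#L'. snd p i) (\<Sum>p\<in>#L. snd p i)))))"
proof -
  define S where "S = {N :: (nat \<Rightarrow> int) multiset. N \<noteq> {#} \<and> set_mset N \<subseteq> V}"
  \<comment> \<open>The coordinates are the multiplicities followed by the positive and negative
    parts of the sums, so that domination means being a sub-multiset with conformal sums.\<close>
  define \<phi> where "\<phi> N = case_sum (count N)
      (case_sum (\<lambda>i. nat (\<Sum>v\<in>#N. v i)) (\<lambda>i. nat (- (\<Sum>v\<in>#N. v i))))"
    for N :: "(nat \<Rightarrow> int) multiset"
  have "finite (V <+> ({..<M} <+> {..<M}))" using assms by auto
  from dickson[OF this, of S \<phi>] obtain T where T: "finite T" "T \<subseteq> S"
      "\<And>N. N \<in> S \<Longrightarrow> \<exists>N'\<in>T. \<forall>i\<in>V <+> ({..<M} <+> {..<M}). \<phi> N' i \<le> \<phi> N i"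
    by blast
  have step: "\<exists>N'\<in>T. N' \<subseteq># N \<and> (\<forall>i<M. conformal (\<Sum>v\<in>#N'. v i) (\<Sum>v\<in>#N. v i))"
    if "N \<noteq> {#}" "set_mset N \<subseteq> V" for N
  proof -
    obtain N' where N': "N' \<in> T" "\<forall>i\<in>V <+> ({..<M} <+> {..<M}). \<phi> N' i \<le> \<phi> N i"
      using T(3) \<open>N \<noteq> {#}\<close> \<open>set_mset N \<subseteq> V\<close> unfolding S_def by blast
    have "count N' v \<le> count N v" for v
    proof (cases "v \<in> V")
      case True
      then have "\<phi> N' (Inl v) \<le> \<phi> N (Inl v)" using N'(2) by blast
      then show ?thesis by (simp add: \<phi>_def)
    next
      case False
      then have "v \<notin># N'" using N'(1) T(2) unfolding S_def by blast
      then have "count N' v = 0" by (simp add: not_in_iff)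
      then show ?thesis by simp
    qed
    then have "N' \<subseteq># N" by (simp add: mset_subset_eqI)
    moreover have "conformal (\<Sum>v\<in>#N'. v i) (\<Sum>v\<in>#N. v i)" if "i < M" for i
    proof -
      have "\<phi> N' (Inr (Inl i)) \<le> \<phi> N (Inr (Inl i))" "\<phi> N' (Inr (Inr i)) \<le> \<phi> N (Inr (Inr i))"
        using N'(2) that by blast+
      then show ?thesis unfolding conformal_iff_nat by (simp add: \<phi>_def)
    qed
    ultimately show ?thesis using N'(1) by blast
  qed
  have "\<exists>Ls. \<Sum>\<^sub># Ls = L \<and> (\<forall>L'\<in>#Ls. image_mset snd L' \<in> T \<and>
        (\<forall>i<M. conformal (\<Sum>p\<in>#L'. snd p i) (\<Sum>p\<in>#L. snd p i)))"
    if "snd ` set_mset L \<subseteq> V" for L :: "('k \<times> (nat \<Rightarrow> int)) multiset"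
    using that
  proof (induction "size L" arbitrary: L rule: less_induct)
    case less
    show ?case
    proof (cases "L = {#}")
      case True
      then show ?thesis by (intro exI[of _ "{#}"]) auto
    next
      case False
      obtain N' where N': "N' \<in> T" "N' \<subseteq># image_mset snd L"
        and conf: "\<And>i. i < M \<Longrightarrow> conformal (\<Sum>v\<in>#N'. v i) (\<Sum>v\<in>#image_mset snd L. v i)"
        using step[of "image_mset snd L"] False less.prems by auto
      obtain L' where L': "L' \<subseteq># L" "image_mset snd L' = N'"
        using image_mset_subset_lift[OF N'(2)] by blast
      have ne: "L' \<noteq> {#}" using N'(1) T(2) L'(2) unfolding S_def by auto
      define K where "K = L - L'"
      have L: "L = L' + K" unfolding K_def using L'(1) by simp
      have "size K < size L" using L ne by (simp add: nonempty_has_size)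
      moreover have "snd ` set_mset K \<subseteq> V" using less.prems L by auto
      ultimately obtain Ls where Ls: "\<Sum>\<^sub># Ls = K" "\<And>P. P \<in># Ls \<Longrightarrow> image_mset snd P \<in> T \<and>
        (\<forall>i<M. conformal (\<Sum>p\<in>#P. snd p i) (\<Sum>p\<in>#K. snd p i))"
        using less.hyps[of K] by blast
      have sumL: "(\<Sum>p\<in>#K. snd p i) = (\<Sum>p\<in>#L. snd p i) - (\<Sum>p\<in>#L'. snd p i)" for i
        by (simp add: L)
      have conf': "conformal (\<Sum>p\<in>#L'. snd p i) (\<Sum>p\<in>#L. snd p i)" if "i < M" for i
        using conf[OF that] unfolding L'(2)[symmetric] by (simp add: multiset.map_comp comp_def)
      show ?thesis
      proof (intro exI[of _ "add_mset L' Ls"] conjI ballI allI impI)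
        show "\<Sum>\<^sub># (add_mset L' Ls) = L" using Ls(1) L by simp
        fix P assume P: "P \<in># add_mset L' Ls"
        show "image_mset snd P \<in> T" using P Ls(2) L'(2) N'(1) by auto
        fix i assume i: "i < M"
        show "conformal (\<Sum>p\<in>#P. snd p i) (\<Sum>p\<in>#L. snd p i)"
        proof (cases "P = L'")
          case False
          then have "P \<in># Ls" using P by simp
          from conjunct2[OF Ls(2)[OF this]]
          have "conformal (\<Sum>p\<in>#P. snd p i) (\<Sum>p\<in>#K. snd p i)" using i by (elim allE impE)
          then show ?thesis
            using conformal_trans[OF _ conformal_diff[OF conf'[OF i]]] unfolding sumL by blast
        qed (use conf'[OF i] in simp)
      qed
    qed
  qed
  moreover have "\<forall>N\<in>T. N \<noteq> {#} \<and> set_mset N \<subseteq> V" using T(2) unfolding S_def by blast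
  ultimately show ?thesis using T(1) by (intro exI[of _ T] conjI) simp_all
qed

text \<open>The kernel of \<open>A\<close> extended by an identity block: coordinate
  \<open>M + j\<close> is the slack of row \<open>j\<close>. Vectors vanish beyond
  \<open>M + J\<close> so that equality of functions is equality of vectors, as finite sets and
  multisets of them require.\<close>

definition in_layer_kernel :: "nat \<Rightarrow> nat \<Rightarrow> (nat \<Rightarrow> nat \<Rightarrow> int) \<Rightarrow> (nat \<Rightarrow> int) \<Rightarrow> bool" where
  "in_layer_kernel M J A v \<longleftrightarrow>
     (\<forall>r\<ge>M + J. v r = 0) \<and> (\<forall>j<J. (\<Sum>i<M. A j i * v i) + v (M + j) = 0)"

lemma in_layer_kernel_diff:
  assumes "in_layer_kernel M J A v" "in_layer_kernel M J A w"
  shows "in_layer_kernel M J A (\<lambda>r. v r - w r)"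
  unfolding in_layer_kernel_def
proof (intro conjI allI impI)
  fix j assume "j < J"
  then have "(\<Sum>i<M. A j i * v i) + v (M + j) = 0" "(\<Sum>i<M. A j i * w i) + w (M + j) = 0"
    using assms unfolding in_layer_kernel_def by auto
  then show "(\<Sum>i<M. A j i * (v i - w i)) + (v (M + j) - w (M + j)) = 0"
    by (simp add: right_diff_distrib sum_subtractf)
qed (use assms in \<open>auto simp: in_layer_kernel_def\<close>)

text \<open>\<open>V\<close> plays the role of the Graver basis of \<open>A\<close> extended by an
  identity. Subtracting an element of \<open>V\<close> below \<open>y\<close> stays in the kernel
  and strictly lowers the 1-norm, so repeated subtraction ends at zero.\<close>

lemma decompose_layer:
  "\<exists>V. finite V \<and> (\<forall>v\<in>V. in_layer_kernel M J A v) \<and>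
     (\<forall>y. in_layer_kernel M J A y \<longrightarrow>
       (\<exists>L. set_mset L \<subseteq> V \<and> (\<forall>r. y r = (\<Sum>v\<in>#L. v r)) \<and>
            (\<forall>v\<in>#L. \<forall>r. conformal (v r) (y r))))"
proof -
  define S where "S = {v. in_layer_kernel M J A v \<and> v \<noteq> (\<lambda>_. 0)}"
  define \<phi> where "\<phi> v = case_sum (\<lambda>r. nat (v r)) (\<lambda>r. nat (- v r))" for v :: "nat \<Rightarrow> int"
  have "finite ({..<M + J} <+> {..<M + J})" by auto
  from dickson[OF this, of S \<phi>] obtain V where V: "finite V" "V \<subseteq> S"
      "\<And>y. y \<in> S \<Longrightarrow> \<exists>v\<in>V. \<forall>i\<in>{..<M + J} <+> {..<M + J}. \<phi> v i \<le> \<phi> y i"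
    by metis
  have step: "\<exists>v\<in>V. \<forall>r. conformal (v r) (y r)" if yS: "y \<in> S" for y
  proof -
    obtain v where v: "v \<in> V" "\<forall>i\<in>{..<M + J} <+> {..<M + J}. \<phi> v i \<le> \<phi> y i"
      using V(3)[OF yS] by blast
    have "conformal (v r) (y r)" for r
    proof (cases "r < M + J")
      case True
      then have "\<phi> v (Inl r) \<le> \<phi> y (Inl r)" "\<phi> v (Inr r) \<le> \<phi> y (Inr r)" using v(2) by blast+
      then show ?thesis unfolding conformal_iff_nat by (simp add: \<phi>_def)
    next
      case False
      moreover have "v \<in> S" using v(1) V(2) by blast
      ultimately have "v r = 0" "y r = 0" using yS unfolding S_def in_layer_kernel_def by auto
      then show ?thesis by simp
    qed
    then show ?thesis using v(1) by blast
  qed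
  have "\<exists>L. set_mset L \<subseteq> V \<and> (\<forall>r. y r = (\<Sum>v\<in>#L. v r)) \<and> (\<forall>v\<in>#L. \<forall>r. conformal (v r) (y r))"
    if "in_layer_kernel M J A y" for y
    using that
  proof (induction "\<Sum>r<M + J. nat \<bar>y r\<bar>" arbitrary: y rule: less_induct)
    case less
    show ?case
    proof (cases "y \<in> S")
      case False
      then have "y = (\<lambda>_. 0)" using less.prems unfolding S_def by blast
      then show ?thesis by (intro exI[of _ "{#}"]) auto
    next
      case True
      obtain v where v: "v \<in> V" "\<And>r. conformal (v r) (y r)" using step[OF True] by blast
      have vS: "v \<in> S" using v(1) V(2) by blast
      define z where "z r = y r - v r" for r
      have "in_layer_kernel M J A z"
        unfolding z_def using less.prems vS by (intro in_layer_kernel_diff) (auto simp: S_def)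
      moreover have "(\<Sum>r<M + J. nat \<bar>z r\<bar>) < (\<Sum>r<M + J. nat \<bar>y r\<bar>)"
      proof (rule sum_strict_mono_ex1)
        show "\<forall>r\<in>{..<M + J}. nat \<bar>z r\<bar> \<le> nat \<bar>y r\<bar>"
          using v(2) unfolding z_def conformal_def by (smt (verit) nat_mono)
        obtain r where r: "v r \<noteq> 0" using vS unfolding S_def by auto
        have "r < M + J"
        proof (rule ccontr)
          assume "\<not> r < M + J"
          then have "v r = 0" using vS unfolding S_def in_layer_kernel_def by simp
          then show False using r by simp
        qed
        moreover have "nat \<bar>z r\<bar> < nat \<bar>y r\<bar>"
          using v(2)[of r] r unfolding z_def conformal_def by linarith
        ultimately show "\<exists>r\<in>{..<M + J}. nat \<bar>z r\<bar> < nat \<bar>y r\<bar>" by blast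
      qed simp
      ultimately obtain L where L: "set_mset L \<subseteq> V" "\<And>r. z r = (\<Sum>v\<in>#L. v r)"
          "\<And>v r. v \<in># L \<Longrightarrow> conformal (v r) (z r)"
        using less.hyps[of z] by blast
      have "conformal (w r) (y r)" if "w \<in># L" for w r
        using conformal_trans[OF L(3)[OF that] ] conformal_diff[OF v(2)] unfolding z_def by blast
      then show ?thesis using v L(1,2) unfolding z_def
        by (intro exI[of _ "add_mset v L"]) (auto simp: algebra_simps)
    qed
  qed
  moreover have "\<forall>v\<in>V. in_layer_kernel M J A v" using V(2) unfolding S_def by blast
  ultimately show ?thesis using V(1) by (intro exI[of _ V] conjI) simp_all
qed

text \<open>
  The memory cell of entry \<open>k\<close> in block \<open>r\<close>, where all blocks but the last have length \<open>l\<close>: the blocks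
  \<open>r < M\<close> hold the variables, the blocks \<open>M + j\<close> the slack of the \<open>j\<close>-th constraint in every layer,
  and the block \<open>M + J\<close>, of length \<open>M\<close>, the slack of the linking constraints. The input has the
  costs and the right-hand sides in the same places.
\<close>

definition addr :: "nat \<Rightarrow> nat \<Rightarrow> nat \<Rightarrow> int" where
  "addr l r k = 2 + int r * int l + int k"

text \<open>A sparse vector as a list of address-value pairs. Values at equal addresses add up,
  because several vectors of a tuple may be put into the same layer.\<close>

definition vec_of :: "(int \<times> int) list \<Rightarrow> int \<Rightarrow> int" where
  "vec_of es a = (\<Sum>(b, v)\<leftarrow>es. if b = a then v else 0)"

lemma vec_of_Nil [simp]: "vec_of [] a = 0"
  by (simp add: vec_of_def)

lemma vec_of_Cons [simp]: "vec_of (e # es) a = (if fst e = a then snd e else 0) + vec_of es a"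
  by (simp add: vec_of_def split: prod.splits)

lemma vec_of_append [simp]: "vec_of (es @ fs) a = vec_of es a + vec_of fs a"
  by (simp add: vec_of_def)

lemma vec_of_eq_0: "a \<notin> fst ` set es \<Longrightarrow> vec_of es a = 0"
  by (induction es) auto

lemma vec_of_map_inj:
  assumes "inj_on f (set xs)" "distinct xs" "x \<in> set xs"
  shows "vec_of (map (\<lambda>x. (f x, g x)) xs) (f x) = g x"
  using assms
proof (induction xs)
  case (Cons y ys)
  show ?case
  proof (cases "x = y")
    case True
    then have "f x \<notin> fst ` set (map (\<lambda>x. (f x, g x)) ys)"
        using Cons.prems by (auto simp: inj_on_def)
    then show ?thesis using True vec_of_eq_0 by simp
  next
    case False
    then have "f y \<noteq> f x" using Cons.prems by (auto simp: inj_on_def)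
    then show ?thesis using False Cons by (auto simp: inj_on_def)
  qed
qed simp

text \<open>A pair in \<open>ps\<close> is a layer and the vector put there. The entries in the last
  block let the linking slack compensate the change of the sums over all layers.\<close>

definition move_entries :: "nat \<Rightarrow> nat \<Rightarrow> nat \<Rightarrow> (nat \<times> (nat \<Rightarrow> int)) list \<Rightarrow> (int \<times> int) list" where
  "move_entries M J l ps =
     concat (map (\<lambda>p. map (\<lambda>r. (addr l r (fst p), snd p r)) [0..<M + J]) ps) @
     map (\<lambda>i. (addr l (M + J) i, - (\<Sum>p\<leftarrow>ps. snd p i))) [0..<M]"

lemma addr_eq_iff:
  assumes "k < l" "k' < l"
  shows "addr l r k = addr l r' k' \<longleftrightarrow> r = r' \<and> k = k'"
proof -
  have "addr l r k = addr l r' k' \<longleftrightarrow> r * l + k = r' * l + k'"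
    unfolding addr_def by (metis (no_types,
        opaque_lifting) add.assoc add_left_cancel of_nat_add of_nat_eq_iff of_nat_mult)
  moreover have "(r * l + k) div l = r" "(r' * l + k') div l = r'" "(r * l + k) mod l = k"
    "(r' * l + k') mod l = k'"
    using assms by auto
  ultimately show ?thesis by metis
qed

lemma addr_less:
  assumes "k < l" "r < R"
  shows "addr l r k < addr l R 0"
proof -
  have "r * l + k < Suc r * l" using assms by simp
  also have "\<dots> \<le> R * l" using assms by (intro mult_le_mono1) auto
  finally have "int (r * l + k) < int (R * l)" by linarith
  then show ?thesis unfolding addr_def by simp
qed

lemma addr_le_iff: "addr l R i \<le> addr l R i' \<longleftrightarrow> i \<le> i'"
  by (simp add: addr_def)

lemma addr_neq:
  assumes "k < l" "r < R"
  shows "addr l r k \<noteq> addr l R i"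
  using addr_less[OF assms] addr_le_iff[of l R 0 i] by auto

text \<open>The sum runs over \<open>mset ps\<close> in order to match the sums over multisets of
  labelled vectors in the decomposition.\<close>

lemma vec_of_move_cell:
  assumes "r < M + J" "k < l" "\<And>p. p \<in> set ps \<Longrightarrow> fst p < l"
  shows "vec_of (move_entries M J l ps) (addr l r k) =
    (\<Sum>p\<in>#mset ps. if fst p = k then snd p r else 0)"
proof -
  have *: "vec_of (map (\<lambda>r. (addr l r k', v r)) [0..<M + J]) (addr l r k) =
      (if k' = k then v r else 0)" if "k' < l" for k' and v :: "nat \<Rightarrow> int"
  proof (cases "k' = k")
    case True
    have "inj_on (\<lambda>r. addr l r k) (set [0..<M + J])"
      using assms(2) by (auto simp: inj_on_def addr_eq_iff)
    from vec_of_map_inj[OF this, of r v] show ?thesis using True assms(1) by simp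
  next
    case False
    then have "addr l r k \<notin> fst ` set (map (\<lambda>r. (addr l r k', v r)) [0..<M + J])"
      using that assms(2) by (auto simp: addr_eq_iff)
    then show ?thesis using False vec_of_eq_0 by simp
  qed
  have "vec_of (concat (map (\<lambda>p. map (\<lambda>r. (addr l r (fst p), snd p r)) [0..<M + J]) ps))
      (addr l r k) = (\<Sum>p\<in>#mset ps. if fst p = k then snd p r else 0)"
    using assms(3) by (induction ps) (auto simp: * simp del: upt_Suc)
  moreover have "vec_of (map (\<lambda>i. (addr l (M + J) i, - (\<Sum>p\<leftarrow>ps. snd p i))) [0..<M])
      (addr l r k) = 0"
  proof (rule vec_of_eq_0, rule notI)
    assume "addr l r k \<in> fst ` set (map (\<lambda>i. (addr l (M + J) i, - (\<Sum>p\<leftarrow>ps. snd p i))) [0..<M])"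
    then obtain i where "addr l r k = addr l (M + J) i" by auto
    then show False using addr_neq[OF assms(2,1)] by blast
  qed
  ultimately show ?thesis unfolding move_entries_def by simp
qed

lemma vec_of_move_link:
  assumes "i < M" "\<And>p. p \<in> set ps \<Longrightarrow> fst p < l"
  shows "vec_of (move_entries M J l ps) (addr l (M + J) i) = - (\<Sum>p\<in>#mset ps. snd p i)"
proof -
  have "vec_of (concat (map (\<lambda>p. map (\<lambda>r. (addr l r (fst p), snd p r)) [0..<M + J]) ps))
      (addr l (M + J) i) = 0"
  proof (rule vec_of_eq_0, rule notI)
    assume "addr l (M + J) i \<in> fst ` set
        (concat (map (\<lambda>p. map (\<lambda>r. (addr l r (fst p), snd p r)) [0..<M + J]) ps))"
    then obtain p r where "p \<in> set ps" "r < M + J" "addr l (M + J) i = addr l r (fst p)"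
      by auto
    then show False using addr_neq[OF assms(2)] by metis
  qed
  moreover have "inj_on (addr l (M + J)) (set [0..<M])"
    by (auto simp: inj_on_def addr_def)
  from vec_of_map_inj[OF this, of i "\<lambda>i. - (\<Sum>p\<leftarrow>ps. snd p i)"]
  have "vec_of (map (\<lambda>i. (addr l (M + J) i, - (\<Sum>p\<leftarrow>ps. snd p i))) [0..<M])
      (addr l (M + J) i) = - (\<Sum>p\<leftarrow>ps. snd p i)"
    using assms(1) by simp
  moreover have "(\<Sum>p\<leftarrow>ps. snd p i) = (\<Sum>p\<in>#mset ps. snd p i)"
    by (simp add: sum_mset_sum_list[symmetric] del: mset_map flip: mset_map)
  ultimately show ?thesis unfolding move_entries_def by simp
qed

text \<open>Division with remainder by \<open>l\<close> recovers block and layer; the last block is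
  separate because its length is \<open>M\<close>.\<close>

lemma address_cases:
  assumes "l \<ge> 1" "2 \<le> a" "a < addr l R M"
  obtains (cell) r k where "r < R" "k < l" "a = addr l r k"
    | (link) i where "i < M" "a = addr l R i"
proof (cases "a < addr l R 0")
  case True
  define b where "b = nat (a - 2)"
  have a: "a = 2 + int b" using assms(2) by (simp add: b_def)
  then have "int b < int (R * l)" using True by (simp add: addr_def)
  then have "b < R * l" by linarith
  then have "b div l < R" by (simp add: less_mult_imp_div_less)
  moreover have "int b = int (b div l) * int l + int (b mod l)"
    by (metis div_mult_mod_eq of_nat_add of_nat_mult)
  then have "a = addr l (b div l) (b mod l)" unfolding addr_def a by linarith
  moreover have "b mod l < l" using assms(1) by simp
  ultimately show ?thesis using cell by blast
next
  case False
  define i where "i = nat (a - addr l R 0)"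
  have "a = addr l R i" using False by (simp add: i_def addr_def)
  moreover have "i < M" using assms(3) addr_le_iff[of l R M i] calculation by auto
  ultimately show ?thesis using link by blast
qed

lemma vec_of_move_outside:
  assumes "\<not> (2 \<le> a \<and> a < addr l (M + J) M)" "\<And>p. p \<in> set ps \<Longrightarrow> fst p < l"
  shows "vec_of (move_entries M J l ps) a = 0"
proof (rule vec_of_eq_0, rule notI)
  assume "a \<in> fst ` set (move_entries M J l ps)"
  then consider (cell) p r where "p \<in> set ps" "r < M + J" "a = addr l r (fst p)"
    | (link) i where "i < M" "a = addr l (M + J) i"
    unfolding move_entries_def by auto
  then show False
  proof cases
    case cell
    have "a < addr l (M + J) 0" using addr_less assms(2) cell by blast
    then show ?thesis using cell assms(1) addr_le_iff[of l "M + J" 0 M] by (auto simp: addr_def)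
  next
    case link
    then show ?thesis using assms(1) by (auto simp: addr_def)
  qed
qed

text \<open>The kernel of the whole n-fold matrix with slack, written on memory addresses, so that
  the contents of an array can serve directly as a point.\<close>

definition in_kernel :: "nat \<Rightarrow> nat \<Rightarrow> (nat \<Rightarrow> nat \<Rightarrow> int) \<Rightarrow> nat \<Rightarrow> (int \<Rightarrow> int) \<Rightarrow> bool" where
  "in_kernel M J A l z \<longleftrightarrow>
     (\<forall>a. \<not> (2 \<le> a \<and> a < addr l (M + J) M) \<longrightarrow> z a = 0) \<and>
     (\<forall>j<J. \<forall>k<l. (\<Sum>i<M. A j i * z (addr l i k)) + z (addr l (M + j) k) = 0) \<and>
     (\<forall>i<M. (\<Sum>k<l. z (addr l i k)) + z (addr l (M + J) i) = 0)"

lemma sum_mset_Union: "(\<Sum>x\<in>#\<Sum>\<^sub># Ls. f x) = (\<Sum>L\<in>#Ls. \<Sum>x\<in>#L. f x)"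
  by (induction Ls) auto

lemma sum_mset_sum: "(\<Sum>x\<in>#(\<Sum>k\<in>K. N k). f x) = (\<Sum>k\<in>K. \<Sum>x\<in>#N k. f x)"
  by (induction K rule: infinite_finite_induct) auto

lemma sum_mset_nonneg_int:
  fixes f :: "'a \<Rightarrow> int"
  shows "(\<And>x. x \<in># N \<Longrightarrow> 0 \<le> f x) \<Longrightarrow> 0 \<le> (\<Sum>x\<in>#N. f x)"
  by (induction N) auto

lemma sum_mset_uminus:
  fixes f :: "'a \<Rightarrow> int"
  shows "(\<Sum>x\<in>#N. - f x) = - (\<Sum>x\<in>#N. f x)"
  by (induction N) auto

text \<open>All summands have the sign of the total, so a partial sum lies between zero and the
  total.\<close>

lemma conformal_sum_mset:
  fixes f :: "'a \<Rightarrow> int"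
  assumes "\<And>x. x \<in># L \<Longrightarrow> conformal (f x) (\<Sum>x\<in>#L. f x)" "L' \<subseteq># L"
  shows "conformal (\<Sum>x\<in>#L'. f x) (\<Sum>x\<in>#L. f x)"
proof -
  obtain K where L: "L = L' + K" using assms(2) by (metis subset_mset.le_iff_add)
  have pos: "(\<Sum>x\<in>#N. f x) \<ge> 0" if "N \<subseteq># L" "(\<Sum>x\<in>#L. f x) \<ge> 0" for N
  proof (rule sum_mset_nonneg_int)
    fix x assume "x \<in># N"
    then have "x \<in># L" using that(1) by (rule mset_subset_eqD[rotated])
    from assms(1)[OF this] that(2) show "0 \<le> f x" unfolding conformal_def by linarith
  qed
  have neg: "(\<Sum>x\<in>#N. - f x) \<ge> 0" if "N \<subseteq># L" "(\<Sum>x\<in>#L. f x) \<le> 0" for N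
  proof (rule sum_mset_nonneg_int)
    fix x assume "x \<in># N"
    then have "x \<in># L" using that(1) by (rule mset_subset_eqD[rotated])
    from assms(1)[OF this] that(2) show "0 \<le> - f x" unfolding conformal_def by linarith
  qed
  have sub: "L' \<subseteq># L" "K \<subseteq># L" using L by simp_all
  have "(\<Sum>x\<in>#L. f x) = (\<Sum>x\<in>#L'. f x) + (\<Sum>x\<in>#K. f x)" using L by simp
  then show ?thesis using pos[OF sub(1)] pos[OF sub(2)] neg[OF sub(1)] neg[OF sub(2)]
    unfolding conformal_def sum_mset_uminus by linarith
qed

text \<open>A multiset, because the multiplicity of a move is what the step length of the program
  will approximate.\<close>

definition decomposed ::
    "nat \<Rightarrow> nat \<Rightarrow> (nat \<Rightarrow> int) list list \<Rightarrow> nat \<Rightarrow> (nat \<times> (nat \<Rightarrow> int)) list multiset \<Rightarrow> (int \<Rightarrow> int)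
        \<Rightarrow> bool"
  where
  "decomposed M J vss l Ls z \<longleftrightarrow>
     (\<forall>ps\<in>#Ls. map snd ps \<in> set vss \<and> (\<forall>p\<in>set ps. fst p < l) \<and>
        (\<forall>a. conformal (vec_of (move_entries M J l ps) a) (z a))) \<and>
     (\<forall>a. z a = (\<Sum>ps\<in>#Ls. vec_of (move_entries M J l ps) a))"

text \<open>The quantifier order matters: \<open>vss\<close> precedes \<open>l\<close>. The layers
  of \<open>z\<close> are split separately, the pieces are pooled with their layers as labels, and
  the pool is regrouped. Within a layer any selection from a conformal decomposition is conformal;
  for the linking slack this is exactly the sum condition of
  \<open>decompose_zero_sum\<close>.\<close>

theorem decompose_kernel:
  "\<exists>vss. (\<forall>vs\<in>set vss. \<forall>v\<in>set vs. in_layer_kernel M J A v) \<and>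
     (\<forall>l\<ge>1. \<forall>z. in_kernel M J A l z \<longrightarrow> (\<exists>Ls. decomposed M J vss l Ls z))"
proof -
  obtain V where V: "finite V" "\<forall>v\<in>V. in_layer_kernel M J A v"
    and V_dec: "\<And>y. in_layer_kernel M J A y \<Longrightarrow>
       \<exists>L. set_mset L \<subseteq> V \<and> (\<forall>r. y r = (\<Sum>v\<in>#L. v r)) \<and> (\<forall>v\<in>#L. \<forall>r. conformal (v r) (y r))"
    using decompose_layer[of M J A] by metis
  obtain T where T: "finite T" "\<forall>N\<in>T. N \<noteq> {#} \<and> set_mset N \<subseteq> V"
    and T_dec: "\<And>L :: (nat \<times> (nat \<Rightarrow> int)) multiset. snd ` set_mset L \<subseteq> V \<Longrightarrow>
      \<exists>Ls. \<Sum>\<^sub># Ls = L \<and> (\<forall>L'\<in>#Ls. image_mset snd L' \<in> T \<and>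
        (\<forall>i<M. conformal (\<Sum>p\<in>#L'. snd p i) (\<Sum>p\<in>#L. snd p i)))"
    using decompose_zero_sum[OF V(1), of M] by metis
  obtain Tl where Tl: "set Tl = T" using finite_list[OF T(1)] by blast
  \<comment> \<open>An arbitrary but fixed order of each multiset, since the program works with
    tuples.\<close>
  define pick where "pick N = (SOME xs. mset xs = N)" for N :: "(nat \<Rightarrow> int) multiset"
  have pick: "mset (pick N) = N" for N
    unfolding pick_def by (rule someI_ex) (rule ex_mset)
  define vss where "vss = map pick Tl"
  show ?thesis
  proof (intro exI[of _ vss] conjI allI impI)
    show "\<forall>vs\<in>set vss. \<forall>v\<in>set vs. in_layer_kernel M J A v"
    proof (intro ballI)
      fix vs v assume "vs \<in> set vss" "v \<in> set vs"
      then obtain N where "N \<in> T" "vs = pick N" unfolding vss_def using Tl by auto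
      then have "v \<in># N" using \<open>v \<in> set vs\<close> pick[of N] by (metis set_mset_mset)
      then show "in_layer_kernel M J A v" using V(2) T(2) \<open>N \<in> T\<close> by blast
    qed
  next
    fix l :: nat and z assume l: "1 \<le> l" and z: "in_kernel M J A l z"
    define y where "y k r = (if r < M + J then z (addr l r k) else 0)" for k r
    have "in_layer_kernel M J A (y k)" if "k < l" for k
      using z that unfolding in_layer_kernel_def in_kernel_def y_def by auto
    then have "\<forall>k\<in>{..<l}. \<exists>L. set_mset L \<subseteq> V \<and> (\<forall>r. y k r = (\<Sum>v\<in>#L. v r)) \<and>
        (\<forall>v\<in>#L. \<forall>r. conformal (v r) (y k r))"
      using V_dec by blast
    then obtain N where N0: "\<forall>k\<in>{..<l}. set_mset (N k) \<subseteq> V \<and> (\<forall>r. y k r = (\<Sum>v\<in>#N k. v r)) \<and>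
        (\<forall>v\<in>#N k. \<forall>r. conformal (v r) (y k r))"
      unfolding bchoice_iff by (elim exE)
    then have N: "\<And>k. k < l \<Longrightarrow> set_mset (N k) \<subseteq> V"
        "\<And>k r. k < l \<Longrightarrow> y k r = (\<Sum>v\<in>#N k. v r)"
      by simp_all
    have N_conf: "conformal (v r) (y k r)" if "k < l" "v \<in># N k" for k v r
      using N0 that by (metis lessThan_iff)
    define L where "L = (\<Sum>k<l. image_mset (Pair k) (N k))"
    have L_mem: "fst p < l \<and> snd p \<in># N (fst p)" if "p \<in># L" for p
      using that unfolding L_def by (auto simp: set_mset_sum)
    have L_sum: "(\<Sum>p\<in>#L. f p) = (\<Sum>k<l. \<Sum>v\<in>#N k. f (k, v))" for f :: "_ \<Rightarrow> int"
      unfolding L_def sum_mset_sum by (simp add: multiset.map_comp comp_def)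
    have L_cell: "(\<Sum>p\<in>#L. if fst p = k then snd p r else 0) = y k r" if "k < l" for k r
    proof -
      have "(\<Sum>p\<in>#L. if fst p = k then snd p r else 0) = (\<Sum>k'<l. if k' = k then y k r else 0)"
        unfolding L_sum by (intro sum.cong) (auto simp: N(2))
      then show ?thesis using that by simp
    qed
    have L_link: "(\<Sum>p\<in>#L. snd p i) = - z (addr l (M + J) i)" if "i < M" for i
    proof -
      have "(\<Sum>p\<in>#L. snd p i) = (\<Sum>k<l. y k i)"
        unfolding L_sum by (intro sum.cong) (auto simp: N(2))
      also have "\<dots> = (\<Sum>k<l. z (addr l i k))" unfolding y_def using that by simp
      also have "\<dots> = - z (addr l (M + J) i)"
        using z that unfolding in_kernel_def by (simp add: eq_neg_iff_add_eq_0)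
      finally show ?thesis .
    qed
    have "snd ` set_mset L \<subseteq> V" using L_mem N(1) by blast
    then obtain Ls where Ls: "\<Sum>\<^sub># Ls = L" "\<And>L'. L' \<in># Ls \<Longrightarrow> image_mset snd L' \<in> T"
        "\<And>L' i. L' \<in># Ls \<Longrightarrow> i < M \<Longrightarrow> conformal (\<Sum>p\<in>#L'. snd p i) (\<Sum>p\<in>#L. snd p i)"
      using T_dec by metis
    have sub: "L' \<subseteq># L" if L': "L' \<in># Ls" for L'
    proof -
      obtain Ls' where "Ls = add_mset L' Ls'" using multi_member_split[OF L'] by blast
      then have "L = L' + \<Sum>\<^sub># Ls'" using Ls(1) by simp
      then show ?thesis by simp
    qed
    \<comment> \<open>Each group is listed so that its vectors appear in the fixed order of
      \<open>pick\<close>; this places \<open>map snd ps\<close> in \<open>vss\<close>.\<close>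
    have "\<forall>L'\<in>set_mset Ls. \<exists>ps. mset ps = L' \<and> map snd ps \<in> set vss"
    proof
      fix L' assume "L' \<in># Ls"
      then have T: "image_mset snd L' \<in> T" by (rule Ls(2))
      have "image_mset snd L' = mset (pick (image_mset snd L'))" by (simp add: pick)
      from image_mset_eq_mset_lift[OF this]
      obtain ps where "mset ps = L'" "map snd ps = pick (image_mset snd L')" by blast
      then show "\<exists>ps. mset ps = L' \<and> map snd ps \<in> set vss"
        using T Tl unfolding vss_def by auto
    qed
    then obtain ls where ls: "\<And>L'. L' \<in># Ls \<Longrightarrow> mset (ls L') = L'"
        "\<And>L'. L' \<in># Ls \<Longrightarrow> map snd (ls L') \<in> set vss"
      unfolding bchoice_iff by auto
    have fst_less: "fst p < l" if "L' \<in># Ls" "p \<in> set (ls L')" for L' p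
      using L_mem sub[OF that(1)] that ls(1) by (metis mset_subset_eqD set_mset_mset)
    show "\<exists>Ls. decomposed M J vss l Ls z"
      unfolding decomposed_def
    proof (intro exI[of _ "image_mset ls Ls"] conjI ballI allI)
      fix ps assume "ps \<in># image_mset ls Ls"
      then obtain L' where L': "L' \<in># Ls" "ps = ls L'" by auto
      show "map snd ps \<in> set vss" using ls(2) L' by simp
      show "fst p < l" if "p \<in> set ps" for p using fst_less L' that by simp
      have mset_ps: "mset ps = L'" using ls(1) L' by simp
      have less: "\<And>p. p \<in> set ps \<Longrightarrow> fst p < l" using fst_less L' by simp
      fix a
      show "conformal (vec_of (move_entries M J l ps) a) (z a)"
      proof (cases "2 \<le> a \<and> a < addr l (M + J) M")
        case False
        then have "z a = 0" using z unfolding in_kernel_def by blast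
        then show ?thesis using vec_of_move_outside[OF False less] by simp
      next
        case True
        then have "2 \<le> a" "a < addr l (M + J) M" by auto
        with l show ?thesis
        proof (cases rule: address_cases)
          case (cell r k)
          have "conformal (\<Sum>p\<in>#L'. if fst p = k then snd p r else 0)
              (\<Sum>p\<in>#L. if fst p = k then snd p r else 0)"
          proof (rule conformal_sum_mset[OF _ sub[OF L'(1)]])
            fix p assume "p \<in># L"
            then have "snd p \<in># N (fst p)" using L_mem by blast
            then show "conformal (if fst p = k then snd p r else 0)
                (\<Sum>p\<in>#L. if fst p = k then snd p r else 0)"
              unfolding L_cell[OF cell(2)] using N_conf[OF cell(2), of "snd p"]
              by (auto simp: conformal_def)
          qed
          then show ?thesis unfolding L_cell[OF cell(2)] cell(3)
            using vec_of_move_cell[OF cell(1,2) less] cell(1) by (simp add: y_def mset_ps)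
        next
          case (link i)
          then show ?thesis using vec_of_move_link[OF link(1) less] Ls(3)[OF L'(1) link(1)]
              L_link[OF link(1)] by (auto simp: mset_ps conformal_def)
        qed
      qed
    next
      fix a
      have split: "(\<Sum>ps\<in>#image_mset ls Ls. F (mset ps)) = (\<Sum>L'\<in>#Ls. F L')" for F :: "_ \<Rightarrow> int"
        using ls(1) by (simp add: multiset.map_comp comp_def cong: image_mset_cong)
      show "z a = (\<Sum>ps\<in>#image_mset ls Ls. vec_of (move_entries M J l ps) a)"
      proof (cases "2 \<le> a \<and> a < addr l (M + J) M")
        case False
        then have "(\<Sum>ps\<in>#image_mset ls Ls. vec_of (move_entries M J l ps) a) = 0"
          using fst_less by (intro sum_mset.neutral) (auto intro!: vec_of_move_outside)
        moreover have "z a = 0" using z False unfolding in_kernel_def by blast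
        ultimately show ?thesis by simp
      next
        case True
        then have "2 \<le> a" "a < addr l (M + J) M" by auto
        with l show ?thesis
        proof (cases rule: address_cases)
          case (cell r k)
          have "(\<Sum>ps\<in>#image_mset ls Ls. vec_of (move_entries M J l ps) a) =
              (\<Sum>ps\<in>#image_mset ls Ls. \<Sum>p\<in>#mset ps. if fst p = k then snd p r else 0)"
            unfolding cell(3) using fst_less
            by (intro arg_cong[of _ _ sum_mset] image_mset_cong vec_of_move_cell[OF cell(1,2)]) auto
          also have "\<dots> = (\<Sum>p\<in>#L. if fst p = k then snd p r else 0)"
            unfolding Ls(1)[symmetric] sum_mset_Union by (rule split)
          finally show ?thesis using L_cell[OF cell(2)] cell by (simp add: y_def)
        next
          case (link i)
          have "(\<Sum>ps\<in>#image_mset ls Ls. vec_of (move_entries M J l ps) a) =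
              (\<Sum>ps\<in>#image_mset ls Ls. - (\<Sum>p\<in>#mset ps. snd p i))"
            unfolding link(2) using fst_less
            by (intro arg_cong[of _ _ sum_mset] image_mset_cong vec_of_move_link[OF link(1)]) auto
          also have "\<dots> = (\<Sum>L'\<in>#Ls. - (\<Sum>p\<in>#L'. snd p i))" by (rule split)
          also have "\<dots> = - (\<Sum>p\<in>#\<Sum>\<^sub># Ls. snd p i)"
            unfolding sum_mset_Union by (rule sum_mset_uminus)
          also have "\<dots> = - (\<Sum>p\<in>#L. snd p i)" unfolding Ls(1) ..
          finally show ?thesis using L_link[OF link(1)] link(2) by simp
        qed
      qed
    qed
  qed
qed

section \<open>Augmenting moves\<close>

lemma in_kernel_add:
  assumes "in_kernel M J A l y" "in_kernel M J A l z"
  shows "in_kernel M J A l (\<lambda>a. y a + z a)"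
  unfolding in_kernel_def
proof (intro conjI allI impI)
  fix j k assume "j < J" "k < l"
  then have "(\<Sum>i<M. A j i * y (addr l i k)) + y (addr l (M + j) k) = 0"
    "(\<Sum>i<M. A j i * z (addr l i k)) + z (addr l (M + j) k) = 0"
    using assms unfolding in_kernel_def by auto
  then show "(\<Sum>i<M. A j i * (y (addr l i k) + z (addr l i k))) +
      (y (addr l (M + j) k) + z (addr l (M + j) k)) = 0"
    by (simp add: distrib_left sum.distrib)
next
  fix i assume "i < M"
  then have "(\<Sum>k<l. y (addr l i k)) + y (addr l (M + J) i) = 0"
    "(\<Sum>k<l. z (addr l i k)) + z (addr l (M + J) i) = 0"
    using assms unfolding in_kernel_def by auto
  then show "(\<Sum>k<l. y (addr l i k) + z (addr l i k)) +
      (y (addr l (M + J) i) + z (addr l (M + J) i)) = 0"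
    by (simp add: sum.distrib)
qed (use assms in \<open>auto simp: in_kernel_def\<close>)

lemma in_kernel_scale:
  assumes "in_kernel M J A l z"
  shows "in_kernel M J A l (\<lambda>a. c * z a)"
  unfolding in_kernel_def
proof (intro conjI allI impI)
  fix j k assume "j < J" "k < l"
  then have "c * ((\<Sum>i<M. A j i * z (addr l i k)) + z (addr l (M + j) k)) = 0"
    using assms unfolding in_kernel_def by auto
  then show "(\<Sum>i<M. A j i * (c * z (addr l i k))) + c * z (addr l (M + j) k) = 0"
    by (simp add: distrib_left sum_distrib_left mult.left_commute)
next
  fix i assume "i < M"
  then have "c * ((\<Sum>k<l. z (addr l i k)) + z (addr l (M + J) i)) = 0"
    using assms unfolding in_kernel_def by auto
  then show "(\<Sum>k<l. c * z (addr l i k)) + c * z (addr l (M + J) i) = 0"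
    by (simp add: distrib_left sum_distrib_left)
qed (use assms in \<open>auto simp: in_kernel_def\<close>)

text \<open>In every layer the vectors placed there satisfy the layer equations, and sums of
  solutions are solutions; the linking equations hold by the choice of the last entries of the
  move.\<close>

lemma in_kernel_move:
  assumes ps: "\<And>p. p \<in> set ps \<Longrightarrow> fst p < l"
    and layer: "\<And>p. p \<in> set ps \<Longrightarrow> in_layer_kernel M J A (snd p)"
  shows "in_kernel M J A l (vec_of (move_entries M J l ps))"
  unfolding in_kernel_def
proof (intro conjI allI impI)
  fix a assume "\<not> (2 \<le> a \<and> a < addr l (M + J) M)"
  then show "vec_of (move_entries M J l ps) a = 0" using ps by (rule vec_of_move_outside)
next
  fix j k assume jk: "j < J" "k < l"
  have "(\<Sum>i<M. A j i * vec_of (move_entries M J l ps) (addr l i k)) =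
      (\<Sum>i<M. A j i * (\<Sum>p\<in>#mset ps. if fst p = k then snd p i else 0))"
    using jk ps by (intro sum.cong refl) (simp add: vec_of_move_cell)
  moreover have "vec_of (move_entries M J l ps) (addr l (M + j) k) =
      (\<Sum>p\<in>#mset ps. if fst p = k then snd p (M + j) else 0)"
    using jk ps by (simp add: vec_of_move_cell)
  moreover have "(\<Sum>i<M. A j i * (\<Sum>p\<in>#mset ps. if fst p = k then snd p i else 0)) +
      (\<Sum>p\<in>#mset ps. if fst p = k then snd p (M + j) else 0) = 0"
    using layer
  proof (induction ps)
    case (Cons p ps)
    have "(\<Sum>i<M. A j i * snd p i) + snd p (M + j) = 0"
      using Cons.prems jk(1) by (simp add: in_layer_kernel_def)
    then show ?case using Cons by (simp add: distrib_left sum.distrib)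
  qed simp
  ultimately show "(\<Sum>i<M. A j i * vec_of (move_entries M J l ps) (addr l i k)) +
      vec_of (move_entries M J l ps) (addr l (M + j) k) = 0" by simp
next
  fix i assume i: "i < M"
  have "(\<Sum>k<l. vec_of (move_entries M J l ps) (addr l i k)) =
      (\<Sum>k<l. \<Sum>p\<in>#mset ps. if fst p = k then snd p i else 0)"
    using i ps by (intro sum.cong refl) (simp add: vec_of_move_cell)
  also have "\<dots> = (\<Sum>p\<in>#mset ps. snd p i)"
    using ps by (induction ps) (simp_all add: sum.distrib)
  finally show "(\<Sum>k<l. vec_of (move_entries M J l ps) (addr l i k)) +
      vec_of (move_entries M J l ps) (addr l (M + J) i) = 0"
    using vec_of_move_link[OF i ps] by simp
qed

text \<open>The layers touched by a move are the base-\<open>l\<close> digits of a single number, which the program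
  enumerates.\<close>

definition choose_layers :: "nat \<Rightarrow> nat \<Rightarrow> (nat \<Rightarrow> int) list \<Rightarrow> (nat \<times> (nat \<Rightarrow> int)) list" where
  "choose_layers l q vs = zip (map (\<lambda>j. q div l ^ j mod l) [0..<length vs]) vs"

lemma map_snd_choose_layers [simp]: "map snd (choose_layers l q vs) = vs"
  by (simp add: choose_layers_def)

lemma choose_layers_less: "l \<ge> 1 \<Longrightarrow> p \<in> set (choose_layers l q vs) \<Longrightarrow> fst p < l"
  unfolding choose_layers_def by (cases p) (auto dest!: set_zip_leftD)

lemma digits_exist:
  fixes l :: nat
  assumes "\<And>k. k \<in> set ks \<Longrightarrow> k < l" "l \<ge> 1"
  shows "\<exists>q < l ^ length ks. map (\<lambda>j. q div l ^ j mod l) [0..<length ks] = ks"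
  using assms(1)
proof (induction ks)
  case (Cons k ks)
  then obtain q where q: "q < l ^ length ks" "map (\<lambda>j. q div l ^ j mod l) [0..<length ks] = ks"
    by auto
  have k: "k < l" using Cons.prems by simp
  have "k + l * q < l * Suc q" using k by simp
  also have "\<dots> \<le> l * l ^ length ks" using q(1) by (intro mult_le_mono2) simp
  finally have "k + l * q < l ^ length (k # ks)" by simp
  moreover have "(k + l * q) div l ^ Suc j = q div l ^ j" for j
    using k by (simp add: div_mult2_eq)
  then have "map (\<lambda>j. (k + l * q) div l ^ j mod l) [0..<length (k # ks)] = k # ks"
    using q(2) k by (simp add: upt_conv_Cons map_Suc_upt[symmetric] comp_def del: upt_Suc
        map_Suc_upt power_Suc)
  ultimately show ?case by (intro exI[of _ "k + l * q"] conjI)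
qed simp

text \<open>One bound \<open>g\<close> on all tuple lengths allows a common range of codes for
  tuples of different length.\<close>

lemma choose_layers_exists:
  assumes "l \<ge> 1" "\<And>p. p \<in> set ps \<Longrightarrow> fst p < l" "length ps \<le> g"
  shows "\<exists>q < l ^ g. ps = choose_layers l q (map snd ps)"
proof -
  have "\<exists>q < l ^ length (map fst ps). map (\<lambda>j. q div l ^ j mod l) [0..<length (map fst ps)] =
      map fst ps"
    using assms(1,2) by (intro digits_exist) auto
  then obtain q where "q < l ^ length ps" "map (\<lambda>j. q div l ^ j mod l) [0..<length ps] = map fst ps"
    by auto
  then have "ps = choose_layers l q (map snd ps)"
    by (simp add: choose_layers_def zip_map_fst_snd)
  moreover have "l ^ length ps \<le> l ^ g" using assms(1,3) by (intro power_increasing) auto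
  ultimately show ?thesis using \<open>q < l ^ length ps\<close> by (meson less_le_trans)
qed

text \<open>The range starts at 2 because cells 0 and 1 are reserved: for the length and
  \<open>l\<close> in the input, for the length and the answer tag in the output.\<close>

definition linear_cost :: "(int \<Rightarrow> int) \<Rightarrow> int \<Rightarrow> (int \<Rightarrow> int) \<Rightarrow> int" where
  "linear_cost w n X = (\<Sum>a\<in>{2..<n}. w a * X a)"

lemma linear_cost_add: "linear_cost w n (\<lambda>a. X a + c * h a) = linear_cost w n X +
    c * linear_cost w n h"
  by (simp add: linear_cost_def distrib_left sum.distrib sum_distrib_left mult.left_commute)

lemma linear_cost_sum_mset:
  "linear_cost w n (\<lambda>a. \<Sum>x\<in>#L. f x a) = (\<Sum>x\<in>#L. linear_cost w n (f x))"
  by (induction L) (simp_all add: linear_cost_def distrib_left sum.distrib)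

text \<open>Grouping equal moves makes the number of distinct moves enter the estimate, instead of
  the size of the decomposition, which grows with the data.\<close>

lemma sum_mset_eq_sum_count:
  "(\<Sum>x\<in>#L. f x) = (\<Sum>x\<in>set_mset L. int (count L x) * f x)"
proof (induction L)
  case (add y L)
  show ?case
  proof (cases "y \<in># L")
    case True
    then have "set_mset (add_mset y L) = set_mset L" by auto
    moreover have "(\<Sum>x\<in>set_mset L. int (count (add_mset y L) x) * f x) =
        (\<Sum>x\<in>set_mset L. int (count L x) * f x + (if x = y then f x else 0))"
      by (intro sum.cong) (auto simp: algebra_simps)
    ultimately show ?thesis using True add by (simp add: sum.distrib)
  next
    case False
    have "(\<Sum>x\<in>set_mset L. int (count (add_mset y L) x) * f x) =
        (\<Sum>x\<in>set_mset L. int (count L x) * f x)"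
      using False by (intro sum.cong) auto
    then show ?thesis using False add by (simp add: not_in_iff)
  qed
qed simp

text \<open>Take the least \<open>n\<close> whose quotient is at most \<open>m\<close>. If
  \<open>n\<close> is positive, the preceding quotient is at least \<open>m + 1\<close>, so even
  after the rounding in its halving, twice the result is at least \<open>m\<close>.\<close>

lemma halving_approx:
  fixes T m :: int
  assumes "1 \<le> m" "m \<le> T"
  shows "\<exists>n. T div 2 ^ n \<le> m \<and> m \<le> 2 * (T div 2 ^ n)"
proof -
  have "T < 2 ^ nat T" using assms
    by (metis (mono_tags, lifting)
        less_exp nat_less_iff of_nat_less_numeral_power_cancel_iff order_trans zero_le_one
        nat_0_le of_nat_less_iff of_nat_numeral of_nat_power)
  then have "\<exists>n. T div 2 ^ n \<le> m" using assms by (intro exI[of _ "nat T"]) simp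
  define n where "n = (LEAST n. T div 2 ^ n \<le> m)"
  have n: "T div 2 ^ n \<le> m" "\<And>i. i < n \<Longrightarrow> \<not> T div 2 ^ i \<le> m"
    unfolding n_def using LeastI_ex[OF \<open>\<exists>n. T div 2 ^ n \<le> m\<close>] not_less_Least by blast+
  have "m \<le> 2 * (T div 2 ^ n)"
  proof (cases n)
    case 0
    then show ?thesis using n assms by simp
  next
    case (Suc i)
    have "m < T div 2 ^ i" using n(2)[of i] Suc by simp
    moreover have "T div 2 ^ n = T div 2 ^ i div 2"
      using Suc by (simp add: div_mult2_eq[symmetric] zdiv_zmult2_eq[symmetric] mult.commute)
    ultimately show ?thesis by linarith
  qed
  then show ?thesis using n(1) by blast
qed

text \<open>Each distinct move in the decomposition of \<open>Y - X\<close> admits a feasible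
  rounded step, which by \<open>stuck\<close> gains at most \<open>D - 1\<close>; its full
  multiplicity gains at most twice that. Integrality gives \<open>D - 1\<close> in place of
  \<open>D\<close>, so \<open>D = 1\<close> already means optimality.\<close>

theorem no_augmentation_imp_near_optimal:
  assumes dec: "\<And>z. in_kernel M J A l z \<Longrightarrow> \<exists>Ls. decomposed M J vss l Ls z"
    and l: "l \<ge> 1" and g: "\<And>vs. vs \<in> set vss \<Longrightarrow> length vs \<le> g"
    and z: "in_kernel M J A l (\<lambda>a. Y a - X a)"
    and X: "\<And>a. 0 \<le> X a" "\<And>a. X a \<le> T" and Y: "\<And>a. 0 \<le> Y a" "\<And>a. Y a \<le> T"
    and stuck: "\<And>n q vs. q < l ^ g \<Longrightarrow> vs \<in> set vss \<Longrightarrow>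
        (\<And>a. 0 \<le> X a + T div 2 ^ n * vec_of (move_entries M J l (choose_layers l q vs)) a) \<Longrightarrow>
        - (T div 2 ^ n * linear_cost w N (vec_of (move_entries M J l (choose_layers l q vs)))) < D"
    and D: "D \<ge> 1"
  shows "linear_cost w N X - linear_cost w N Y \<le> 2 * int (l ^ g * length vss) * (D - 1)"
proof -
  define h where "h ps = vec_of (move_entries M J l ps)" for ps
  define c where "c = linear_cost w N"
  obtain Ls where Ls: "\<And>ps. ps \<in># Ls \<Longrightarrow> map snd ps \<in> set vss"
      "\<And>ps p. ps \<in># Ls \<Longrightarrow> p \<in> set ps \<Longrightarrow> fst p < l"
      "\<And>ps a. ps \<in># Ls \<Longrightarrow> conformal (h ps a) (Y a - X a)"
    and sum: "\<And>a. Y a - X a = (\<Sum>ps\<in>#Ls. h ps a)"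
    using dec[OF z] unfolding decomposed_def h_def by metis
  have bound: "- (int (count Ls ps) * c (h ps)) \<le> 2 * (D - 1)" if ps: "ps \<in># Ls" for ps
  proof (cases "c (h ps) \<ge> 0")
    case True
    then have "0 \<le> int (count Ls ps) * c (h ps)" by simp
    moreover have "0 \<le> 2 * (D - 1)" using D by simp
    ultimately show ?thesis by (meson neg_le_0_iff_le order_trans)
  next
    case False
    define m where "m = int (count Ls ps)"
    \<comment> \<open>The copies of \<open>ps\<close> alone form a sub-multiset of
      \<open>Ls\<close>.\<close>
    have conf: "conformal (m * h ps a) (Y a - X a)" for a
    proof -
      have "conformal (\<Sum>x\<in>#replicate_mset (count Ls ps) ps. h x a) (\<Sum>x\<in>#Ls. h x a)"
        using Ls(3) sum by (intro conformal_sum_mset)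
            (auto simp: count_le_replicate_mset_subset_eq[symmetric])
      then show ?thesis using sum[of a] by (simp add: m_def)
    qed
    \<comment> \<open>A move with nonzero cost has a nonzero entry, and any such entry bounds the
      multiplicity by \<open>T\<close>.\<close>
    have "\<exists>a. h ps a \<noteq> 0"
    proof (rule ccontr)
      assume "\<not> ?thesis"
      then have "c (h ps) = 0" by (simp add: c_def linear_cost_def)
      then show False using False by simp
    qed
    then obtain a where a: "h ps a \<noteq> 0" by blast
    have m: "1 \<le> m" using ps by (simp add: m_def Suc_le_eq)
    have "m \<le> m * \<bar>h ps a\<bar>" using m a by (simp add: mult_le_cancel_left1)
    also have "\<dots> = \<bar>m * h ps a\<bar>" using m by (simp add: abs_mult)
    also have "\<dots> \<le> \<bar>Y a - X a\<bar>" using conf[of a] unfolding conformal_def by linarith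
    also have "\<dots> \<le> T" using X[of a] Y[of a] by linarith
    finally have "m \<le> T" .
    from halving_approx[OF m this] obtain n where n: "T div 2 ^ n \<le> m" "m \<le> 2 * (T div 2 ^ n)"
        by blast
    obtain q where q: "q < l ^ g" "ps = choose_layers l q (map snd ps)"
      using choose_layers_exists[OF l Ls(2)[OF ps], where g = g] g[OF Ls(1)[OF ps]] by auto
    have pos: "0 \<le> T div 2 ^ n" using n m by linarith
    have nonneg: "0 \<le> X a + T div 2 ^ n * h ps a" for a
    proof (cases "h ps a \<ge> 0")
      case True
      then show ?thesis using X(1)[of a] pos by simp
    next
      case False
      \<comment> \<open>In a decreasing coordinate the shorter step goes no lower than
        \<open>m\<close> copies of the move, and these go no lower than \<open>Y a\<close>.\<close>
      then have "m * h ps a \<le> T div 2 ^ n * h ps a" using n(1) by (simp add: mult_le_cancel_right)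
      moreover have "m * h ps a < 0" using False m by (simp add: mult_less_0_iff)
      then have "Y a - X a \<le> m * h ps a" using conf[of a] unfolding conformal_def by linarith
      ultimately show ?thesis using Y(1)[of a] by linarith
    qed
    have "- (T div 2 ^ n * c (h ps)) < D"
      using stuck[OF q(1) Ls(1)[OF ps], of n] nonneg unfolding q(2)[symmetric] h_def c_def by blast
    moreover have "m * (- c (h ps)) \<le> 2 * (T div 2 ^ n) * (- c (h ps))"
      using n(2) False by (intro mult_right_mono) auto
    ultimately show ?thesis unfolding m_def[symmetric] by simp
  qed
  have "set_mset Ls \<subseteq> (\<lambda>(q, vs). choose_layers l q vs) ` ({..<l ^ g} \<times> set vss)"
  proof
    fix ps assume ps: "ps \<in># Ls"
    obtain q where "q < l ^ g" "ps = choose_layers l q (map snd ps)"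
      using choose_layers_exists[OF l Ls(2)[OF ps], where g = g] g[OF Ls(1)[OF ps]] by auto
    then show "ps \<in> (\<lambda>(q, vs). choose_layers l q vs) ` ({..<l ^ g} \<times> set vss)"
      using Ls(1)[OF ps] by (intro image_eqI[of _ _ "(q, map snd ps)"]) auto
  qed
  then have "card (set_mset Ls) \<le> card ({..<l ^ g} \<times> set vss)"
    by (intro surj_card_le) auto
  also have "\<dots> \<le> l ^ g * length vss"
    by (simp add: card_cartesian_product card_length)
  finally have card: "card (set_mset Ls) \<le> l ^ g * length vss" .
  have "c X - c Y = - c (\<lambda>a. Y a - X a)"
    by (simp add: c_def linear_cost_def right_diff_distrib sum_subtractf)
  also have "(\<lambda>a. Y a - X a) = (\<lambda>a. \<Sum>ps\<in>#Ls. h ps a)" using sum by blast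
  also have "c \<dots> = (\<Sum>ps\<in>set_mset Ls. int (count Ls ps) * c (h ps))"
    unfolding c_def linear_cost_sum_mset by (rule sum_mset_eq_sum_count)
  also have "- \<dots> = (\<Sum>ps\<in>set_mset Ls. - (int (count Ls ps) * c (h ps)))"
    by (simp add: sum_negf)
  also have "\<dots> \<le> (\<Sum>ps\<in>set_mset Ls. 2 * (D - 1))" by (intro sum_mono bound) auto
  also have "\<dots> = int (card (set_mset Ls)) * (2 * (D - 1))" by simp
  also have "\<dots> \<le> int (l ^ g * length vss) * (2 * (D - 1))"
    using card D by (intro mult_right_mono) (auto simp del: of_nat_mult of_nat_power)
  finally show ?thesis unfolding c_def by (simp add: algebra_simps)
qed

section \<open>The cost of structured programs\<close>

text \<open>Bounding contents is enough: an address is itself the value of an expression, so its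
  length is controlled through the contents it reads.\<close>

definition mem_bounded :: "nat \<Rightarrow> memory \<Rightarrow> bool" where
  "mem_bounded \<beta> s \<longleftrightarrow> (\<forall>a i. \<bar>s a i\<bar> \<le> 2 ^ \<beta>)"

lemma mem_bounded_mono:
  assumes "mem_bounded \<beta> s" "\<beta> \<le> \<gamma>"
  shows "mem_bounded \<gamma> s"
proof -
  have "(2 :: int) ^ \<beta> \<le> 2 ^ \<gamma>" using assms(2) by (intro power_increasing) auto
  then show ?thesis using assms(1) unfolding mem_bounded_def by (meson order_trans)
qed

lemma mem_bounded_upd:
  "mem_bounded \<beta> s \<Longrightarrow> \<bar>v\<bar> \<le> 2 ^ \<beta> \<Longrightarrow> mem_bounded \<beta> (s(a := (s a)(i := v)))"
  unfolding mem_bounded_def by auto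

text \<open>The value \<open>2 ^ m\<close> itself has \<open>m + 1\<close> digits; the remaining
  unit is the sign bit.\<close>

lemma bits_le: "\<bar>z\<bar> \<le> 2 ^ m \<Longrightarrow> bits z \<le> m + 2"
proof -
  assume "\<bar>z\<bar> \<le> 2 ^ m"
  then have "nat \<bar>z\<bar> \<le> nat (2 ^ m)" by (rule nat_mono)
  also have "nat (2 ^ m) = 2 ^ m" by (simp add: nat_power_eq)
  also have "(2 :: nat) ^ m < 2 ^ (m + 1)" by simp
  finally have "floorlog 2 (nat \<bar>z\<bar>) \<le> m + 1" by (intro floorlog_leI) auto
  then show ?thesis unfolding bits_def bitlen_def by simp
qed

lemma abs_div_le:
  fixes x y :: int
  shows "\<bar>x div y\<bar> \<le> \<bar>x\<bar>"
proof -
  have pos: "\<bar>x div y\<bar> \<le> \<bar>x\<bar>" if y: "y > 0" for x y :: int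
  proof -
    have "x div y \<le> \<bar>x\<bar> div y" using y by (intro zdiv_mono1) auto
    also have "\<bar>x\<bar> div y \<le> \<bar>x\<bar>" using zdiv_mono2[of "\<bar>x\<bar>" 1 y] y by simp
    finally have upper: "x div y \<le> \<bar>x\<bar>" .
    have "\<bar>x\<bar> * 1 \<le> \<bar>x\<bar> * y" using y by (intro mult_left_mono) auto
    then have "- \<bar>x\<bar> * y \<le> x" by linarith
    then have "- \<bar>x\<bar> * y div y \<le> x div y" using y by (rule zdiv_mono1)
    moreover have "- \<bar>x\<bar> * y div y = - \<bar>x\<bar>" using y by (intro nonzero_mult_div_cancel_right) auto
    ultimately show ?thesis using upper by linarith
  qed
  consider "y > 0" | "y = 0" | "- y > 0" by linarith
  then show ?thesis
  proof cases
    case 3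
    then show ?thesis using pos[OF 3, of "- x"] by simp
  qed (use pos in auto)
qed

text \<open>One common exponent for all four operations allows a single argument for every binary
  node in \<open>aexp_bound\<close>.\<close>

lemma operation_bounds:
  fixes x y :: int
  assumes x: "\<bar>x\<bar> \<le> 2 ^ m" and y: "\<bar>y\<bar> \<le> 2 ^ n"
  shows "\<bar>x + y\<bar> \<le> 2 ^ (m + n + 1)" "\<bar>x - y\<bar> \<le> 2 ^ (m + n + 1)"
    "\<bar>x * y\<bar> \<le> 2 ^ (m + n + 1)" "\<bar>x div y\<bar> \<le> 2 ^ (m + n + 1)"
proof -
  have le: "(2 :: int) ^ m \<le> 2 ^ (m + n)" "(2 :: int) ^ n \<le> 2 ^ (m + n)"
      "(2 :: int) ^ (m + n) \<le> 2 ^ (m + n + 1)"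
    by (intro power_increasing; simp)+
  have two: "(2 :: int) ^ (m + n + 1) = 2 * 2 ^ (m + n)" by simp
  show "\<bar>x + y\<bar> \<le> 2 ^ (m + n + 1)" "\<bar>x - y\<bar> \<le> 2 ^ (m + n + 1)"
    using x y le two by linarith+
  have "\<bar>x * y\<bar> \<le> 2 ^ m * 2 ^ n" unfolding abs_mult using x y by (intro mult_mono) auto
  also have "\<dots> = 2 ^ (m + n)" by (simp add: power_add)
  finally show "\<bar>x * y\<bar> \<le> 2 ^ (m + n + 1)" using le by linarith
  show "\<bar>x div y\<bar> \<le> 2 ^ (m + n + 1)" using abs_div_le[of x y] x le by linarith
qed

text \<open>Requiring \<open>\<beta>\<close> to be at least 1 lets additive constants be absorbed
  into the factor.\<close>

definition aexp_linear :: "nat \<Rightarrow> aexp \<Rightarrow> bool" where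
  "aexp_linear \<kappa> e \<longleftrightarrow>
     (\<forall>\<beta>\<ge>1. \<forall>s. mem_bounded \<beta> s \<longrightarrow> \<bar>aval e s\<bar> \<le> 2 ^ (\<kappa> * \<beta>) \<and> acost e s \<le> \<kappa> * \<beta>)"

lemma aexp_bound: "\<exists>\<kappa>. aexp_linear \<kappa> e"
proof -
  have binary: "\<exists>\<kappa>. aexp_linear \<kappa> e"
    if e: "\<And>s. aval e s = f (aval e1 s) (aval e2 s)"
      "\<And>s. acost e s = acost e1 s + acost e2 s + bits (aval e s)"
      and f: "\<And>x y m n. \<bar>x\<bar> \<le> 2 ^ m \<Longrightarrow> \<bar>y\<bar> \<le> 2 ^ n \<Longrightarrow> \<bar>f x y\<bar> \<le> 2 ^ (m + n + 1)"
      and k1: "aexp_linear k1 e1"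
      and k2: "aexp_linear k2 e2"
    for f e e1 e2 k1 k2
    unfolding aexp_linear_def
  proof (intro exI[of _ "2 * (k1 + k2) + 3"] allI impI conjI)
    fix \<beta> :: nat and s assume \<beta>: "1 \<le> \<beta>" and s: "mem_bounded \<beta> s"
    have 1: "\<bar>aval e1 s\<bar> \<le> 2 ^ (k1 * \<beta>)" "acost e1 s \<le> k1 * \<beta>"
      using k1 \<beta> s by (auto simp: aexp_linear_def)
    have 2: "\<bar>aval e2 s\<bar> \<le> 2 ^ (k2 * \<beta>)" "acost e2 s \<le> k2 * \<beta>"
      using k2 \<beta> s by (auto simp: aexp_linear_def)
    have v: "\<bar>aval e s\<bar> \<le> 2 ^ (k1 * \<beta> + k2 * \<beta> + 1)" unfolding e using f 1 2 by blast
    have "k1 * \<beta> + k2 * \<beta> + 1 \<le> (2 * (k1 + k2) + 3) * \<beta>" using \<beta> by (simp add: algebra_simps)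
    then have "(2 :: int) ^ (k1 * \<beta> + k2 * \<beta> + 1) \<le> 2 ^ ((2 * (k1 + k2) + 3) * \<beta>)"
      by (intro power_increasing) auto
    then show "\<bar>aval e s\<bar> \<le> 2 ^ ((2 * (k1 + k2) + 3) * \<beta>)" using v by linarith
    have "bits (aval e s) \<le> k1 * \<beta> + k2 * \<beta> + 3" using bits_le[OF v] by simp
    then show "acost e s \<le> (2 * (k1 + k2) + 3) * \<beta>"
      unfolding e(2) using 1 2 \<beta> by (simp add: algebra_simps)
  qed
  show ?thesis
  proof (induction e)
    case (Const z)
    show ?case
      unfolding aexp_linear_def
    proof (intro exI[of _ "nat \<bar>z\<bar> + bits z"] allI impI conjI)
      fix \<beta> :: nat and s assume \<beta>: "1 \<le> \<beta>"
      have le: "n \<le> n * \<beta>" for n using \<beta> by simp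
      have "\<bar>z\<bar> = int (nat \<bar>z\<bar>)" by simp
      also have "\<dots> \<le> 2 ^ nat \<bar>z\<bar>" using less_exp[of "nat \<bar>z\<bar>"]
        by (metis less_imp_le of_nat_le_iff of_nat_numeral of_nat_power)
      also have "(2 :: int) ^ nat \<bar>z\<bar> \<le> 2 ^ ((nat \<bar>z\<bar> + bits z) * \<beta>)"
      proof (intro power_increasing)
        show "nat \<bar>z\<bar> \<le> (nat \<bar>z\<bar> + bits z) * \<beta>"
          by (rule order_trans[OF le_add1 le])
      qed simp
      finally show "\<bar>aval (Const z) s\<bar> \<le> 2 ^ ((nat \<bar>z\<bar> + bits z) * \<beta>)" by simp
      show "acost (Const z) s \<le> (nat \<bar>z\<bar> + bits z) * \<beta>"
        unfolding acost.simps by (rule order_trans[OF le_add2 le])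
    qed
  next
    case (Cell a e)
    then obtain k where k: "aexp_linear k e" by (elim exE)
    show ?case
      unfolding aexp_linear_def
    proof (intro exI[of _ "k + 3"] allI impI conjI)
      fix \<beta> :: nat and s assume \<beta>: "1 \<le> \<beta>" and s: "mem_bounded \<beta> s"
      have v: "\<bar>aval (Cell a e) s\<bar> \<le> 2 ^ \<beta>" using s by (simp add: mem_bounded_def)
      have "\<beta> \<le> (k + 3) * \<beta>" by simp
      then have "(2 :: int) ^ \<beta> \<le> 2 ^ ((k + 3) * \<beta>)" by (intro power_increasing) auto
      then show "\<bar>aval (Cell a e) s\<bar> \<le> 2 ^ ((k + 3) * \<beta>)" using v by linarith
      have "acost e s \<le> k * \<beta>" using k \<beta> s by (auto simp: aexp_linear_def)
      then show "acost (Cell a e) s \<le> (k + 3) * \<beta>"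
          using bits_le[OF v] \<beta> by (simp add: algebra_simps)
    qed
  next
    case (Add e1 e2)
    then show ?case
      by (elim exE) (rule binary[where f =
          "(+)", OF aval.simps(3) acost.simps(3) operation_bounds(1)])
  next
    case (Sub e1 e2)
    then show ?case
      by (elim exE) (rule binary[where f =
          "(-)", OF aval.simps(4) acost.simps(4) operation_bounds(2)])
  next
    case (Mul e1 e2)
    then show ?case
      by (elim exE) (rule binary[where f =
          "(*)", OF aval.simps(5) acost.simps(5) operation_bounds(3)])
  next
    case (Div e1 e2)
    then show ?case
      by (elim exE) (rule binary[where f =
          "(div)", OF aval.simps(6) acost.simps(6) operation_bounds(4)])
  qed
qed

text \<open>A constant determined by the program text; choosing it abstractly keeps all later time
  bounds free of numerals.\<close>

definition aexp_factor :: "aexp \<Rightarrow> nat" where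
  "aexp_factor e = (SOME \<kappa>. aexp_linear \<kappa> e)"

lemma aexp_factor:
  assumes "1 \<le> \<beta>" "mem_bounded \<beta> s"
  shows "\<bar>aval e s\<bar> \<le> 2 ^ (aexp_factor e * \<beta>)" "acost e s \<le> aexp_factor e * \<beta>"
  using someI_ex[OF aexp_bound[of e], folded aexp_factor_def] assms by (auto simp: aexp_linear_def)

section \<open>Loop-free programs as memory transformers\<close>

fun loop_free :: "com \<Rightarrow> bool" where
  "loop_free Skip \<longleftrightarrow> True"
| "loop_free (Assign a e f) \<longleftrightarrow> True"
| "loop_free (Seq P Q) \<longleftrightarrow> loop_free P \<and> loop_free Q"
| "loop_free (Cond e P Q) \<longleftrightarrow> loop_free P \<and> loop_free Q"
| "loop_free (While e P) \<longleftrightarrow> False"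

fun effect :: "com \<Rightarrow> memory \<Rightarrow> memory" where
  "effect Skip s = s"
| "effect (Assign a e f) s = s(a := (s a)(aval e s := aval f s))"
| "effect (Seq P Q) s = effect Q (effect P s)"
| "effect (Cond e P Q) s = (if aval e s > 0 then effect P s else effect Q s)"
| "effect (While e P) s = s"

definition com_linear :: "nat \<Rightarrow> com \<Rightarrow> bool" where
  "com_linear \<kappa> P \<longleftrightarrow> (\<forall>\<beta>\<ge>1. \<forall>s. mem_bounded \<beta> s \<longrightarrow>
     (\<exists>t. exec P s t (effect P s) \<and> t \<le> \<kappa> * \<beta>) \<and> mem_bounded (\<kappa> * \<beta>) (effect P s))"

lemma com_linearD:
  assumes "com_linear \<kappa> P" "1 \<le> \<beta>" "mem_bounded \<beta> s"
  shows "\<exists>t. exec P s t (effect P s) \<and> t \<le> \<kappa> * \<beta> \<and> mem_bounded (\<kappa> * \<beta>) (effect P s)"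
  using assms unfolding com_linear_def by blast

text \<open>Loop-free code multiplies the length of the numbers in memory by a constant at most. So its
  running time is linear in that length, and bounds on the memory are only needed at loop heads.\<close>

lemma loop_free_bound:
  assumes "loop_free P"
  shows "\<exists>\<kappa>. com_linear \<kappa> P"
  using assms
proof (induction P)
  case Skip
  show ?case
    unfolding com_linear_def
    by (intro exI[of _ 1] allI impI conjI) (auto intro!: exI[of _
        "Suc 0"] exec_Skip[unfolded One_nat_def])
next
  case (Assign a e f)
  show ?case
    unfolding com_linear_def
  proof (intro exI[of _ "aexp_factor e + aexp_factor f + 1"] allI impI)
    fix \<beta> :: nat and s assume \<beta>: "1 \<le> \<beta>" and s: "mem_bounded \<beta> s"
    let ?k = "aexp_factor e + aexp_factor f + 1"
    have run: "\<exists>t. exec (Assign a e f) s t (effect (Assign a e f) s) \<and> t \<le> ?k * \<beta>"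
      unfolding effect.simps
      by (rule exI, rule conjI, rule exec_Assign)
        (use aexp_factor(2)[OF \<beta> s, of e] aexp_factor(2)[OF \<beta> s, of f] in \<open>simp add: algebra_simps\<close>)
    have "\<bar>aval f s\<bar> \<le> 2 ^ (aexp_factor f * \<beta>)" using aexp_factor(1)[OF \<beta> s] .
    also have "(2 :: int) ^ (aexp_factor f * \<beta>) \<le> 2 ^ (?k * \<beta>)"
      by (intro power_increasing) (auto simp: algebra_simps)
    finally have "mem_bounded (?k * \<beta>) (effect (Assign a e f) s)"
      using mem_bounded_mono[OF s, of "?k * \<beta>"] unfolding effect.simps
      by (intro mem_bounded_upd) auto
    with run show "(\<exists>t. exec (Assign a e f) s t (effect (Assign a e f) s) \<and> t \<le> ?k * \<beta>) \<and>
        mem_bounded (?k * \<beta>) (effect (Assign a e f) s)" ..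
  qed
next
  case (Seq P Q)
  then obtain k1 k2 where "com_linear k1 P" "com_linear k2 Q" by auto
  note k1 = com_linearD[OF this(1)] and k2 = com_linearD[OF this(2)]
  show ?case
    unfolding com_linear_def
  \<comment> \<open>After \<open>P\<close> the memory is bounded with exponent
    \<open>k1 * \<beta>\<close>. It is enlarged to \<open>(k1 + 1) * \<beta>\<close>, which is
    positive even for \<open>k1 = 0\<close>, before the bound for \<open>Q\<close> is
    applied.\<close>
  proof (intro exI[of _ "k1 + k2 * (k1 + 1)"] allI impI)
    fix \<beta> :: nat and s assume \<beta>: "1 \<le> \<beta>" and s: "mem_bounded \<beta> s"
    obtain t1 where t1: "exec P s t1 (effect P s)" "t1 \<le> k1 * \<beta>" "mem_bounded (k1 * \<beta>) (effect P s)"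
      using k1[OF \<beta> s] by blast
    have s1: "mem_bounded ((k1 + 1) * \<beta>) (effect P s)" using t1(3) by (rule mem_bounded_mono) simp
    have "1 \<le> (k1 + 1) * \<beta>" using \<beta> by simp
    from k2[OF this s1] obtain t2 where t2: "exec Q (effect P s) t2 (effect Q (effect P s))"
        "t2 \<le> k2 * ((k1 + 1) * \<beta>)" "mem_bounded (k2 * ((k1 + 1) * \<beta>)) (effect Q (effect P s))"
      by blast
    have "exec (Seq P Q) s (t1 + t2) (effect (Seq P Q) s)" using exec_Seq[OF t1(1) t2(1)] by simp
    moreover have "t1 + t2 \<le> (k1 + k2 * (k1 + 1)) * \<beta>"
      using t1(2) t2(2) by (simp add: algebra_simps)
    moreover have "mem_bounded ((k1 + k2 * (k1 + 1)) * \<beta>) (effect (Seq P Q) s)"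
      unfolding effect.simps by (rule mem_bounded_mono[OF t2(3)]) (simp add: algebra_simps)
    ultimately show "(\<exists>t. exec (Seq P Q) s t (effect (Seq P Q) s) \<and> t \<le> (k1 + k2 * (k1 + 1)) * \<beta>) \<and>
        mem_bounded ((k1 + k2 * (k1 + 1)) * \<beta>) (effect (Seq P Q) s)" by blast
  qed
next
  case (Cond e P Q)
  then obtain k1 k2 where "com_linear k1 P" "com_linear k2 Q" by auto
  note k1 = com_linearD[OF this(1)] and k2 = com_linearD[OF this(2)]
  show ?case
    unfolding com_linear_def
  proof (intro exI[of _ "aexp_factor e + k1 + k2"] allI impI)
    fix \<beta> :: nat and s assume \<beta>: "1 \<le> \<beta>" and s: "mem_bounded \<beta> s"
    let ?k = "aexp_factor e + k1 + k2"
    have e: "acost e s \<le> aexp_factor e * \<beta>" using aexp_factor(2)[OF \<beta> s] .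
    show "(\<exists>t. exec (Cond e P Q) s t (effect (Cond e P Q) s) \<and> t \<le> ?k * \<beta>) \<and>
        mem_bounded (?k * \<beta>) (effect (Cond e P Q) s)"
    proof (cases "aval e s > 0")
      case True
      obtain t where t: "exec P s t (effect P s)" "t \<le> k1 * \<beta>" "mem_bounded (k1 * \<beta>) (effect P s)"
        using k1[OF \<beta> s] by blast
      have "acost e s + t \<le> ?k * \<beta>" using e t(2) by (simp add: algebra_simps)
      moreover have "mem_bounded (?k * \<beta>) (effect P s)"
        by (rule mem_bounded_mono[OF t(3)]) (simp add: algebra_simps)
      ultimately show ?thesis using exec_CondT[OF True t(1)] True by auto
    next
      case False
      obtain t where t: "exec Q s t (effect Q s)" "t \<le> k2 * \<beta>" "mem_bounded (k2 * \<beta>) (effect Q s)"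
        using k2[OF \<beta> s] by blast
      have "acost e s + t \<le> ?k * \<beta>" using e t(2) by (simp add: algebra_simps)
      moreover have "mem_bounded (?k * \<beta>) (effect Q s)"
        by (rule mem_bounded_mono[OF t(3)]) (simp add: algebra_simps)
      ultimately show ?thesis using exec_CondF[OF False t(1)] False by auto
    qed
  qed
qed simp

definition time_factor :: "com \<Rightarrow> nat" where
  "time_factor P = (SOME \<kappa>. com_linear \<kappa> P)"

text \<open>A total-correctness judgement with a time bound; termination is part of the
  existential.\<close>

definition runs :: "com \<Rightarrow> memory \<Rightarrow> nat \<Rightarrow> (memory \<Rightarrow> bool) \<Rightarrow> bool" where
  "runs P s b R \<longleftrightarrow> (\<exists>t s'. exec P s t s' \<and> t \<le> b \<and> R s')"

lemma runs_loop_free: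
  assumes "loop_free P" "1 \<le> \<beta>" "mem_bounded \<beta> s" "R (effect P s)"
  shows "runs P s (time_factor P * \<beta>) R"
  unfolding runs_def
  using com_linearD[OF someI_ex[OF loop_free_bound[OF assms(1)],
      folded time_factor_def] assms(2,3)] assms(4)
  by blast

lemma runs_mono: "runs P s b R \<Longrightarrow> b \<le> c \<Longrightarrow> (\<And>s'. R s' \<Longrightarrow> R' s') \<Longrightarrow> runs P s c R'"
  unfolding runs_def by (meson order_trans)

lemma runs_Seq:
  assumes "runs P s b R" "\<And>s'. R s' \<Longrightarrow> runs Q s' c R'"
  shows "runs (Seq P Q) s (b + c) R'"
  using assms unfolding runs_def by (meson add_mono exec_Seq)

lemma runs_Cond:
  assumes "acost e s \<le> k" "aval e s > 0 \<Longrightarrow> runs P s b R" "\<not> aval e s > 0 \<Longrightarrow> runs Q s b R"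
  shows "runs (Cond e P Q) s (k + b) R"
proof (cases "aval e s > 0")
  case True
  then obtain t s' where "exec P s t s'" "t \<le> b" "R s'" using assms(2) unfolding runs_def by blast
  then show ?thesis using exec_CondT[OF True] assms(1) unfolding runs_def by (meson add_mono)
next
  case False
  then obtain t s' where "exec Q s t s'" "t \<le> b" "R s'" using assms(3) unfolding runs_def by blast
  then show ?thesis using exec_CondF[OF False] assms(1) unfolding runs_def by (meson add_mono)
qed

text \<open>The variant \<open>m\<close> counts iterations, each paying \<open>k\<close> for its
  test and \<open>b\<close> for the body; the additional unit pays for the final failing
  test.\<close>

lemma runs_While:
  assumes step: "\<And>s. I s \<Longrightarrow> aval e s > 0 \<Longrightarrow> runs P s b (\<lambda>s'. I s' \<and> m s' < m s)"
    and guard: "\<And>s. I s \<Longrightarrow> acost e s \<le> k"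
    and "I s"
  shows "runs (While e P) s ((m s + 1) * (k + b)) (\<lambda>s'. I s' \<and> \<not> aval e s' > 0)"
  using \<open>I s\<close>
proof (induction "m s" arbitrary: s rule: less_induct)
  case less
  show ?case
  proof (cases "aval e s > 0")
    case True
    obtain t s1 where t: "exec P s t s1" "t \<le> b" "I s1" "m s1 < m s"
      using step[OF less.prems True] unfolding runs_def by blast
    obtain t' s2 where t': "exec (While e P) s1 t' s2" "t' \<le> (m s1 + 1) * (k + b)" "I s2"
        "\<not> aval e s2 > 0"
      using less.hyps[OF t(4,3)] unfolding runs_def by blast
    have "acost e s + t + t' \<le> (k + b) + (m s1 + 1) * (k + b)"
      using t(2) t'(2) guard[OF less.prems] by linarith
    also have "\<dots> = (m s1 + 2) * (k + b)" by (simp add: algebra_simps)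
    also have "\<dots> \<le> (m s + 1) * (k + b)" using t(4) by (intro mult_le_mono1) simp
    finally show ?thesis unfolding runs_def using exec_WhileT[OF True t(1) t'(1)] t'(3,4) by blast
  next
    case False
    have "acost e s \<le> (m s + 1) * (k + b)" using guard[OF less.prems] by (simp add: algebra_simps)
    then show ?thesis unfolding runs_def using exec_WhileF[OF False] less.prems False by blast
  qed
qed

section \<open>Building blocks of programs\<close>

definition seqs :: "com list \<Rightarrow> com" where
  "seqs Ps = foldr Seq Ps Skip"

lemma seqs_simps [simp]: "seqs [] = Skip" "seqs (P # Ps) = Seq P (seqs Ps)"
  by (simp_all add: seqs_def)

lemma loop_free_seqs [simp]: "loop_free (seqs Ps) \<longleftrightarrow> (\<forall>P\<in>set Ps. loop_free P)"
  by (induction Ps) auto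

fun arrays_read :: "aexp \<Rightarrow> nat set" where
  "arrays_read (Const z) = {}"
| "arrays_read (Cell a e) = insert a (arrays_read e)"
| "arrays_read (Add e f) = arrays_read e \<union> arrays_read f"
| "arrays_read (Sub e f) = arrays_read e \<union> arrays_read f"
| "arrays_read (Mul e f) = arrays_read e \<union> arrays_read f"
| "arrays_read (Div e f) = arrays_read e \<union> arrays_read f"

text \<open>The address expressions of a move read only the input and register 6. By this lemma they
  denote the same addresses while the move is being applied, checked and undone.\<close>

lemma aval_cong: "(\<And>a. a \<in> arrays_read e \<Longrightarrow> s a = s' a) \<Longrightarrow> aval e s = aval e s'"
  by (induction e) auto

abbreviation reg :: "nat \<Rightarrow> aexp" where
  "reg a \<equiv> Cell a (Const 0)"

abbreviation set_reg :: "nat \<Rightarrow> aexp \<Rightarrow> com" where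
  "set_reg a e \<equiv> Assign a (Const 0) e"

section \<open>The augmentation program\<close>

text \<open>The first entry of the input is \<open>l\<close>, and it is stored in cell 1.\<close>

definition len_expr :: aexp where
  "len_expr = Cell 0 (Const 1)"

fun pow_expr :: "nat \<Rightarrow> aexp" where
  "pow_expr 0 = Const 1"
| "pow_expr (Suc j) = Mul len_expr (pow_expr j)"

text \<open>The machine has division but no remainder, so the last base-\<open>l\<close> digit is
  obtained by subtraction.\<close>

definition digit_expr :: "nat \<Rightarrow> aexp" where
  "digit_expr j = (let e = Div (reg 6) (pow_expr j) in Sub e (Mul len_expr (Div e len_expr)))"

definition cell_expr :: "nat \<Rightarrow> aexp \<Rightarrow> aexp" where
  "cell_expr r e = Add (Add (Const 2) (Mul (Const (int r)) len_expr)) e"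

lemma aval_pow_expr: "aval (pow_expr j) s = s 0 1 ^ j"
  by (induction j) (auto simp: len_expr_def)

lemma aval_digit_expr:
  assumes "s 0 1 = int l" "s 6 0 = int q"
  shows "aval (digit_expr j) s = int (q div l ^ j mod l)"
proof -
  have "aval (digit_expr j) s = int q div int l ^ j - int l * (int q div int l ^ j div int l)"
    using assms by (simp add: digit_expr_def Let_def aval_pow_expr len_expr_def)
  also have "\<dots> = int q div int l ^ j mod int l" by (rule minus_mult_div_eq_mod)
  also have "\<dots> = int (q div l ^ j mod l)" by (simp add: zdiv_int zmod_int)
  finally show ?thesis .
qed

lemma aval_cell_expr:
  assumes "s 0 1 = int l" "aval e s = int k"
  shows "aval (cell_expr r e) s = addr l r k"
  using assms by (simp add: cell_expr_def addr_def len_expr_def)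

lemma arrays_read_exprs [simp]:
  "arrays_read len_expr = {0}" "arrays_read (pow_expr j) \<subseteq> {0}"
      "arrays_read (digit_expr j) = {0, 6}"
  "arrays_read (cell_expr r e) = insert 0 (arrays_read e)"
proof -
  show pow: "arrays_read (pow_expr j) \<subseteq> {0}" by (induction j) (auto simp: len_expr_def)
  show "arrays_read (digit_expr j) = {0, 6}"
    using pow by (auto simp: digit_expr_def Let_def len_expr_def)
qed (auto simp: len_expr_def cell_expr_def)

text \<open>Registers (cell 0 of an array): 2 is the bound \<open>T\<close>, 3 the weight of the slack variables, 4 the
  required gain, 5 the step length, 6 the number encoding the layers, 7 the flag for success,
  8 is scratch, 9 is an accumulator, 10 a loop counter. Array 1 holds the current point.\<close>

definition move_code :: "nat \<Rightarrow> nat \<Rightarrow> (nat \<Rightarrow> int) list \<Rightarrow> (aexp \<times> aexp \<times> int) list" where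
  "move_code M J vs =
     concat (map (\<lambda>j. map (\<lambda>r. (cell_expr r (digit_expr j),
         if r < M then Cell 0 (cell_expr r (digit_expr j)) else reg 3, (vs ! j) r)) [0..<M + J])
       [0..<length vs]) @
     map (\<lambda>i. (cell_expr (M + J) (Const (int i)), reg 3, - (\<Sum>v\<leftarrow>vs. v i))) [0..<M]"

lemma choose_layers_eq_map:
  "choose_layers l q vs = map (\<lambda>j. (q div l ^ j mod l, vs ! j)) [0..<length vs]"
  unfolding choose_layers_def by (rule nth_equalityI) auto

text \<open>The triples of \<open>move_code\<close> consist of an address expression, a weight
  expression and a coefficient. The vectors \<open>vs\<close> are fixed in the program text, whereas
  the layers come from register 6 and appear only on evaluation.\<close>

lemma move_code_entries:
  assumes "s 0 1 = int l" "s 6 0 = int q"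
  shows "map (\<lambda>(a, w, v). (aval a s, v)) (move_code M J vs) =
    move_entries M J l (choose_layers l q vs)"
proof -
  have "(\<Sum>p\<leftarrow>choose_layers l q vs. snd p i) = (\<Sum>v\<leftarrow>vs. v i)" for i
  proof -
    have "(\<Sum>p\<leftarrow>choose_layers l q vs. snd p i) = (\<Sum>v\<leftarrow>map snd (choose_layers l q vs). v i)"
      by (simp add: comp_def del: map_snd_choose_layers)
    then show ?thesis by simp
  qed
  moreover have "aval (cell_expr r (digit_expr j)) s = addr l r (q div l ^ j mod l)" for r j
    using aval_cell_expr aval_digit_expr assms by blast
  moreover have "aval (cell_expr r (Const (int i))) s = addr l r i" for r i
    using aval_cell_expr assms(1) by simp
  ultimately show ?thesis
    unfolding move_code_def move_entries_def
    by (simp add: choose_layers_eq_map map_concat comp_def)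
qed

text \<open>Before \<open>addr l M 0\<close> the input holds costs; from there on it holds
  right-hand sides, where the weight \<open>W\<close> takes the place of a cost.\<close>

definition slack_weight :: "nat \<Rightarrow> nat \<Rightarrow> (int \<Rightarrow> int) \<Rightarrow> int \<Rightarrow> int \<Rightarrow> int" where
  "slack_weight M l In W a = (if a < addr l M 0 then In a else W)"

lemma move_code_weight:
  assumes "s 0 1 = int l" "s 6 0 = int q" "s 3 0 = W" "l \<ge> 1" "(a, w, v) \<in> set (move_code M J vs)"
  shows "aval w s = slack_weight M l (s 0) W (aval a s)"
proof -
  consider (cell) j r where "r < M + J" "a = cell_expr r (digit_expr j)"
      "w = (if r < M then Cell 0 (cell_expr r (digit_expr j)) else reg 3)"
    | (link) i where "a = cell_expr (M + J) (Const (int i))" "w = reg 3"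
    using assms(5) unfolding move_code_def by auto
  then show ?thesis
  proof cases
    case cell
    have a: "aval a s = addr l r (q div l ^ j mod l)"
      unfolding cell(2) using aval_cell_expr aval_digit_expr assms by blast
    show ?thesis
    proof (cases "r < M")
      case True
      then have "aval a s < addr l M 0" unfolding a using assms(4) by (intro addr_less) auto
      then show ?thesis using True cell by (simp add: slack_weight_def)
    next
      case False
      have "int M * int l \<le> int r * int l" using False by (intro mult_right_mono) auto
      then have "\<not> aval a s < addr l M 0" unfolding a by (simp add: addr_def)
      then show ?thesis using False cell assms(3) by (simp add: slack_weight_def)
    qed
  next
    case link
    have "aval a s = addr l (M + J) i" unfolding link(1) using aval_cell_expr assms(1) by simp
    then have "\<not> aval a s < addr l M 0" by (simp add: addr_def algebra_simps not_less)
    then show ?thesis using link assms(3) by (simp add: slack_weight_def)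
  qed
qed

lemma move_code_reads:
  "(a, w, v) \<in> set (move_code M J vs) \<Longrightarrow> arrays_read a \<subseteq> {0, 6} \<and> arrays_read w \<subseteq> {0, 3, 6}"
  unfolding move_code_def by (auto split: if_splits)

definition add_code :: "int \<Rightarrow> (aexp \<times> aexp \<times> int) list \<Rightarrow> com" where
  "add_code c es = seqs (map (\<lambda>(a, w,
      v). Assign 1 a (Add (Cell 1 a) (Mul (Const (c * v)) (reg 5)))) es)"

definition check_code :: "(aexp \<times> aexp \<times> int) list \<Rightarrow> com" where
  "check_code es = seqs (map (\<lambda>(a, w,
      v). Cond (Sub (Const 0) (Cell 1 a)) (set_reg 8 (Const 0)) Skip) es)"

definition gain_expr :: "(aexp \<times> aexp \<times> int) list \<Rightarrow> aexp" where
  "gain_expr es = foldr (\<lambda>(a, w, v) e. Add (Mul (Const v) w) e) es (Const 0)"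

text \<open>Entries may share an address, so nonnegativity can be judged only once all have been
  added; a rejected move is undone by the opposite addition. Register 8 starts with a number that is
  positive iff the gain reaches register 4, a negative entry overwrites it by zero, and the final
  reset makes a rejected attempt restore the memory exactly.\<close>

definition try_code :: "(aexp \<times> aexp \<times> int) list \<Rightarrow> com" where
  "try_code es =
     Seq (set_reg 8 (Sub (Sub (Const 1) (reg 4)) (Mul (reg 5) (gain_expr es))))
    (Seq (add_code 1 es)
    (Seq (check_code es)
    (Seq (Cond (reg 8) (set_reg 7 (Const 1)) (add_code (- 1) es))
         (set_reg 8 (Const 0)))))"

lemma loop_free_try_code: "loop_free (try_code es)"
  by (auto simp: try_code_def add_code_def check_code_def)

lemma effect_add_code:
  assumes "\<And>a w v. (a, w, v) \<in> set es \<Longrightarrow> arrays_read a \<subseteq> {0, 6}"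
  shows "effect (add_code c es) s =
    s(1 := (\<lambda>b. s 1 b + c * s 5 0 * vec_of (map (\<lambda>(a, w, v). (aval a s, v)) es) b))"
  using assms
proof (induction es arbitrary: s)
  case (Cons e es)
  obtain a w v where e: "e = (a, w, v)" by (cases e)
  let ?s = "s(1 := (s 1)(aval a s := s 1 (aval a s) + c * v * s 5 0))"
  have "aval a' ?s = aval a' s" if "(a', w', v') \<in> set es" for a' w' v'
    by (rule aval_cong) (use Cons.prems that in force)
  then have *: "map (\<lambda>(a, w, v). (aval a ?s, v)) es = map (\<lambda>(a, w, v). (aval a s, v)) es" by auto
  have "effect (add_code c (e # es)) s = effect (add_code c es) ?s"
    by (simp add: add_code_def e)
  also have "\<dots> = ?s(1 := (\<lambda>b. ?s 1 b + c * ?s 5 0 * vec_of (map (\<lambda>(a, w, v). (aval a ?s,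
      v)) es) b))"
    using Cons.prems by (intro Cons.IH) auto
  finally show ?case unfolding * by (auto simp: fun_eq_iff e algebra_simps)
qed (simp add: add_code_def)

lemma effect_check_code:
  assumes "\<And>a w v. (a, w, v) \<in> set es \<Longrightarrow> arrays_read a \<subseteq> {0, 6}"
  shows "effect (check_code es) s =
    (if \<exists>(a, w, v)\<in>set es. s 1 (aval a s) < 0 then s(8 := (s 8)(0 := 0)) else s)"
  using assms
proof (induction es arbitrary: s)
  case (Cons e es)
  obtain a w v where e: "e = (a, w, v)" by (cases e)
  let ?s = "s(8 := (s 8)(0 := 0))"
  have *: "aval a' ?s = aval a' s" if "(a', w', v') \<in> set es" for a' w' v'
    by (rule aval_cong) (use Cons.prems that in force)
  have "(\<exists>(a, w, v)\<in>set es. ?s 1 (aval a ?s) < 0) \<longleftrightarrow> (\<exists>(a, w, v)\<in>set es. s 1 (aval a s) < 0)"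
  proof (rule bex_cong[OF refl])
    fix x assume "x \<in> set es"
    then show "(case x of (a, w, v) \<Rightarrow> ?s 1 (aval a ?s) < 0) \<longleftrightarrow>
        (case x of (a, w, v) \<Rightarrow> s 1 (aval a s) < 0)"
      using *[of "fst x" "fst (snd x)" "snd (snd x)"] by (simp add: case_prod_unfold)
  qed
  moreover have "effect (check_code es) ?s =
      (if \<exists>(a, w, v)\<in>set es. ?s 1 (aval a ?s) < 0 then ?s(8 := (?s 8)(0 := 0)) else ?s)"
    using Cons.prems by (intro Cons.IH) auto
  moreover have "?s(8 := (?s 8)(0 := 0)) = ?s" by simp
  \<comment> \<open>Clearing the flag twice is the same as clearing it once, so one violation
    decides the outcome.\<close>
  ultimately have marked: "effect (check_code es) ?s = ?s" by metis
  have unmarked: "effect (check_code es) s =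
      (if \<exists>(a, w, v)\<in>set es. s 1 (aval a s) < 0 then ?s else s)"
    using Cons.prems by (intro Cons.IH) auto
  have "effect (check_code (e # es)) s = effect (check_code es) (if s 1 (aval a s)
      < 0 then ?s else s)"
    by (simp add: check_code_def e)
  also have "\<dots> = (if s 1 (aval a s) < 0 \<or> (\<exists>(a, w, v)\<in>set es. s 1 (aval a s) < 0) then ?s else s)"
    using marked unmarked by (cases
        "s 1 (aval a s) < 0") (simp_all only: if_True if_False simp_thms)
  finally show ?case unfolding e list.set bex_simps(5) prod.case .
qed (simp add: check_code_def)

lemma aval_gain_expr: "aval (gain_expr es) s = (\<Sum>(a, w, v)\<leftarrow>es. v * aval w s)"
  by (induction es) (auto simp: gain_expr_def)

lemma effect_try_code:
  assumes reads: "\<And>a w v. (a, w, v) \<in> set es \<Longrightarrow> arrays_read a \<subseteq> {0, 6}"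
    and ok: "s 8 0 = 0"
  defines "X \<equiv> (\<lambda>b. s 1 b + s 5 0 * vec_of (map (\<lambda>(a, w, v). (aval a s, v)) es) b)"
  shows "effect (try_code es) s =
    (if (\<forall>(a, w, v)\<in>set es. 0 \<le> X (aval a s)) \<and> s 4 0 \<le> - (s 5 0 * (\<Sum>(a, w, v)\<leftarrow>es. v * aval w s))
     then s(1 := X, 7 := (s 7)(0 := 1)) else s)"
proof -
  define gain where "gain = 1 - s 4 0 - s 5 0 * (\<Sum>(a, w, v)\<leftarrow>es. v * aval w s)"
  define s1 where "s1 = s(8 := (s 8)(0 := gain))"
  have e1: "effect (set_reg 8 (Sub (Sub (Const 1) (reg 4)) (Mul (reg 5) (gain_expr es)))) s = s1"
    by (simp add: s1_def gain_def aval_gain_expr)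
  have addr: "aval a s' = aval a s" if "(a, w, v) \<in> set es" "s' 0 = s 0" "s' 6 = s 6" for a w v s'
    by (rule aval_cong) (use reads[OF that(1)] that in auto)
  have ents: "map (\<lambda>(a, w, v). (aval a s', v)) es = map (\<lambda>(a, w, v). (aval a s, v)) es"
    if "s' 0 = s 0" "s' 6 = s 6" for s'
    using addr that by auto
  have add: "effect (add_code c es) s' =
      s'(1 := (\<lambda>b. s' 1 b + c * s' 5 0 * vec_of (map (\<lambda>(a, w, v). (aval a s, v)) es) b))"
    if "s' 0 = s 0" "s' 6 = s 6" for c s'
    unfolding ents[OF that, symmetric] by (rule effect_add_code[OF reads])
  define s2 where "s2 = s1(1 := X)"
  have e2: "effect (add_code 1 es) s1 = s2"
    unfolding s2_def X_def by (subst add) (simp_all add: s1_def)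
  define neg where "neg \<longleftrightarrow> (\<exists>(a, w, v)\<in>set es. X (aval a s) < 0)"
  have "(\<exists>(a, w, v)\<in>set es. s2 1 (aval a s2) < 0) \<longleftrightarrow> neg"
    unfolding neg_def
  proof (rule bex_cong[OF refl])
    fix x assume "x \<in> set es"
    then have "aval (fst x) s2 = aval (fst x) s"
      by (intro addr[of "fst x" "fst (snd x)" "snd (snd x)"]) (auto simp: s2_def s1_def)
    then show "(case x of (a, w, v) \<Rightarrow> s2 1 (aval a s2) < 0) \<longleftrightarrow>
        (case x of (a, w, v) \<Rightarrow> X (aval a s) < 0)"
      by (simp add: case_prod_unfold s2_def)
  qed
  then have e3: "effect (check_code es) s2 = s2(8 := (s 8)(0 := if neg then 0 else gain))"
    by (subst effect_check_code[OF reads]) (auto simp: s2_def s1_def)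
  define s3 where "s3 = s2(8 := (s 8)(0 := if neg then 0 else gain))"
  have undo: "effect (add_code (- 1) es) s3 = s3(1 := s 1)"
    by (subst add) (simp_all add: s3_def s2_def s1_def X_def)
  have s8: "(s 8)(0 := 0) = s 8" using ok by auto
  have good: "(\<forall>(a, w, v)\<in>set es. 0 \<le> X (aval a s)) \<and>
      s 4 0 \<le> - (s 5 0 * (\<Sum>(a, w, v)\<leftarrow>es. v * aval w s)) \<longleftrightarrow>
      s3 8 0 > 0"
  proof -
    have "(\<forall>(a, w, v)\<in>set es. 0 \<le> X (aval a s)) \<longleftrightarrow> \<not> neg"
      unfolding neg_def by (simp add: case_prod_unfold not_less)
    then show ?thesis unfolding s3_def gain_def by simp linarith
  qed
  have "effect (try_code es) s =
      (let s4 = (if s3 8 0 > 0 then s3(7 := (s3 7)(0 := 1)) else s3(1 := s 1)) in s4(8 :=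
          (s4 8)(0 := 0)))"
    unfolding try_code_def effect.simps(3) e1 e2 e3 s3_def[symmetric]
    by (simp add: undo Let_def)
  also have "\<dots> = (if s3 8 0 > 0 then s(1 := X, 7 := (s 7)(0 := 1)) else s)"
    using s8 by (auto simp: Let_def s3_def s2_def s1_def fun_eq_iff)
  finally show ?thesis unfolding good .
qed

text \<open>By linearity this holds with repeated addresses too, so the gain the program adds up
  entry by entry is the true change of cost.\<close>

lemma linear_cost_vec_of:
  assumes "\<And>e. e \<in> set es \<Longrightarrow> 2 \<le> fst e \<and> fst e < n"
  shows "linear_cost w n (vec_of es) = (\<Sum>e\<leftarrow>es. snd e * w (fst e))"
  using assms
proof (induction es)
  case (Cons e es)
  have "linear_cost w n (vec_of (e # es)) =
      (\<Sum>a\<in>{2..<n}. if fst e = a then w a * snd e else 0) + linear_cost w n (vec_of es)"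
    unfolding linear_cost_def sum.distrib[symmetric]
        by (intro sum.cong refl) (simp add: distrib_left)
  also have "(\<Sum>a\<in>{2..<n}. if fst e = a then w a * snd e else 0) = w (fst e) * snd e"
    using Cons.prems[of e] by (subst sum.delta') auto
  finally show ?case using Cons by (simp add: mult.commute)
qed (simp add: linear_cost_def)

lemma move_entries_range:
  assumes "e \<in> set (move_entries M J l ps)" "\<And>p. p \<in> set ps \<Longrightarrow> fst p < l"
  shows "2 \<le> fst e \<and> fst e < addr l (M + J) M"
proof -
  consider (cell) p r where "p \<in> set ps" "r < M + J" "fst e = addr l r (fst p)"
    | (link) i where "i < M" "fst e = addr l (M + J) i"
    using assms(1) unfolding move_entries_def by auto
  then show ?thesis
  proof cases
    case cell
    have "fst e < addr l (M + J) 0" using addr_less assms(2) cell by metis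
    then show ?thesis using cell addr_le_iff[of l "M + J" 0 M] by (auto simp: addr_def)
  next
    case link
    then show ?thesis by (auto simp: addr_def)
  qed
qed

text \<open>Only the entries touched by a move are tested for nonnegativity.\<close>

lemma effect_try_move:
  fixes M J :: nat and vs :: "(nat \<Rightarrow> int) list"
  assumes "s 0 1 = int l" "s 6 0 = int q" "s 3 0 = W" "s 8 0 = 0" "l \<ge> 1" and nonneg:
      "\<And>a. 0 \<le> s 1 a"
  defines "h \<equiv> vec_of (move_entries M J l (choose_layers l q vs))"
  defines "X \<equiv> (\<lambda>a. s 1 a + s 5 0 * h a)"
  shows "effect (try_code (move_code M J vs)) s =
    (if (\<forall>a. 0 \<le> X a) \<and>
        s 4 0 \<le> - (s 5 0 * linear_cost (slack_weight M l (s 0) W) (addr l (M + J) M) h)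
     then s(1 := X, 7 := (s 7)(0 := 1)) else s)"
proof -
  note entries = move_code_entries[OF assms(1,2), of M J vs]
  have range: "2 \<le> fst e \<and> fst e < addr l (M + J) M"
    if "e \<in> set (move_entries M J l (choose_layers l q vs))" for e
    using move_entries_range[OF that choose_layers_less[OF assms(5)]] .
  have "(\<Sum>(a, w, v)\<leftarrow>move_code M J vs. v * aval w s) =
      (\<Sum>(a, w, v)\<leftarrow>move_code M J vs. v * slack_weight M l (s 0) W (aval a s))"
    using move_code_weight[OF assms(1,2,3,5)]
    by (intro arg_cong[of _ _ sum_list] map_cong) auto
  also have "\<dots> = (\<Sum>e\<leftarrow>map (\<lambda>(a, w, v). (aval a s, v)) (move_code M J vs).
      snd e * slack_weight M l (s 0) W (fst e))"
    by (simp add: comp_def case_prod_unfold)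
  also have "\<dots> = linear_cost (slack_weight M l (s 0) W) (addr l (M + J) M) h"
    unfolding entries h_def using linear_cost_vec_of[OF range] by simp
  finally have gain: "(\<Sum>(a, w, v)\<leftarrow>move_code M J vs. v * aval w s) =
      linear_cost (slack_weight M l (s 0) W) (addr l (M + J) M) h" .
  have addrs: "fst ` set (move_entries M J l (choose_layers l q vs)) = (\<lambda>(a, w,
      v). aval a s) ` set (move_code M J vs)"
    unfolding entries[symmetric] by force
  have "(\<forall>(a, w, v)\<in>set (move_code M J vs). 0 \<le> X (aval a s)) \<longleftrightarrow> (\<forall>a. 0 \<le> X a)"
  proof (intro iffI allI)
    fix b assume *: "\<forall>(a, w, v)\<in>set (move_code M J vs). 0 \<le> X (aval a s)"
    show "0 \<le> X b"
    proof (cases "b \<in> fst ` set (move_entries M J l (choose_layers l q vs))")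
      case True
      then show ?thesis using * unfolding addrs by auto
    next
      case False
      then show ?thesis using nonneg vec_of_eq_0 by (simp add: X_def h_def)
    qed
  qed auto
  then have nonneg_iff: "(\<forall>(a, w, v)\<in>set (move_code M J vs). 0 \<le> s 1 (aval a s) +
      s 5 0 * h (aval a s)) \<longleftrightarrow>
      (\<forall>a. 0 \<le> s 1 a + s 5 0 * h a)"
    unfolding X_def .
  have reads: "arrays_read a \<subseteq> {0, 6}" if "(a, w, v) \<in> set (move_code M J vs)" for a w v
    using move_code_reads[OF that] by simp
  show ?thesis
    using effect_try_code[of "move_code M J vs" s, OF reads assms(4)]
    unfolding entries gain h_def[symmetric] nonneg_iff X_def .
qed

text \<open>Decrementing before the attempts makes the codes run from \<open>l ^ g - 1\<close> down
  to \<open>0\<close>, although the loop tests for positivity.\<close>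

definition layers_body :: "nat \<Rightarrow> nat \<Rightarrow> (nat \<Rightarrow> int) list list \<Rightarrow> com" where
  "layers_body M J vss = Seq (set_reg 6 (Sub (reg 6) (Const 1)))
     (seqs (map (\<lambda>vs. try_code (move_code M J vs)) vss))"

definition step_body :: "nat \<Rightarrow> nat \<Rightarrow> (nat \<Rightarrow> int) list list \<Rightarrow> nat \<Rightarrow> com" where
  "step_body M J vss g = Seq (set_reg 6 (pow_expr g))
     (Seq (While (reg 6) (layers_body M J vss)) (set_reg 5 (Div (reg 5) (Const 2))))"

definition start_pass :: com where
  "start_pass = Seq (set_reg 7 (Const 0)) (set_reg 5 (reg 2))"

text \<open>The required gain is halved only after a pass without success: a success in mid-pass
  changes the point, so the failures recorded before it say nothing about the new point.\<close>

definition finish_pass :: com where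
  "finish_pass = Cond (reg 7) Skip (set_reg 4 (Div (reg 4) (Const 2)))"

definition augment :: "nat \<Rightarrow> nat \<Rightarrow> (nat \<Rightarrow> int) list list \<Rightarrow> nat \<Rightarrow> com" where
  "augment M J vss g = While (reg 4)
     (Seq start_pass (Seq (While (reg 5) (step_body M J vss g)) finish_pass))"

text \<open>The situation once the input is known to have nonnegative right-hand sides. The number
  \<open>T\<close> bounds input entries and the number of cells, hence, as shown below, the entries
  of feasible points; \<open>T * T * W\<close> then bounds the cost. The conditions on
  \<open>\<beta>\<close> cover every kind of number kept in memory across iterations, including the
  largest code \<open>l ^ g\<close>.\<close>

locale augmentation =
  fixes M J :: nat and A :: "nat \<Rightarrow> nat \<Rightarrow> int" and vss :: "(nat \<Rightarrow> int) list list" and g l :: nat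
    and In :: "int \<Rightarrow> int" and T W :: int and \<beta> :: nat
  assumes l: "1 \<le> l" and In_1: "In 1 = int l"
    and A_nonneg: "\<And>j i. 0 \<le> A j i"
    and layer: "\<And>vs v. vs \<in> set vss \<Longrightarrow> v \<in> set vs \<Longrightarrow> in_layer_kernel M J A v"
    and short: "\<And>vs. vs \<in> set vss \<Longrightarrow> length vs \<le> g"
    and dec: "\<And>z. in_kernel M J A l z \<Longrightarrow> \<exists>Ls. decomposed M J vss l Ls z"
    and T: "1 \<le> T" and In_bound: "\<And>a. \<bar>In a\<bar> \<le> T"
    and In_nonneg: "\<And>a. addr l M 0 \<le> a \<Longrightarrow> a < addr l (M + J) M \<Longrightarrow> 0 \<le> In a"
    and N_le: "addr l (M + J) M \<le> T + 2" and W: "T \<le> W"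
    and \<beta>: "1 \<le> \<beta>" "T \<le> 2 ^ \<beta>" "W \<le> 2 ^ \<beta>" "T * T * W \<le> 2 ^ \<beta>" "int (l ^ g) \<le> 2 ^ \<beta>"
begin

definition N where "N = addr l (M + J) M"

definition cost where "cost = linear_cost (slack_weight M l In W) N"

text \<open>No variables used, all slack: feasibility is membership in the coset of this point.\<close>

definition base where "base a = (if addr l M 0 \<le> a \<and> a < N then In a else 0)"

definition feas where "feas X \<longleftrightarrow> (\<forall>a. 0 \<le> X a) \<and> in_kernel M J A l (\<lambda>a. X a - base a)"

lemma feas_base: "feas base"
  unfolding feas_def using In_nonneg by (auto simp: base_def in_kernel_def N_def)

lemma base_small: "k < l \<Longrightarrow> i < M \<Longrightarrow> base (addr l i k) = 0"
  using addr_less[of k l i M] by (simp add: base_def)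

lemma feas_cell:
  assumes "feas X" "j < J" "k < l"
  shows "(\<Sum>i<M. A j i * X (addr l i k)) + X (addr l (M + j) k) = base (addr l (M + j) k)"
proof -
  have "(\<Sum>i<M. A j i * (X (addr l i k) - base (addr l i k))) +
      (X (addr l (M + j) k) - base (addr l (M + j) k)) = 0"
    using assms unfolding feas_def in_kernel_def by blast
  moreover have "(\<Sum>i<M. A j i * (X (addr l i k) - base (addr l i k))) =
      (\<Sum>i<M. A j i * X (addr l i k))"
    using assms(3) by (intro sum.cong) (auto simp: base_small)
  ultimately show ?thesis by simp
qed

lemma feas_link:
  assumes "feas X" "i < M"
  shows "(\<Sum>k<l. X (addr l i k)) + X (addr l (M + J) i) = base (addr l (M + J) i)"
proof -
  have "(\<Sum>k<l. X (addr l i k) - base (addr l i k)) +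
      (X (addr l (M + J) i) - base (addr l (M + J) i)) = 0"
    using assms unfolding feas_def in_kernel_def by blast
  moreover have "(\<Sum>k<l. X (addr l i k) - base (addr l i k)) = (\<Sum>k<l. X (addr l i k))"
    using assms(2) by (intro sum.cong) (auto simp: base_small)
  ultimately show ?thesis by simp
qed

lemma base_le: "base a \<le> T"
  using In_bound[of a] T by (auto simp: base_def)

lemma feas_outside: "feas X \<Longrightarrow> \<not> (2 \<le> a \<and> a < N) \<Longrightarrow> X a = 0"
proof -
  assume X: "feas X" and a: "\<not> (2 \<le> a \<and> a < N)"
  have "X a - base a = 0" using X a unfolding feas_def in_kernel_def N_def by blast
  moreover have "2 \<le> addr l M 0" by (simp add: addr_def)
  then have "base a = 0" using a by (auto simp: base_def)
  ultimately show "X a = 0" by simp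
qed

text \<open>A variable has coefficient 1 in its linking equation, and a slack variable has
  coefficient 1 in its own equation. All other terms are nonnegative, so the right-hand side bounds
  it.\<close>

lemma feas_le:
  assumes X: "feas X"
  shows "X a \<le> T"
proof (cases "2 \<le> a \<and> a < N")
  case False
  then show ?thesis using feas_outside[OF X] T by simp
next
  case True
  have nonneg: "0 \<le> X b" for b using X by (simp add: feas_def)
  from True have "2 \<le> a" "a < addr l (M + J) M" by (auto simp: N_def)
  with l show ?thesis
  proof (cases rule: address_cases)
    case (cell r k)
    show ?thesis
    proof (cases "r < M")
      case True
      have "X a \<le> (\<Sum>k<l. X (addr l r k))"
        unfolding cell(3) by (rule member_le_sum) (use cell(2) nonneg in auto)
      then show ?thesis
        using feas_link[OF X True] nonneg[of "addr l (M + J) r"] base_le[of "addr l (M + J) r"]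
        by linarith
    next
      case False
      then obtain j where j: "r = M + j" "j < J"
          using cell(1) by (metis add_less_cancel_left le_Suc_ex not_less)
      have "0 \<le> (\<Sum>i<M. A j i * X (addr l i k))" using A_nonneg nonneg by (intro sum_nonneg) auto
      then show ?thesis using feas_cell[OF X j(2) cell(2)] base_le[of a]
          unfolding cell(3) j(1) by linarith
    qed
  next
    case (link i)
    have "0 \<le> (\<Sum>k<l. X (addr l i k))" using nonneg by (intro sum_nonneg) auto
    then show ?thesis using feas_link[OF X link(1)] base_le[of a] unfolding link(2) by linarith
  qed
qed

lemma cost_bound:
  assumes X: "feas X"
  shows "\<bar>cost X\<bar> \<le> T * T * W"
proof -
  have "\<bar>cost X\<bar> \<le> (\<Sum>a\<in>{2..<N}. \<bar>slack_weight M l In W a * X a\<bar>)"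
    unfolding cost_def linear_cost_def by (rule sum_abs)
  also have "\<dots> \<le> (\<Sum>a\<in>{2..<N}. W * T)"
  proof (rule sum_mono)
    fix a
    have "\<bar>slack_weight M l In W a\<bar> \<le> W"
      unfolding slack_weight_def using In_bound[of a] W T by auto
    moreover have "\<bar>X a\<bar> \<le> T" using feas_le[OF X, of a] X by (simp add: feas_def)
    ultimately show "\<bar>slack_weight M l In W a * X a\<bar> \<le> W * T"
      unfolding abs_mult using T W by (intro mult_mono) auto
  qed
  also have "\<dots> = int (nat (N - 2)) * (W * T)" by simp
  also have "\<dots> \<le> T * (W * T)"
    using N_le T W unfolding N_def by (intro mult_right_mono) auto
  finally show ?thesis by (simp add: ac_simps)
qed

lemma minimizer_exists: "\<exists>X. feas X \<and> (\<forall>Y. feas Y \<longrightarrow> cost X \<le> cost Y)"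
proof -
  \<comment> \<open>Shifting by the lower bound for the cost turns minimization into a search for a
    least natural number.\<close>
  define m where "m X = nat (cost X + T * T * W)" for X
  obtain X where X: "feas X" "\<And>Y. feas Y \<Longrightarrow> m X \<le> m Y"
    using ex_has_least_nat[of feas base m] feas_base by blast
  have "cost X \<le> cost Y" if "feas Y" for Y
    using X(2)[OF that] cost_bound[OF X(1)] cost_bound[OF that] unfolding m_def by linarith
  then show ?thesis using X(1) by blast
qed

definition move_vec where
  "move_vec q vs = vec_of (move_entries M J l (choose_layers l q vs))"

lemma feas_move:
  assumes "feas X" "vs \<in> set vss" "\<And>a. 0 \<le> X a + c * move_vec q vs a"
  shows "feas (\<lambda>a. X a + c * move_vec q vs a)"
proof -
  have "in_kernel M J A l (move_vec q vs)"
    unfolding move_vec_def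
  proof (rule in_kernel_move)
    fix p assume p: "p \<in> set (choose_layers l q vs)"
    then show "fst p < l" by (rule choose_layers_less[OF l])
    have "snd p \<in> set (map snd (choose_layers l q vs))" using p by (simp del: map_snd_choose_layers)
    then show "in_layer_kernel M J A (snd p)" using layer[OF assms(2)] by simp
  qed
  then have "in_kernel M J A l (\<lambda>a. (X a - base a) + c * move_vec q vs a)"
    using assms(1) unfolding feas_def by (intro in_kernel_add in_kernel_scale) auto
  then show ?thesis using assms(3) unfolding feas_def by (simp add: algebra_simps)
qed

section \<open>The invariant of a pass over all moves\<close>

definition blocked where
  "blocked D X \<gamma> q vs \<longleftrightarrow>
     ((\<forall>a. 0 \<le> X a + \<gamma> * move_vec q vs a) \<longrightarrow> - (\<gamma> * cost (move_vec q vs)) < D)"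

definition state_ok :: "memory \<Rightarrow> bool" where
  "state_ok s \<longleftrightarrow> s 0 = In \<and> s 2 0 = T \<and> s 3 0 = W \<and> s 8 0 = 0 \<and> mem_bounded \<beta> s \<and> feas (s 1)"

text \<open>As long as nothing has succeeded, the point is still \<open>X0\<close> and the attempts
  in \<open>Done\<close> are known to be blocked there. After a success this record is replaced by
  the guaranteed gain, which later successes can only increase.\<close>

definition progress where
  "progress D X0 Done s \<longleftrightarrow> s 4 0 = D \<and> state_ok s \<and>
     (s 7 0 = 0 \<and> s 1 = X0 \<and> (\<forall>(\<gamma>, q, vs)\<in>Done. blocked D X0 \<gamma> q vs) \<or>
      s 7 0 = 1 \<and> cost (s 1) \<le> cost X0 - D)"

lemma progress_mono: "progress D X0 Done s \<Longrightarrow> Done' \<subseteq> Done \<Longrightarrow> progress D X0 Done' s"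
  unfolding progress_def by blast

lemma mem_bounded_point:
  assumes "mem_bounded \<beta> s" "feas X"
  shows "mem_bounded \<beta> (s(1 := X))"
  unfolding mem_bounded_def
proof (intro allI)
  fix a i
  have "\<bar>X i\<bar> \<le> 2 ^ \<beta>" using feas_le[OF assms(2), of i] assms(2) \<beta>(2) by (auto simp: feas_def)
  then show "\<bar>(s(1 := X)) a i\<bar> \<le> 2 ^ \<beta>" using assms(1) by (simp add: mem_bounded_def)
qed

lemma one_le_bound: "\<bar>1 :: int\<bar> \<le> 2 ^ \<beta>"
  by simp

lemma progress_try:
  assumes s: "progress D X0 Done s" "s 5 0 = \<gamma>" "s 6 0 = int q" and vs: "vs \<in> set vss" and D:
      "0 \<le> D"
  defines "s' \<equiv> effect (try_code (move_code M J vs)) s"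
  shows "progress D X0 (insert (\<gamma>, q, vs) Done) s' \<and> s' 5 0 = \<gamma> \<and> s' 6 0 = int q"
proof -
  have i: "s 4 0 = D" "s 0 = In" "s 2 0 = T" "s 3 0 = W" "s 8 0 = 0" "mem_bounded \<beta> s" "feas (s 1)"
    using s(1) by (auto simp: progress_def state_ok_def)
  define X where "X = (\<lambda>a. s 1 a + \<gamma> * move_vec q vs a)"
  have s': "s' = (if (\<forall>a. 0 \<le> X a) \<and> D \<le> - (\<gamma> * cost (move_vec q vs))
      then s(1 := X, 7 := (s 7)(0 := 1)) else s)"
    unfolding s'_def X_def move_vec_def cost_def N_def
    unfolding s(2)[symmetric] i(1)[symmetric] i(2)[symmetric]
    using i(2,7) In_1 l s(3) i(4,5)
    by (intro effect_try_move) (auto simp: feas_def)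
  show ?thesis
  proof (cases "(\<forall>a. 0 \<le> X a) \<and> D \<le> - (\<gamma> * cost (move_vec q vs))")
    case True
    have X: "feas X" unfolding X_def using feas_move[OF i(7) vs] True unfolding X_def by blast
    have "mem_bounded \<beta> (s(1 := X, 7 := (s 7)(0 := 1)))"
      using mem_bounded_upd[OF mem_bounded_point[OF i(6) X] one_le_bound, of 7 0] by simp
    moreover have "cost X = cost (s 1) + \<gamma> * cost (move_vec q vs)"
      unfolding X_def cost_def by (rule linear_cost_add)
    moreover have "cost (s 1) \<le> cost X0" using s(1) D unfolding progress_def by auto
    ultimately show ?thesis using s True X unfolding s' progress_def state_ok_def by auto
  next
    case False
    then have *: "blocked D (s 1) \<gamma> q vs" unfolding blocked_def X_def by auto
    have "s' = s" using s' False by metis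
    then show ?thesis using s * unfolding progress_def by auto
  qed
qed

lemma progress_tries:
  assumes "progress D X0 Done s" "s 5 0 = \<gamma>" "s 6 0 = int q" "set us \<subseteq> set vss" "0 \<le> D"
  defines "s' \<equiv> effect (seqs (map (\<lambda>vs. try_code (move_code M J vs)) us)) s"
  shows "progress D X0 (Done \<union> {(\<gamma>, q, vs) | vs. vs \<in> set us}) s' \<and> s' 5 0 = \<gamma> \<and> s' 6 0 = int q"
  using assms(1-4) unfolding s'_def
proof (induction us arbitrary: s Done)
  case (Cons u us)
  let ?s = "effect (try_code (move_code M J u)) s"
  have u: "progress D X0 (insert (\<gamma>, q, u) Done) ?s" "?s 5 0 = \<gamma>" "?s 6 0 = int q"
    using progress_try[of D X0 Done s \<gamma> q u] Cons.prems assms(5) by auto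
  have "progress D X0 (insert (\<gamma>, q, u) Done \<union> {(\<gamma>, q, vs) | vs. vs \<in> set us})
      (effect (seqs (map (\<lambda>vs. try_code (move_code M J vs)) us)) ?s) \<and>
      effect (seqs (map (\<lambda>vs. try_code (move_code M J vs)) us)) ?s 5 0 = \<gamma> \<and>
      effect (seqs (map (\<lambda>vs. try_code (move_code M J vs)) us)) ?s 6 0 = int q"
    using Cons.prems(4) by (intro Cons.IH[OF u]) auto
  then show ?case by (auto elim!: progress_mono)
qed (auto elim!: progress_mono)

lemma progress_set_reg:
  assumes "progress D X0 Done s" "\<bar>v\<bar> \<le> 2 ^ \<beta>" "r = 5 \<or> r = 6"
  shows "progress D X0 Done (s(r := (s r)(0 := v)))"
  using assms mem_bounded_upd[of \<beta> s v r 0] unfolding progress_def state_ok_def by auto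

definition layers_time where
  "layers_time = (l ^ g + 1) * (aexp_factor (reg 6) * \<beta> + time_factor (layers_body M J vss) * \<beta>)"

lemma runs_layers:
  assumes s: "progress D X0 Done s" "s 5 0 = \<gamma>" "s 6 0 = int (l ^ g)" and D: "0 \<le> D"
  shows "runs (While (reg 6) (layers_body M J vss)) s layers_time (\<lambda>s'. s' 5 0 = \<gamma> \<and>
    progress D X0 (Done \<union> {(\<gamma>, q, vs) | q vs. q < l ^ g \<and> vs \<in> set vss}) s')"
proof -
  \<comment> \<open>The codes count down, so those already treated are the ones not below the
    current value.\<close>
  define Dn where "Dn q = Done \<union> {(\<gamma>, q', vs) | q' vs. q \<le> q' \<and> q' < l ^ g \<and> vs \<in> set vss}" for q
  define I where "I s \<longleftrightarrow> (\<exists>q \<le> l ^ g. s 6 0 = int q \<and> s 5 0 = \<gamma> \<and> progress D X0 (Dn q) s)" for s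
  have lf: "loop_free (layers_body M J vss)"
    by (auto simp: layers_body_def loop_free_try_code)
  have bnd: "mem_bounded \<beta> s" if "I s" for s
    using that by (auto simp: I_def progress_def state_ok_def)
  have "runs (While (reg 6) (layers_body M J vss)) s
      ((nat (s 6 0) + 1) * (aexp_factor (reg 6) * \<beta> + time_factor (layers_body M J vss) * \<beta>))
      (\<lambda>s'. I s' \<and> \<not> aval (reg 6) s' > 0)"
  proof (rule runs_While[where m = "\<lambda>s. nat (s 6 0)"])
    fix s assume I: "I s" and pos: "aval (reg 6) s > 0"
    obtain q where q: "q \<le> l ^ g" "s 6 0 = int q" "s 5 0 = \<gamma>" "progress D X0 (Dn q) s"
      using I unfolding I_def by blast
    then obtain q' where q': "q = Suc q'" using pos by (cases q) auto
    let ?s = "s(6 := (s 6)(0 := int q'))"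
    have "int q \<le> 2 ^ \<beta>" using q(1) \<beta>(5) by linarith
    then have "\<bar>int q'\<bar> \<le> 2 ^ \<beta>" using q' by linarith
    then have "progress D X0 (Dn q) ?s" by (intro progress_set_reg[OF q(4)]) simp_all
    then have "progress D X0 (Dn q \<union> {(\<gamma>, q',
        vs) | vs. vs \<in> set vss}) (effect (layers_body M J vss) s) \<and>
        effect (layers_body M J vss) s 5 0 = \<gamma> \<and> effect (layers_body M J vss) s 6 0 = int q'"
      using progress_tries[of D X0 "Dn q" ?s \<gamma> q' vss] D q q' by (simp add: layers_body_def)
    moreover have "Dn q' \<subseteq> Dn q \<union> {(\<gamma>, q', vs) | vs. vs \<in> set vss}"
      unfolding Dn_def q' by (auto simp: Suc_le_eq le_less)
    ultimately have "I (effect (layers_body M J vss) s) \<and>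
        nat (effect (layers_body M J vss) s 6 0) < nat (s 6 0)"
      unfolding I_def using q q' progress_mono by auto
    then show "runs (layers_body M J vss) s (time_factor (layers_body M J vss) * \<beta>)
        (\<lambda>s'. I s' \<and> nat (s' 6 0) < nat (s 6 0))"
      by (intro runs_loop_free[OF lf \<beta>(1) bnd[OF I]])
  next
    show "acost (reg 6) s \<le> aexp_factor (reg 6) * \<beta>" if "I s" for s
      using aexp_factor(2)[OF \<beta>(1) bnd[OF that]] .
  next
    have "Dn (l ^ g) = Done" unfolding Dn_def by auto
    then show "I s" unfolding I_def using s by (intro exI[of _ "l ^ g"]) simp
  qed
  then show ?thesis
  proof (rule runs_mono)
    show "(nat (s 6 0) + 1) * (aexp_factor (reg 6) * \<beta> +
        time_factor (layers_body M J vss) * \<beta>) \<le> layers_time"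
      unfolding layers_time_def s(3) nat_int by (rule order_refl)
    fix s' assume s': "I s' \<and> \<not> aval (reg 6) s' > 0"
    then have "s' 5 0 = \<gamma>" "progress D X0 (Dn 0) s'" unfolding I_def by auto
    then show "s' 5 0 = \<gamma> \<and>
        progress D X0 (Done \<union> {(\<gamma>, q, vs) | q vs. q < l ^ g \<and> vs \<in> set vss}) s'"
      by (auto elim!: progress_mono simp: Dn_def)
  qed
qed

end

context augmentation
begin

definition step_time where
  "step_time = time_factor (set_reg 6 (pow_expr g)) * \<beta> +
     (layers_time + time_factor (set_reg 5 (Div (reg 5) (Const 2))) * \<beta>)"

definition tried where
  "tried n = {(T div 2 ^ m, q, vs) | m q vs. m < n \<and> q < l ^ g \<and> vs \<in> set vss}"

lemma abs_div_two_pow_le: "\<bar>T div 2 ^ n\<bar> \<le> 2 ^ \<beta>"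
  using abs_div_le[of T "2 ^ n"] T \<beta>(2) by linarith

lemma runs_step:
  assumes s: "progress D X0 (tried n) s" "s 5 0 = T div 2 ^ n" and D: "0 \<le> D"
  shows "runs (step_body M J vss g) s step_time
    (\<lambda>s'. s' 5 0 = T div 2 ^ Suc n \<and> progress D X0 (tried (Suc n)) s')"
  unfolding step_body_def step_time_def
proof (rule runs_Seq)
  have i: "s 0 1 = int l" "mem_bounded \<beta> s"
      using s(1) In_1 by (auto simp: progress_def state_ok_def)
  have "\<bar>int (l ^ g)\<bar> \<le> 2 ^ \<beta>" using \<beta>(5) by linarith
  then have "progress D X0 (tried n) (s(6 := (s 6)(0 := int (l ^ g))))"
    by (intro progress_set_reg[OF s(1)]) simp_all
  then show "runs (set_reg 6 (pow_expr g)) s (time_factor (set_reg 6 (pow_expr g)) * \<beta>)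
      (\<lambda>s. s 5 0 = T div 2 ^ n \<and> s 6 0 = int (l ^ g) \<and> progress D X0 (tried n) s)"
    using s(2) i by (intro runs_loop_free \<beta>(1)) (auto simp: aval_pow_expr)
next
  fix s assume s: "s 5 0 = T div 2 ^ n \<and> s 6 0 = int (l ^ g) \<and> progress D X0 (tried n) s"
  show "runs (Seq (While (reg 6) (layers_body M J vss)) (set_reg 5 (Div (reg 5) (Const 2)))) s
      (layers_time + time_factor (set_reg 5 (Div (reg 5) (Const 2))) * \<beta>)
      (\<lambda>s'. s' 5 0 = T div 2 ^ Suc n \<and> progress D X0 (tried (Suc n)) s')"
  proof (rule runs_Seq)
    show "runs (While (reg 6) (layers_body M J vss)) s layers_time (\<lambda>s'. s' 5 0 = T div 2 ^ n \<and>
        progress D X0 (tried n \<union> {(T div 2 ^ n, q, vs) | q vs. q < l ^ g \<and> vs \<in> set vss}) s')"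
      using s D by (intro runs_layers) auto
  next
    fix s assume s: "s 5 0 = T div 2 ^ n \<and>
        progress D X0 (tried n \<union> {(T div 2 ^ n, q, vs) | q vs. q < l ^ g \<and> vs \<in> set vss}) s"
    have "tried (Suc n) \<subseteq> tried n \<union> {(T div 2 ^ n, q, vs) | q vs. q < l ^ g \<and> vs \<in> set vss}"
      unfolding tried_def by (auto simp: less_Suc_eq)
    with s have p: "progress D X0 (tried (Suc n)) s" using progress_mono by blast
    have half: "T div 2 ^ n div 2 = T div 2 ^ Suc n"
      by (simp add: zdiv_zmult2_eq[symmetric] mult.commute)
    have "progress D X0 (tried (Suc n)) (s(5 := (s 5)(0 := T div 2 ^ Suc n)))"
      by (intro progress_set_reg[OF p abs_div_two_pow_le]) simp
    moreover have "mem_bounded \<beta> s" using p by (auto simp: progress_def state_ok_def)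
    ultimately show "runs (set_reg 5 (Div (reg 5) (Const 2))) s
        (time_factor (set_reg 5 (Div (reg 5) (Const 2))) * \<beta>)
        (\<lambda>s'. s' 5 0 = T div 2 ^ Suc n \<and> progress D X0 (tried (Suc n)) s')"
      using s half by (intro runs_loop_free \<beta>(1)) simp_all
  qed
qed

text \<open>The number of halvings of \<open>T\<close> is at most \<open>\<beta> + 1\<close>; the
  last unit is for the failing test.\<close>

definition pass_time where
  "pass_time = (\<beta> + 2) * (aexp_factor (reg 5) * \<beta> + step_time)"

lemma floorlog_le:
  assumes "x \<le> 2 ^ \<beta>"
  shows "floorlog 2 (nat x) \<le> \<beta> + 1"
proof (rule floorlog_leI)
  have "nat x \<le> nat (2 ^ \<beta>)" using assms by (rule nat_mono)
  also have "\<dots> = 2 ^ \<beta>" by (simp add: nat_power_eq)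
  also have "\<dots> < 2 ^ (\<beta> + 1)" by simp
  finally show "nat x < 2 ^ (\<beta> + 1)" .
qed auto

lemma floorlog_half:
  assumes "0 < x"
  shows "floorlog 2 (nat x) = Suc (floorlog 2 (nat (x div 2)))"
proof -
  have "nat (x div 2) = nat x div 2" by (simp add: nat_div_distrib)
  then show ?thesis using compute_floorlog[of 2 "nat x"] assms by simp
qed

lemma runs_steps:
  assumes s: "progress D X0 {} s" "s 5 0 = T" and D: "0 \<le> D"
  shows "runs (While (reg 5) (step_body M J vss g)) s pass_time
    (\<lambda>s'. progress D X0 {(T div 2 ^ n, q, vs) | n q vs. 0 < T div 2 ^ n \<and> q < l ^ g \<and>
        vs \<in> set vss} s')"
proof -
  define I where "I s \<longleftrightarrow> (\<exists>n. s 5 0 = T div 2 ^ n \<and> progress D X0 (tried n) s)" for s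
  have bnd: "mem_bounded \<beta> s" if "I s" for s
    using that by (auto simp: I_def progress_def state_ok_def)
  have "runs (While (reg 5) (step_body M J vss g)) s
      ((floorlog 2 (nat (s 5 0)) + 1) * (aexp_factor (reg 5) * \<beta> + step_time))
      (\<lambda>s'. I s' \<and> \<not> aval (reg 5) s' > 0)"
  proof (rule runs_While[where m = "\<lambda>s. floorlog 2 (nat (s 5 0))"])
    fix s assume I: "I s" and pos: "aval (reg 5) s > 0"
    obtain n where n: "s 5 0 = T div 2 ^ n" "progress D X0 (tried n) s"
      using I unfolding I_def by blast
    have half: "T div 2 ^ Suc n = T div 2 ^ n div 2"
      by (simp add: zdiv_zmult2_eq[symmetric] mult.commute)
    have less: "floorlog 2 (nat (T div 2 ^ Suc n)) < floorlog 2 (nat (s 5 0))"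
      using floorlog_half[of "s 5 0"] pos n(1) half by simp
    show "runs (step_body M J vss g) s step_time
        (\<lambda>s'. I s' \<and> floorlog 2 (nat (s' 5 0)) < floorlog 2 (nat (s 5 0)))"
    proof (rule runs_mono[OF runs_step[OF n(2,1) D]])
      fix s' assume s': "s' 5 0 = T div 2 ^ Suc n \<and> progress D X0 (tried (Suc n)) s'"
      then have "I s'" unfolding I_def by blast
      then show "I s' \<and> floorlog 2 (nat (s' 5 0)) < floorlog 2 (nat (s 5 0))" using s' less by metis
    qed simp
  next
    show "acost (reg 5) s \<le> aexp_factor (reg 5) * \<beta>" if "I s" for s
      using aexp_factor(2)[OF \<beta>(1) bnd[OF that]] .
  next
    have "tried 0 = {}" unfolding tried_def by auto
    then show "I s" unfolding I_def using s by (intro exI[of _ 0]) simp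
  qed
  then show ?thesis
  proof (rule runs_mono)
    have "floorlog 2 (nat (s 5 0)) + 1 \<le> \<beta> + 2" using floorlog_le[OF \<beta>(2)] s(2) by simp
    then show "(floorlog 2 (nat (s 5 0)) + 1) * (aexp_factor (reg 5) * \<beta> + step_time) \<le> pass_time"
      unfolding pass_time_def by (rule mult_le_mono1)
    fix s' assume s': "I s' \<and> \<not> aval (reg 5) s' > 0"
    then obtain n where "s' 5 0 = T div 2 ^ n" and p: "progress D X0 (tried n) s'"
        unfolding I_def by blast
    then have n: "T div 2 ^ n \<le> 0" using s' by (simp add: not_less)
    \<comment> \<open>Quotients decrease with the exponent, so every positive step length came
      before the one at which the loop stopped.\<close>
    have "m < n" if "0 < T div 2 ^ m" for m
    proof (rule ccontr)
      assume "\<not> m < n"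
      then have "T div 2 ^ m \<le> T div 2 ^ n" using T
        by (intro zdiv_mono2) (auto intro: power_increasing)
      then show False using that n by simp
    qed
    then have "{(T div 2 ^ n, q, vs) | n q vs. 0 < T div 2 ^ n \<and> q < l ^ g \<and>
        vs \<in> set vss} \<subseteq> tried n"
      unfolding tried_def by blast
    then show "progress D X0 {(T div 2 ^ n, q, vs) | n q vs. 0 < T div 2 ^ n \<and> q < l ^ g \<and>
        vs \<in> set vss} s'"
      by (rule progress_mono[OF p])
  qed
qed

text \<open>The number of pairs of a code and a tuple, increased by one to be positive even if
  \<open>vss\<close> is empty.\<close>

definition K where "K = int (l ^ g * length vss) + 1"

lemma stuck_gap:
  assumes X: "feas X" and Y: "feas Y" and D: "1 \<le> D"
    and stuck: "\<forall>(\<gamma>, q, vs)\<in>{(T div 2 ^ n, q, vs) | n q vs.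
      0 < T div 2 ^ n \<and> q < l ^ g \<and> vs \<in> set vss}. blocked D X \<gamma> q vs"
  shows "cost X - cost Y \<le> 2 * K * (D - 1)"
proof -
  have "in_kernel M J A l (\<lambda>a. (Y a - base a) + (- 1) * (X a - base a))"
    using X Y unfolding feas_def by (intro in_kernel_add in_kernel_scale) auto
  then have ker: "in_kernel M J A l (\<lambda>a. Y a - X a)" by simp
  have "cost X - cost Y \<le> 2 * int (l ^ g * length vss) * (D - 1)"
    unfolding cost_def
  proof (rule no_augmentation_imp_near_optimal[OF dec l short ker _ feas_le[OF X] _ feas_le[OF Y]
      _ D])
    show "0 \<le> X a" "0 \<le> Y a" for a using X Y by (auto simp: feas_def)
    fix n q vs
    assume q: "q < l ^ g" "vs \<in> set vss"
      and nonneg: "\<And>a. 0 \<le> X a + T div 2 ^ n * vec_of (move_entries M J l (choose_layers l q vs)) a"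
    show "- (T div 2 ^ n * linear_cost (slack_weight M l In W) N
        (vec_of (move_entries M J l (choose_layers l q vs)))) < D"
    proof (cases "0 < T div 2 ^ n")
      case True
      then have "blocked D X (T div 2 ^ n) q vs" using stuck q by blast
      then show ?thesis using nonneg unfolding blocked_def move_vec_def cost_def by blast
    next
      \<comment> \<open>A zero step changes nothing, so its gain is below \<open>D\<close>.\<close>
      case False
      then have "T div 2 ^ n = 0" using T by (simp add: pos_imp_zdiv_nonneg_iff order_antisym)
      then show ?thesis using D by simp
    qed
  qed
  also have "\<dots> \<le> 2 * K * (D - 1)" using D unfolding K_def by (intro mult_right_mono) auto
  finally show ?thesis .
qed

definition augment_time where
  "augment_time = ((4 * nat K + 2) * (\<beta> + 1) + 4 * nat K + 1) *
     (aexp_factor (reg 4) * \<beta> + (time_factor start_pass * \<beta> + (pass_time +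
         time_factor finish_pass * \<beta>)))"

text \<open>Iterations are counted by the length of \<open>D\<close>, weighted by \<open>4 K + 2\<close>, plus the quotient of the
  remaining gap and \<open>D\<close>, which is at most \<open>4 K\<close> after every halving.\<close>

lemma runs_augment:
  assumes s: "state_ok s" "s 4 0 = 2 * T * T * W" and \<beta>': "2 * T * T * W \<le> 2 ^ \<beta>"
  shows "runs (augment M J vss g) s augment_time
    (\<lambda>s'. state_ok s' \<and> (\<forall>Y. feas Y \<longrightarrow> cost (s' 1) \<le> cost Y))"
proof -
  obtain Y where Y: "feas Y" "\<And>X. feas X \<Longrightarrow> cost Y \<le> cost X" using minimizer_exists by blast
  define gap where "gap s = cost (s 1) - cost Y" for s :: memory
  \<comment> \<open>At exit register 4 is \<open>0\<close>, and the bound on the gap becomes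
    optimality.\<close>
  define I where "I s \<longleftrightarrow> state_ok s \<and> 0 \<le> s 4 0 \<and> s 4 0 \<le> 2 ^ \<beta> \<and> gap s \<le> 4 * K * s 4 0" for s
  define m where "m s = (4 * nat K + 2) * floorlog 2 (nat (s 4 0)) + nat (gap s div s 4 0)"
      for s :: memory
  have K: "1 \<le> K" unfolding K_def by simp
  have gap: "0 \<le> gap s" if "state_ok s" for s using that Y(2) by (simp add: gap_def state_ok_def)
  have bnd: "mem_bounded \<beta> s" if "I s" for s using that by (simp add: I_def state_ok_def)
  have lf: "loop_free start_pass" "loop_free finish_pass"
      by (auto simp: start_pass_def finish_pass_def)
  have "runs (augment M J vss g) s ((m s + 1) * (aexp_factor (reg 4) * \<beta> +
      (time_factor start_pass * \<beta> + (pass_time + time_factor finish_pass * \<beta>))))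
      (\<lambda>s'. I s' \<and> \<not> aval (reg 4) s' > 0)"
    unfolding augment_def
  proof (rule runs_While[where m = m])
    fix s assume I: "I s" and pos: "aval (reg 4) s > 0"
    define D where "D = s 4 0"
    have D: "1 \<le> D" "D \<le> 2 ^ \<beta>" and s4: "s 4 0 = D" using pos I by (auto simp: D_def I_def)
    have state_ok: "state_ok s" and gap_s: "gap s \<le> 4 * K * D" using I by (auto simp: I_def D_def)
    define X0 where "X0 = s 1"
    have X0: "feas X0" using state_ok by (simp add: X0_def state_ok_def)
    let ?stuck = "{(T div 2 ^ n, q, vs) | n q vs. 0 < T div 2 ^ n \<and> q < l ^ g \<and> vs \<in> set vss}"
    show "runs (Seq start_pass (Seq (While (reg 5) (step_body M J vss g)) finish_pass)) s
        (time_factor start_pass * \<beta> + (pass_time + time_factor finish_pass * \<beta>))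
        (\<lambda>s'. I s' \<and> m s' < m s)"
    proof (rule runs_Seq)
      let ?s = "s(7 := (s 7)(0 := 0), 5 := (s 5)(0 := T))"
      have "mem_bounded \<beta> ?s"
        using mem_bounded_upd[OF mem_bounded_upd[OF bnd[OF I]], of 0 T 7 0 5 0] T \<beta>(2) by simp
      then have "progress D X0 {} ?s"
          using state_ok s4 by (auto simp: progress_def state_ok_def X0_def)
      moreover have "effect start_pass s = ?s"
          using state_ok by (auto simp: start_pass_def state_ok_def)
      ultimately show "runs start_pass s (time_factor start_pass * \<beta>)
          (\<lambda>s. progress D X0 {} s \<and> s 5 0 = T)"
        by (intro runs_loop_free[OF lf(1) \<beta>(1) bnd[OF I]]) simp
    next
      fix s1 assume s1: "progress D X0 {} s1 \<and> s1 5 0 = T"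
      show "runs (Seq (While (reg 5) (step_body M J vss g)) finish_pass) s1
          (pass_time + time_factor finish_pass * \<beta>) (\<lambda>s'. I s' \<and> m s' < m s)"
      proof (rule runs_Seq)
        show "runs (While (reg 5) (step_body M J vss g)) s1 pass_time (progress D X0 ?stuck)"
          using s1 D by (intro runs_steps) auto
      next
        fix s2 assume s2: "progress D X0 ?stuck s2"
        have inv2: "state_ok s2" and s24: "s2 4 0 = D" using s2 by (auto simp: progress_def)
        have "I (effect finish_pass s2) \<and> m (effect finish_pass s2) < m s"
        proof (cases "s2 7 0 = 1")
          case True
          then have e: "effect finish_pass s2 = s2" by (simp add: finish_pass_def)
          have "gap s2 \<le> gap s - D" using s2 True unfolding progress_def gap_def X0_def by auto
          moreover from this have "gap s2 div D \<le> (gap s - D) div D"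
              using D by (intro zdiv_mono1) auto
          moreover have "(gap s - D + D) div D = (gap s - D) div D + 1"
            using D by (intro div_add_self2) simp
          ultimately have "gap s2 div D \<le> gap s div D - 1" "gap s2 \<le> gap s - D" by simp_all
          moreover have "0 \<le> gap s2 div D"
              using gap[OF inv2] D by (simp add: pos_imp_zdiv_nonneg_iff)
          ultimately show ?thesis using inv2 gap_s D unfolding e I_def m_def s24 s4 by auto
        next
          case False
          then have s27: "s2 7 0 = 0" "s2 1 = X0" and
            stuck: "\<forall>(\<gamma>, q, vs)\<in>?stuck. blocked D X0 \<gamma> q vs" using s2 by (auto simp: progress_def)
          define s3 where "s3 = s2(4 := (s2 4)(0 := D div 2))"
          have e: "effect finish_pass s2 = s3" using s27 s24 by (simp add: finish_pass_def s3_def)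
          \<comment> \<open>The third fact is where integrality pays off: \<open>stuck_gap\<close>
            involves \<open>D - 1\<close>, and this is covered by twice the rounded half.\<close>
          have D2: "0 \<le> D div 2" "D div 2 \<le> 2 ^ \<beta>" "D - 1 \<le> 2 * (D div 2)" using D by linarith+
          then have "mem_bounded \<beta> s3"
            unfolding s3_def using inv2 by (intro mem_bounded_upd) (auto simp: state_ok_def)
          then have inv3: "state_ok s3" using inv2 by (auto simp: state_ok_def s3_def)
          have "gap s3 \<le> 2 * K * (D - 1)"
            using stuck_gap[OF X0 Y(1) D(1) stuck] s27(2) by (simp add: gap_def s3_def)
          also have "\<dots> \<le> 2 * K * (2 * (D div 2))" using D2(3) K by (intro mult_left_mono) auto
          finally have g3: "gap s3 \<le> 4 * K * (D div 2)" by simp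
          have I3: "I s3" using inv3 D2 g3 by (simp add: I_def) (simp add: s3_def)
          \<comment> \<open>For \<open>D = 1\<close> the new value is \<open>0\<close>, and division
            by zero yields \<open>0\<close>.\<close>
          have "gap s3 div (D div 2) \<le> 4 * K"
          proof (cases "D div 2 = 0")
            case False
            then have "0 < D div 2" using D2 by linarith
            then show ?thesis using zdiv_mono1[OF g3, of "D div 2"] by simp
          qed (use K in simp)
          then have "nat (gap s3 div (D div 2)) \<le> 4 * nat K" using K by linarith
          moreover have "floorlog 2 (nat D) = Suc (floorlog 2 (nat (D div 2)))"
              using D by (intro floorlog_half) auto
          ultimately have "m s3 < m s" unfolding m_def s4 by (simp add: s3_def)
          then show ?thesis using I3 e by simp
        qed
        then show "runs finish_pass s2 (time_factor finish_pass * \<beta>) (\<lambda>s'. I s' \<and> m s' < m s)"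
          using inv2 by (intro runs_loop_free[OF lf(2) \<beta>(1)]) (auto simp: state_ok_def)
      qed
    qed
  next
    show "acost (reg 4) s \<le> aexp_factor (reg 4) * \<beta>" if "I s" for s
      using aexp_factor(2)[OF \<beta>(1) bnd[OF that]] .
  next
    \<comment> \<open>Both costs have absolute value at most \<open>T * T * W\<close>; this is the
      origin of the initial value of register 4.\<close>
    have "gap s \<le> 2 * T * T * W"
      using cost_bound[of "s 1"] cost_bound[OF Y(1)] s(1) unfolding gap_def state_ok_def by auto
    moreover have pos: "0 \<le> 2 * T * T * W" using T W by simp
    then have "1 * (2 * T * T * W) \<le> 4 * K * (2 * T * T * W)"
        using K by (intro mult_right_mono) auto
    then have "2 * T * T * W \<le> 4 * K * (2 * T * T * W)" by (simp only: mult_1_left)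
    ultimately show "I s" unfolding I_def s(2) using s(1) \<beta>' pos by (meson order_trans)
  qed
  then show ?thesis
  proof (rule runs_mono)
    have "floorlog 2 (nat (s 4 0)) \<le> \<beta> + 1" unfolding s(2) by (rule floorlog_le[OF \<beta>'])
    then have "(4 * nat K + 2) * floorlog 2 (nat (s 4 0)) \<le> (4 * nat K + 2) * (\<beta> + 1)"
      by (rule mult_le_mono2)
    moreover have "nat (gap s div s 4 0) \<le> 4 * nat K"
    proof -
      have pos: "1 \<le> s 4 0" unfolding s(2)
          using T W by (metis (no_types,
          opaque_lifting) int_one_le_iff_zero_less mult_pos_pos order_less_le_trans
          zero_less_numeral zero_less_one)
      have "gap s \<le> s 4 0"
        using cost_bound[of "s 1"] cost_bound[OF Y(1)] s unfolding gap_def state_ok_def by auto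
      then have "gap s div s 4 0 \<le> s 4 0 div s 4 0" using pos by (intro zdiv_mono1) auto
      also have "\<dots> = 1" using pos by simp
      finally show ?thesis using K by linarith
    qed
    ultimately show "(m s + 1) * (aexp_factor (reg 4) * \<beta> +
        (time_factor start_pass * \<beta> + (pass_time + time_factor finish_pass * \<beta>))) \<le> augment_time"
      unfolding augment_time_def m_def by (intro mult_le_mono1) linarith
    fix s' assume s': "I s' \<and> \<not> aval (reg 4) s' > 0"
    then have "state_ok s'" "s' 4 0 = 0" "gap s' \<le> 0" by (auto simp: I_def)
    then show "state_ok s' \<and> (\<forall>Y. feas Y \<longrightarrow> cost (s' 1) \<le> cost Y)"
      using Y(2) unfolding gap_def by (metis diff_le_0_iff_le order_trans)
  qed
qed

end

section \<open>Solving n-fold integer programs\<close>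

context augmentation
begin

abbreviation st where "st \<equiv> addr l M 0"

definition obj_part where "obj_part X = (\<Sum>a\<in>{2..<st}. In a * X a)"

definition slack_part where "slack_part X = (\<Sum>a\<in>{st..<N}. X a)" for X :: "int \<Rightarrow> int"

lemma st_bounds: "2 \<le> st" "st \<le> N"
proof -
  have "int M * int l \<le> int (M + J) * int l" by (intro mult_right_mono) auto
  then show "st \<le> N" by (simp add: addr_def N_def)
qed (simp add: addr_def)

lemma cost_split: "cost X = obj_part X + W * slack_part X"
proof -
  have "{2..<N} = {2..<st} \<union> {st..<N}" using st_bounds by auto
  then have "cost X = (\<Sum>a\<in>{2..<st}. slack_weight M l In W a * X a) +
      (\<Sum>a\<in>{st..<N}. slack_weight M l In W a * X a)"
    unfolding cost_def linear_cost_def by (simp add: sum.union_disjoint)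
  then show ?thesis by (simp add: obj_part_def slack_part_def slack_weight_def sum_distrib_left)
qed

lemma slack_part_nonneg: "feas X \<Longrightarrow> 0 \<le> slack_part X"
  unfolding slack_part_def feas_def by (intro sum_nonneg) auto

lemma slack_zero_iff: "feas X \<Longrightarrow> slack_part X = 0 \<longleftrightarrow> (\<forall>a. st \<le> a \<and> a < N \<longrightarrow> X a = 0)"
  unfolding slack_part_def feas_def by (subst sum_nonneg_eq_0_iff) auto

text \<open>The absolute costs together amount to at most \<open>T\<close>, and each multiplies an
  entry of size at most \<open>T\<close>. Two objective values thus differ by at most
  \<open>2 * T * T\<close>.\<close>

lemma obj_part_bound:
  assumes "feas X" "(\<Sum>a\<in>{2..<N}. \<bar>In a\<bar>) \<le> T"
  shows "\<bar>obj_part X\<bar> \<le> T * T"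
proof -
  have "\<bar>obj_part X\<bar> \<le> (\<Sum>a\<in>{2..<st}. \<bar>In a * X a\<bar>)" unfolding obj_part_def by (rule sum_abs)
  also have "\<dots> \<le> (\<Sum>a\<in>{2..<st}. \<bar>In a\<bar> * T)"
    unfolding abs_mult using feas_le[OF assms(1)] assms(1)
    by (intro sum_mono mult_left_mono) (auto simp: feas_def)
  also have "\<dots> = (\<Sum>a\<in>{2..<st}. \<bar>In a\<bar>) * T" by (simp add: sum_distrib_right)
  also have "\<dots> \<le> (\<Sum>a\<in>{2..<N}. \<bar>In a\<bar>) * T"
    using st_bounds T by (intro mult_right_mono sum_mono2) auto
  also have "\<dots> \<le> T * T" using assms(2) T by (intro mult_right_mono) auto
  finally show ?thesis .
qed

text \<open>The original problem, without slack. Position \<open>i * l + k\<close> is variable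
  \<open>i\<close> in layer \<open>k\<close>, at address \<open>2 + (i * l + k)\<close>.\<close>

definition solves :: "(nat \<Rightarrow> nat) \<Rightarrow> bool" where
  "solves x \<longleftrightarrow>
     (\<forall>j<J. \<forall>k<l. (\<Sum>i<M. A j i * int (x (i * l + k))) = In (addr l (M + j) k)) \<and>
     (\<forall>i<M. (\<Sum>k<l. int (x (i * l + k))) = In (addr l (M + J) i))"

definition obj :: "(nat \<Rightarrow> nat) \<Rightarrow> int" where
  "obj x = (\<Sum>p<M * l. In (2 + int p) * int (x p))"

lemma sum_cells: "(\<Sum>a\<in>{2..<st}. f a) = (\<Sum>p<M * l. f (2 + int p))" for f :: "int \<Rightarrow> int"
proof (rule sum.reindex_bij_witness[of _ "\<lambda>p. 2 + int p" "\<lambda>a. nat (a - 2)"])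
  fix a assume "a \<in> {2..<st}"
  then have "a - 2 < int (M * l)" "2 \<le> a" by (auto simp: addr_def)
  then show "nat (a - 2) \<in> {..<M * l}" by (simp add: nat_less_iff del: of_nat_mult)
next
  fix p assume "p \<in> {..<M * l}"
  then have "int p < int M * int l"
    by (simp only: lessThan_iff of_nat_less_iff flip: of_nat_mult)
  then show "2 + int p \<in> {2..<st}" by (simp add: addr_def)
qed auto

lemma base_st: "st \<le> a \<Longrightarrow> a < N \<Longrightarrow> base a = In a"
  by (simp add: base_def)

lemma slack_addr: "j < J \<Longrightarrow> k < l \<Longrightarrow> st \<le> addr l (M + j) k \<and> addr l (M + j) k < N"
proof -
  assume "j < J" "k < l"
  then have "addr l (M + j) k < addr l (M + J) 0" by (intro addr_less) auto
  also have "\<dots> \<le> N" by (simp add: N_def addr_def)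
  finally have "addr l (M + j) k < N" .
  moreover have "int M * int l \<le> int (M + j) * int l" by (intro mult_right_mono) auto
  then have "st \<le> addr l (M + j) k" by (simp add: addr_def)
  ultimately show ?thesis by simp
qed

lemma link_addr: "i < M \<Longrightarrow> st \<le> addr l (M + J) i \<and> addr l (M + J) i < N"
proof -
  assume "i < M"
  moreover have "int M * int l \<le> int (M + J) * int l" by (intro mult_right_mono) auto
  ultimately show ?thesis by (simp add: N_def addr_def)
qed

lemma addr_flat: "addr l i k = 2 + int (i * l + k)"
  by (simp add: addr_def)

lemma solves_imp_feas:
  assumes y: "solves y"
  shows "\<exists>Y. feas Y \<and> slack_part Y = 0 \<and> obj_part Y = obj y"
proof -
  define Y where "Y a = (if 2 \<le> a \<and> a < st then int (y (nat (a - 2))) else 0)" for a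
  have cell: "Y (addr l i k) = int (y (i * l + k))" if "i < M" "k < l" for i k
  proof -
    have "addr l i k < st" using that by (intro addr_less)
    then show ?thesis unfolding Y_def by (simp add: addr_flat del: of_nat_add of_nat_mult)
  qed
  have zero: "Y a = 0" if "st \<le> a" for a using that by (simp add: Y_def)
  have "in_kernel M J A l (\<lambda>a. Y a - base a)"
    unfolding in_kernel_def
  proof (intro conjI allI impI)
    fix a assume "\<not> (2 \<le> a \<and> a < addr l (M + J) M)"
    then show "Y a - base a = 0" using st_bounds by (auto simp: Y_def base_def N_def[symmetric])
  next
    fix j k assume jk: "j < J" "k < l"
    have "(\<Sum>i<M. A j i * (Y (addr l i k) - base (addr l i k))) = (\<Sum>i<M. A j i * int (y (i * l +
        k)))"
      using jk by (intro sum.cong) (auto simp: cell base_small)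
    then show "(\<Sum>i<M. A j i * (Y (addr l i k) - base (addr l i k))) +
        (Y (addr l (M + j) k) - base (addr l (M + j) k)) = 0"
      using y jk slack_addr[OF jk] by (simp add: solves_def base_st zero)
  next
    fix i assume i: "i < M"
    have "(\<Sum>k<l. Y (addr l i k) - base (addr l i k)) = (\<Sum>k<l. int (y (i * l + k)))"
      using i by (intro sum.cong) (auto simp: cell base_small)
    then show "(\<Sum>k<l. Y (addr l i k) - base (addr l i k)) +
        (Y (addr l (M + J) i) - base (addr l (M + J) i)) = 0"
      using y i link_addr[OF i] by (simp add: solves_def base_st zero)
  qed
  then have "feas Y" by (simp add: feas_def Y_def)
  moreover have "slack_part Y = 0" by (simp add: slack_part_def Y_def)
  moreover have "obj_part Y = obj y"
    unfolding obj_part_def obj_def sum_cells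
  proof (rule sum.cong[OF refl])
    fix p assume "p \<in> {..<M * l}"
    then have "int p < int M * int l"
      by (simp only: lessThan_iff of_nat_less_iff flip: of_nat_mult)
    then show "In (2 + int p) * Y (2 + int p) = In (2 + int p) * int (y p)"
      by (simp add: Y_def addr_def)
  qed
  ultimately show ?thesis by blast
qed

lemma feas_imp_solves:
  assumes X: "feas X" and slack: "slack_part X = 0"
  defines "x \<equiv> \<lambda>p. nat (X (2 + int p))"
  shows "solves x" "obj x = obj_part X"
proof -
  have x: "int (x p) = X (2 + int p)" for p using X by (simp add: x_def feas_def)
  have cell: "int (x (i * l + k)) = X (addr l i k)" for i k
    unfolding x addr_flat ..
  have zero: "X a = 0" if "st \<le> a \<and> a < N" for a using slack_zero_iff[OF X] slack that by blast
  show "solves x"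
    unfolding solves_def
  proof (intro conjI allI impI)
    show "(\<Sum>i<M. A j i * int (x (i * l + k))) = In (addr l (M + j) k)" if "j < J" "k < l" for j k
      using feas_cell[OF X that] slack_addr[OF that] by (simp add: cell zero base_st)
    show "(\<Sum>k<l. int (x (i * l + k))) = In (addr l (M + J) i)" if "i < M" for i
      using feas_link[OF X that] link_addr[OF that] by (simp add: cell zero base_st)
  qed
  show "obj x = obj_part X" by (simp add: obj_def obj_part_def sum_cells x)
qed

text \<open>\<open>W\<close> is one more than the largest possible difference of objectives, so a
  single unit of slack already outweighs it; among points without slack, cost and objective
  agree.\<close>

lemma minimizer_solves:
  assumes X: "feas X" "\<And>Y. feas Y \<Longrightarrow> cost X \<le> cost Y"
    and sum: "(\<Sum>a\<in>{2..<N}. \<bar>In a\<bar>) \<le> T" and W2: "W = 2 * T * T + 1"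
  shows "0 < slack_part X \<Longrightarrow> \<not> solves y"
    and "slack_part X = 0 \<Longrightarrow> solves y \<Longrightarrow> obj (\<lambda>p. nat (X (2 + int p))) \<le> obj y"
proof -
  assume pos: "0 < slack_part X"
  show "\<not> solves y"
  proof
    assume "solves y"
    then obtain Y where Y: "feas Y" "slack_part Y = 0" "obj_part Y = obj y"
        using solves_imp_feas by blast
    have "W * 1 \<le> W * slack_part X" using pos T W by (intro mult_left_mono) auto
    then have "obj_part X + W \<le> obj_part Y"
      using X(2)[OF Y(1)] Y(2) unfolding cost_split by simp
    then show False using obj_part_bound[OF X(1) sum] obj_part_bound[OF Y(1) sum] W2 by linarith
  qed
next
  assume zero: "slack_part X = 0" and "solves y"
  then obtain Y where "feas Y" "slack_part Y = 0" "obj_part Y = obj y"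
      using solves_imp_feas by blast
  then show "obj (\<lambda>p. nat (X (2 + int p))) \<le> obj y"
    using X(2)[of Y] feas_imp_solves(2)[OF X(1) zero] zero unfolding cost_split by simp
qed

end

section \<open>The complete program\<close>

definition read_length :: com where
  "read_length = Seq (set_reg 2 (reg 0)) (set_reg 10 (reg 0))"

text \<open>The costs occupy the addresses from 2 to \<open>1 + M * l\<close>. The same number is
  the length of an optimal output, which consists of a tag and \<open>M * l\<close> entries.\<close>

definition last_cost_expr :: "nat \<Rightarrow> aexp" where
  "last_cost_expr M = Add (Const 1) (Mul (Const (int M)) len_expr)"

text \<open>One downward scan does three jobs: register 2 accumulates absolute values and becomes
  \<open>T\<close>, the right-hand sides are copied to array 1 as the all-slack start, and a
  negative one sets register 9.\<close>

definition scan_body :: "nat \<Rightarrow> com" where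
  "scan_body M =
     Seq (Cond (Cell 0 (reg 10)) (set_reg 2 (Add (reg 2) (Cell 0 (reg 10))))
         (set_reg 2 (Sub (reg 2) (Cell 0 (reg 10)))))
    (Seq (Cond (Sub (reg 10) (last_cost_expr M))
            (Seq (Assign 1 (reg 10) (Cell 0 (reg 10)))
                 (Cond (Sub (Const 0) (Cell 0 (reg 10))) (set_reg 9 (Const 1)) Skip))
            Skip)
         (set_reg 10 (Sub (reg 10) (Const 1))))"

definition set_weights :: com where
  "set_weights = Seq (set_reg 3 (Add (Const 1) (Mul (Const 2) (Mul (reg 2) (reg 2)))))
     (set_reg 4 (Mul (Const 2) (Mul (Mul (reg 2) (reg 2)) (reg 3))))"

definition answer_infeasible :: com where
  "answer_infeasible = Seq (Assign 1 (Const 0) (Const 1)) (Assign 1 (Const 1) (Const 0))"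

definition start_sum :: com where
  "start_sum = Seq (set_reg 9 (Const 0)) (set_reg 10 (reg 0))"

definition sum_body :: com where
  "sum_body = Seq (set_reg 9 (Add (reg 9) (Cell 1 (reg 10)))) (set_reg 10 (Sub (reg 10) (Const 1)))"

text \<open>Since variables are stored from address 2 on, the optimal table already lies where the
  output is expected; only length and tag are missing. The slack behind it is cut off by the
  length.\<close>

definition answer_optimal :: "nat \<Rightarrow> com" where
  "answer_optimal M = Seq (Assign 1 (Const 0) (last_cost_expr M)) (Assign 1 (Const 1) (Const 2))"

definition final_answer :: "nat \<Rightarrow> com" where
  "final_answer M = Cond (reg 9) answer_infeasible (answer_optimal M)"

definition optimize :: "nat \<Rightarrow> nat \<Rightarrow> (nat \<Rightarrow> int) list list \<Rightarrow> nat \<Rightarrow> com" where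
  "optimize M J vss g = Seq set_weights (Seq (augment M J vss g) (Seq start_sum
     (Seq (While (Sub (reg 10) (last_cost_expr M)) sum_body) (final_answer M))))"

definition solver :: "nat \<Rightarrow> nat \<Rightarrow> (nat \<Rightarrow> int) list list \<Rightarrow> nat \<Rightarrow> com" where
  "solver M J vss g =
     Seq read_length (Seq (While (reg 10) (scan_body M))
       (Cond (reg 9) answer_infeasible (optimize M J vss g)))"

lemma aval_last_cost_expr: "s 0 1 = int l \<Longrightarrow> aval (last_cost_expr M) s = addr l M 0 - 1"
  by (simp add: last_cost_expr_def len_expr_def addr_def)

lemma effect_scan_body:
  fixes s :: memory
  assumes "s 0 1 = int l"
  defines "a \<equiv> s 10 0"
  shows "effect (scan_body M) s = s(2 := (s 2)(0 := s 2 0 + \<bar>s 0 a\<bar>),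
     1 := (if addr l M 0 \<le> a then (s 1)(a := s 0 a) else s 1),
     9 := (if addr l M 0 \<le> a \<and> s 0 a < 0 then (s 9)(0 := 1) else s 9),
     10 := (s 10)(0 := a - 1))"
proof -
  define s1 where "s1 = s(2 := (s 2)(0 := s 2 0 + \<bar>s 0 a\<bar>))"
  have 1: "effect (Cond (Cell 0 (reg 10)) (set_reg 2 (Add (reg 2) (Cell 0 (reg 10))))
      (set_reg 2 (Sub (reg 2) (Cell 0 (reg 10))))) s = s1"
    by (simp add: s1_def a_def)
  have v: "aval (last_cost_expr M) s1 = addr l M 0 - 1"
    using assms by (intro aval_last_cost_expr) (simp add: s1_def)
  have s1: "s1 10 0 = a" "s1 0 = s 0" "s1 1 = s 1" "s1 9 = s 9" "s1 10 = s 10"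
    by (simp_all add: s1_def a_def)
  show ?thesis
    unfolding scan_body_def effect.simps(3) 1
    using v s1 by (auto simp: fun_eq_iff s1_def)
qed

lemma sum_int_head: "k \<le> n \<Longrightarrow> (\<Sum>i\<in>{k..n}. f i) = f k + (\<Sum>i\<in>{k + 1..n}. f i)"
    for k n :: int and f :: "int \<Rightarrow> int"
proof -
  assume "k \<le> n"
  then have "{k..n} = insert k {k + 1..n}" by auto
  then show ?thesis by simp
qed

lemma runs_scan:
  fixes In :: "int \<Rightarrow> int" and n l M \<beta> :: nat
  assumes In: "In 0 = int n" "In 1 = int l" and T: "T = int n + (\<Sum>i\<in>{1..int n}. \<bar>In i\<bar>)"
      "T \<le> 2 ^ \<beta>" and \<beta>: "1 \<le> \<beta>"
    and s: "s 0 = In" "s 1 = (\<lambda>_. 0)" "s 2 0 = int n" "s 10 0 = int n" "s 9 0 = 0" "s 8 0 = 0"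
        "mem_bounded \<beta> s"
  shows "runs (While (reg 10) (scan_body M)) s
    ((n + 1) * (aexp_factor (reg 10) * \<beta> + time_factor (scan_body M) * \<beta>))
    (\<lambda>s'. s' 0 = In \<and> s' 2 0 = T \<and> s' 8 0 = 0 \<and> mem_bounded \<beta> s' \<and>
       s' 1 = (\<lambda>a. if addr l M 0 \<le> a \<and> a \<le> int n then In a else 0) \<and>
       (s' 9 0 > 0 \<longleftrightarrow> (\<exists>a. addr l M 0 \<le> a \<and> a \<le> int n \<and> In a < 0)))"
proof -
  define I where "I s \<longleftrightarrow> (\<exists>k. 0 \<le> k \<and> k \<le> int n \<and> s 10 0 = k \<and> s 0 = In \<and>
      s 2 0 = int n + (\<Sum>i\<in>{k + 1..int n}. \<bar>In i\<bar>) \<and> s 8 0 = 0 \<and> mem_bounded \<beta> s \<and>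
      s 1 = (\<lambda>a. if addr l M 0 \<le> a \<and> k < a \<and> a \<le> int n then In a else 0) \<and>
      (s 9 0 > 0 \<longleftrightarrow> (\<exists>a. addr l M 0 \<le> a \<and> k < a \<and> a \<le> int n \<and> In a < 0)))" for s :: memory
  have st: "2 \<le> addr l M 0" by (simp add: addr_def)
  have lf: "loop_free (scan_body M)" by (simp add: scan_body_def)
  have bnd: "mem_bounded \<beta> s" if "I s" for s using that by (auto simp: I_def)
  have "runs (While (reg 10) (scan_body M)) s
      ((nat (s 10 0) + 1) * (aexp_factor (reg 10) * \<beta> + time_factor (scan_body M) * \<beta>))
      (\<lambda>s'. I s' \<and> \<not> aval (reg 10) s' > 0)"
  proof (rule runs_While[where m = "\<lambda>s. nat (s 10 0)"])
    fix s assume I: "I s" and pos: "aval (reg 10) s > 0"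
    obtain k where k: "0 \<le> k" "k \<le> int n" "s 10 0 = k" "s 0 = In"
      "s 2 0 = int n + (\<Sum>i\<in>{k + 1..int n}. \<bar>In i\<bar>)" "s 8 0 = 0" "mem_bounded \<beta> s"
      "s 1 = (\<lambda>a. if addr l M 0 \<le> a \<and> k < a \<and> a \<le> int n then In a else 0)"
      "s 9 0 > 0 \<longleftrightarrow> (\<exists>a. addr l M 0 \<le> a \<and> k < a \<and> a \<le> int n \<and> In a < 0)"
      using I unfolding I_def by auto
    have k1: "1 \<le> k" using pos k(3) by simp
    let ?s = "effect (scan_body M) s"
    have e: "?s = s(2 := (s 2)(0 := s 2 0 + \<bar>In k\<bar>),
       1 := (if addr l M 0 \<le> k then (s 1)(k := In k) else s 1),
       9 := (if addr l M 0 \<le> k \<and> In k < 0 then (s 9)(0 := 1) else s 9),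
       10 := (s 10)(0 := k - 1))"
      using effect_scan_body[of s l M] In k by simp
    have sum: "s 2 0 + \<bar>In k\<bar> = int n + (\<Sum>i\<in>{k - 1 + 1..int n}. \<bar>In i\<bar>)"
      using sum_int_head[of k "int n" "\<lambda>i. \<bar>In i\<bar>"] k by simp
    have "(\<Sum>i\<in>{k - 1 + 1..int n}. \<bar>In i\<bar>) \<le> (\<Sum>i\<in>{1..int n}. \<bar>In i\<bar>)"
      using k1 by (intro sum_mono2) auto
    then have le: "s 2 0 + \<bar>In k\<bar> \<le> T" unfolding sum T(1) by simp
    have nonneg: "0 \<le> s 2 0" unfolding k(5) by (intro add_nonneg_nonneg sum_nonneg) auto
    have Ink: "\<bar>In k\<bar> \<le> 2 ^ \<beta>" using k(7) k(4) by (auto simp: mem_bounded_def)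
    have kb: "\<bar>k - 1\<bar> \<le> 2 ^ \<beta>" using k(3,7) k1 unfolding mem_bounded_def by (smt (verit))
    have "mem_bounded \<beta> ?s"
      unfolding e mem_bounded_def
      using k(7) le nonneg T(2) Ink kb unfolding mem_bounded_def by (auto simp: one_le_power)
    moreover have "?s 1 = (\<lambda>a. if addr l M 0 \<le> a \<and> k - 1 < a \<and> a \<le> int n then In a else 0)"
      unfolding e using k(2,8) by (auto simp: fun_eq_iff)
    moreover have "?s 9 0 > 0 \<longleftrightarrow> (\<exists>a. addr l M 0 \<le> a \<and> k - 1 < a \<and> a \<le> int n \<and> In a < 0)"
    proof -
      have "(\<exists>a. addr l M 0 \<le> a \<and> k - 1 < a \<and> a \<le> int n \<and> In a < 0) \<longleftrightarrow>
          (addr l M 0 \<le> k \<and> In k < 0) \<or> (\<exists>a. addr l M 0 \<le> a \<and> k < a \<and> a \<le> int n \<and> In a < 0)"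
        using k(2) by (metis int_one_le_iff_zero_less le_less linorder_not_le zle_diff1_eq)
      moreover have "?s 9 0 > 0 \<longleftrightarrow> (addr l M 0 \<le> k \<and> In k < 0) \<or> s 9 0 > 0"
        unfolding e by auto
      ultimately show ?thesis using k(9) by (simp only:)
    qed
    moreover have "?s 10 0 = k - 1" "?s 0 = In" "?s 2 0 = s 2 0 + \<bar>In k\<bar>" "?s 8 0 = 0"
      unfolding e using k by auto
    ultimately have "I ?s" unfolding I_def using k1 k(2) sum by (intro exI[of _ "k - 1"]) simp
    moreover have "nat (?s 10 0) < nat (s 10 0)" unfolding e using k k1 by simp
    ultimately show "runs (scan_body M) s (time_factor (scan_body M) * \<beta>)
        (\<lambda>s'. I s' \<and> nat (s' 10 0) < nat (s 10 0))"
      by (intro runs_loop_free[OF lf \<beta> k(7)]) simp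
  next
    show "acost (reg 10) s \<le> aexp_factor (reg 10) * \<beta>" if "I s" for s
      using aexp_factor(2)[OF \<beta> bnd[OF that]] .
  next
    show "I s" unfolding I_def using s In by (intro exI[of _ "int n"]) (auto simp: fun_eq_iff)
  qed
  then show ?thesis
  proof (rule runs_mono)
    show "(nat (s 10 0) + 1) * (aexp_factor (reg 10) * \<beta> + time_factor (scan_body M) * \<beta>) \<le>
        (n + 1) * (aexp_factor (reg 10) * \<beta> + time_factor (scan_body M) * \<beta>)"
      using s(4) by simp
    fix s' assume s': "I s' \<and> \<not> aval (reg 10) s' > 0"
    then obtain k where k: "0 \<le> k" "s' 10 0 = k" "s' 0 = In"
      "s' 2 0 = int n + (\<Sum>i\<in>{k + 1..int n}. \<bar>In i\<bar>)" "s' 8 0 = 0" "mem_bounded \<beta> s'"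
      "s' 1 = (\<lambda>a. if addr l M 0 \<le> a \<and> k < a \<and> a \<le> int n then In a else 0)"
      "s' 9 0 > 0 \<longleftrightarrow> (\<exists>a. addr l M 0 \<le> a \<and> k < a \<and> a \<le> int n \<and> In a < 0)"
      unfolding I_def by auto
    have "k = 0" using s' k by simp
    moreover have "addr l M 0 \<le> a \<and> 0 < a \<longleftrightarrow> addr l M 0 \<le> a" for a using st by auto
    ultimately show "s' 0 = In \<and> s' 2 0 = T \<and> s' 8 0 = 0 \<and> mem_bounded \<beta> s' \<and>
       s' 1 = (\<lambda>a. if addr l M 0 \<le> a \<and> a \<le> int n then In a else 0) \<and>
       (s' 9 0 > 0 \<longleftrightarrow> (\<exists>a. addr l M 0 \<le> a \<and> a \<le> int n \<and> In a < 0))"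
      using k T(1) by (simp flip: conj_assoc)
  qed
qed

lemma runs_sum:
  fixes In X :: "int \<Rightarrow> int" and n l M \<beta> :: nat
  assumes In: "In 0 = int n" "In 1 = int l" and le: "addr l M 0 \<le> int n + 1" and \<beta>: "1 \<le> \<beta>"
    and X: "\<And>a. 0 \<le> X a" "(\<Sum>i\<in>{addr l M 0..int n}. X i) \<le> 2 ^ \<beta>"
    and s: "s 0 = In" "s 1 = X" "s 9 0 = 0" "s 10 0 = int n" "mem_bounded \<beta> s"
  shows "runs (While (Sub (reg 10) (last_cost_expr M)) sum_body) s
    ((n + 1) * (aexp_factor (Sub (reg 10) (last_cost_expr M)) * \<beta> + time_factor sum_body * \<beta>))
    (\<lambda>s'. s' 0 = In \<and> s' 1 = X \<and> s' 9 0 = (\<Sum>i\<in>{addr l M 0..int n}. X i) \<and> mem_bounded \<beta> s')"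
proof -
  let ?g = "Sub (reg 10) (last_cost_expr M)"
  define st where "st = addr l M 0"
  define I where "I s \<longleftrightarrow> (\<exists>k. st - 1 \<le> k \<and> k \<le> int n \<and> s 10 0 = k \<and> s 0 = In \<and> s 1 = X \<and>
      s 9 0 = (\<Sum>i\<in>{k + 1..int n}. X i) \<and> mem_bounded \<beta> s)" for s :: memory
  have st: "2 \<le> st" by (simp add: st_def addr_def)
  have lf: "loop_free sum_body" by (simp add: sum_body_def)
  have bnd: "mem_bounded \<beta> s" if "I s" for s using that by (auto simp: I_def)
  have "runs (While ?g sum_body) s
      ((nat (s 10 0) + 1) * (aexp_factor ?g * \<beta> + time_factor sum_body * \<beta>))
      (\<lambda>s'. I s' \<and> \<not> aval ?g s' > 0)"
  proof (rule runs_While[where m = "\<lambda>s. nat (s 10 0)"])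
    fix s assume I: "I s" and pos: "aval ?g s > 0"
    obtain k where k: "st - 1 \<le> k" "k \<le> int n" "s 10 0 = k" "s 0 = In" "s 1 = X"
      "s 9 0 = (\<Sum>i\<in>{k + 1..int n}. X i)" "mem_bounded \<beta> s"
      using I unfolding I_def by auto
    have k1: "st \<le> k" using pos k(3,4) In aval_last_cost_expr[of s l M] by (simp add: st_def)
    let ?s = "effect sum_body s"
    have e: "?s = s(9 := (s 9)(0 := s 9 0 + X k), 10 := (s 10)(0 := k - 1))"
      unfolding sum_body_def using k by simp
    have sum: "s 9 0 + X k = (\<Sum>i\<in>{k - 1 + 1..int n}. X i)"
      using sum_int_head[of k "int n" X] k by simp
    have "(\<Sum>i\<in>{k - 1 + 1..int n}. X i) \<le> (\<Sum>i\<in>{st..int n}. X i)"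
      using k1 X(1) by (intro sum_mono2) auto
    then have "s 9 0 + X k \<le> 2 ^ \<beta>" unfolding sum using X(2)[folded st_def] by (rule order_trans)
    moreover have "0 \<le> s 9 0 + X k" unfolding sum using X(1) by (intro sum_nonneg) auto
    moreover have "\<bar>k - 1\<bar> \<le> 2 ^ \<beta>" using k(3,7) k1 st unfolding mem_bounded_def by (smt (verit))
    ultimately have "mem_bounded \<beta> ?s" using k(7) unfolding e mem_bounded_def by auto
    then have "I ?s" unfolding I_def
        using k1 k(2,4,5) sum by (intro exI[of _ "k - 1"]) (simp add: e)
    moreover have "nat (?s 10 0) < nat (s 10 0)" unfolding e using k k1 st by simp
    ultimately show "runs sum_body s (time_factor sum_body * \<beta>)
        (\<lambda>s'. I s' \<and> nat (s' 10 0) < nat (s 10 0))"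
      by (intro runs_loop_free[OF lf \<beta> k(7)]) simp
  next
    show "acost ?g s \<le> aexp_factor ?g * \<beta>" if "I s" for s
      using aexp_factor(2)[OF \<beta> bnd[OF that]] .
  next
    show "I s" unfolding I_def using s le by (intro exI[of _ "int n"]) (auto simp: st_def)
  qed
  then show ?thesis
  proof (rule runs_mono)
    show "(nat (s 10 0) + 1) * (aexp_factor ?g * \<beta> + time_factor sum_body * \<beta>) \<le>
        (n + 1) * (aexp_factor ?g * \<beta> + time_factor sum_body * \<beta>)"
      using s(4) by simp
    fix s' assume s': "I s' \<and> \<not> aval ?g s' > 0"
    then obtain k where k: "st - 1 \<le> k" "s' 10 0 = k" "s' 0 = In" "s' 1 = X"
      "s' 9 0 = (\<Sum>i\<in>{k + 1..int n}. X i)" "mem_bounded \<beta> s'"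
      unfolding I_def by auto
    have "k = st - 1" using s' k In aval_last_cost_expr[of s' l M] by (simp add: st_def)
    then show "s' 0 = In \<and> s' 1 = X \<and> s' 9 0 = (\<Sum>i\<in>{addr l M 0..int n}. X i) \<and> mem_bounded \<beta> s'"
      using k by (simp add: st_def)
  qed
qed

text \<open>The running time written out without reference to the locale, visibly polynomial in
  \<open>l\<close> and \<open>\<beta>\<close> for fixed program text.\<close>

definition augment_bound :: "nat \<Rightarrow> nat \<Rightarrow> (nat \<Rightarrow> int) list list \<Rightarrow> nat \<Rightarrow> nat \<Rightarrow> nat \<Rightarrow> nat" where
  "augment_bound M J vss g l \<beta> =
     ((4 * (l ^ g * length vss + 1) + 2) * (\<beta> + 1) + 4 * (l ^ g * length vss + 1) + 1) *
     (aexp_factor (reg 4) * \<beta> + (time_factor start_pass * \<beta> +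
       ((\<beta> + 2) * (aexp_factor (reg 5) * \<beta> + (time_factor (set_reg 6 (pow_expr g)) * \<beta> +
          ((l ^ g + 1) * (aexp_factor (reg 6) * \<beta> + time_factor (layers_body M J vss) * \<beta>) +
           time_factor (set_reg 5 (Div (reg 5) (Const 2))) * \<beta>))) +
        time_factor finish_pass * \<beta>)))"

definition finish_bound :: "nat \<Rightarrow> nat \<Rightarrow> (nat \<Rightarrow> int) list list \<Rightarrow> nat \<Rightarrow> nat \<Rightarrow> nat \<Rightarrow> nat \<Rightarrow> nat" where
  "finish_bound M J vss g n l \<beta> = time_factor set_weights * \<beta> + (augment_bound M J vss g l \<beta> +
     (time_factor start_sum * \<beta> +
      ((n + 1) * (aexp_factor (Sub (reg 10) (last_cost_expr M)) * \<beta> + time_factor sum_body * \<beta>) +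
       time_factor (final_answer M) * \<beta>)))"

definition solver_bound :: "nat \<Rightarrow> nat \<Rightarrow> (nat \<Rightarrow> int) list list \<Rightarrow> nat \<Rightarrow> nat \<Rightarrow> nat \<Rightarrow> nat \<Rightarrow> nat" where
  "solver_bound M J vss g n l \<beta> = time_factor read_length * \<beta> +
     ((n + 1) * (aexp_factor (reg 10) * \<beta> + time_factor (scan_body M) * \<beta>) +
      (aexp_factor (reg 9) * \<beta> + (time_factor answer_infeasible * \<beta> +
          finish_bound M J vss g n l \<beta>)))"

context augmentation
begin

lemma augment_time_eq: "augment_time = augment_bound M J vss g l \<beta>"
proof -
  have "nat K = l ^ g * length vss + 1" unfolding K_def by linarith
  then show ?thesis
    unfolding augment_time_def augment_bound_def pass_time_def step_time_def layers_time_def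
        by (simp only:)
qed

definition correct_output :: "int list \<Rightarrow> bool" where
  "correct_output ys \<longleftrightarrow> (ys = [0] \<and> (\<forall>y. \<not> solves y)) \<or>
     (\<exists>x. ys = 2 # map (\<lambda>p. int (x p)) [0..<M * l] \<and> solves x \<and> (\<forall>y. solves y \<longrightarrow> obj x \<le> obj y))"

lemma runs_finish:
  assumes In_0: "In 0 = int n" "N = int n + 1" and sum: "(\<Sum>a\<in>{2..<N}. \<bar>In a\<bar>) \<le> T"
    and W2: "W = 2 * T * T + 1" and \<beta>': "2 * T * T * W \<le> 2 ^ \<beta>"
    and s: "s 0 = In" "s 1 = base" "s 2 0 = T" "s 8 0 = 0" "mem_bounded \<beta> s"
  shows "runs (optimize M J vss g) s (finish_bound M J vss g n l \<beta>)
      (\<lambda>s'. correct_output (read_output s'))"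
  unfolding optimize_def finish_bound_def
proof (rule runs_Seq)
  let ?s = "s(3 := (s 3)(0 := W), 4 := (s 4)(0 := 2 * T * T * W))"
  have lf: "loop_free set_weights" by (simp add: set_weights_def)
  have e: "effect set_weights s = ?s" using s W2 by (simp add: set_weights_def algebra_simps)
  have "0 \<le> W" "0 \<le> 2 * T * T * W" using T W by auto
  then have "mem_bounded \<beta> ?s" using s(5) \<beta>(3) \<beta>' unfolding mem_bounded_def by auto
  then have "state_ok ?s \<and> ?s 4 0 = 2 * T * T * W" using s feas_base unfolding state_ok_def by auto
  then show "runs set_weights s (time_factor set_weights * \<beta>) (\<lambda>s. state_ok s \<and>
      s 4 0 = 2 * T * T * W)"
    by (intro runs_loop_free[OF lf \<beta>(1) s(5)]) (simp only: e)
next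
  fix s1 assume s1: "state_ok s1 \<and> s1 4 0 = 2 * T * T * W"
  show "runs (Seq (augment M J vss g) (Seq start_sum
      (Seq (While (Sub (reg 10) (last_cost_expr M)) sum_body) (final_answer M)))) s1
      (augment_bound M J vss g l \<beta> + (time_factor start_sum * \<beta> +
      ((n + 1) * (aexp_factor (Sub (reg 10) (last_cost_expr M)) * \<beta> + time_factor sum_body * \<beta>) +
       time_factor (final_answer M) * \<beta>))) (\<lambda>s'. correct_output (read_output s'))"
  proof (rule runs_Seq)
    show "runs (augment M J vss g) s1 (augment_bound M J vss g l \<beta>)
        (\<lambda>s'. state_ok s' \<and> (\<forall>Y. feas Y \<longrightarrow> cost (s' 1) \<le> cost Y))"
      using runs_augment[OF _ _ \<beta>'] s1 unfolding augment_time_eq by blast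
  next
    fix s2 assume s2: "state_ok s2 \<and> (\<forall>Y. feas Y \<longrightarrow> cost (s2 1) \<le> cost Y)"
    define X where "X = s2 1"
    have X: "feas X" "\<And>Y. feas Y \<Longrightarrow> cost X \<le> cost Y" using s2 by (auto simp: X_def state_ok_def)
    have bnd: "mem_bounded \<beta> s2" using s2 by (simp add: state_ok_def)
    have range: "{st..int n} = {st..<N}" using In_0(2) by auto
    show "runs (Seq start_sum (Seq (While (Sub (reg 10) (last_cost_expr M)) sum_body)
        (final_answer M))) s2
        (time_factor start_sum * \<beta> +
        ((n + 1) * (aexp_factor (Sub (reg 10) (last_cost_expr M)) * \<beta> + time_factor sum_body * \<beta>) +
         time_factor (final_answer M) * \<beta>)) (\<lambda>s'. correct_output (read_output s'))"
    proof (rule runs_Seq)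
      let ?s = "s2(9 := (s2 9)(0 := 0), 10 := (s2 10)(0 := int n))"
      have "\<bar>s2 0 0\<bar> \<le> 2 ^ \<beta>" using bnd by (simp add: mem_bounded_def)
      then have "\<bar>int n\<bar> \<le> 2 ^ \<beta>" using s2 In_0 by (simp add: state_ok_def)
      then have "mem_bounded \<beta> ?s" using bnd unfolding mem_bounded_def by auto
      moreover have "effect start_sum s2 = ?s"
          using s2 In_0 by (simp add: start_sum_def state_ok_def)
      ultimately show "runs start_sum s2 (time_factor start_sum * \<beta>) (\<lambda>s. s 0 = In \<and> s 1 = X \<and>
          s 9 0 = 0 \<and> s 10 0 = int n \<and> mem_bounded \<beta> s)"
        using s2 by (intro runs_loop_free[OF _ \<beta>(1) bnd])
            (auto simp: start_sum_def state_ok_def X_def)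
    next
      fix s3 assume s3: "s3 0 = In \<and> s3 1 = X \<and> s3 9 0 = 0 \<and> s3 10 0 = int n \<and> mem_bounded \<beta> s3"
      \<comment> \<open>Register 9 collects at most \<open>T\<close> entries of size at most
        \<open>T\<close>, so the sum stays below \<open>W\<close>.\<close>
      have slack_le: "slack_part X \<le> 2 ^ \<beta>"
      proof -
        have "slack_part X \<le> (\<Sum>a\<in>{st..<N}. T)"
          unfolding slack_part_def using feas_le[OF X(1)] by (intro sum_mono) auto
        also have "\<dots> = int (nat (N - st)) * T" by simp
        also have "\<dots> \<le> T * T" using N_le st_bounds T unfolding N_def by (intro mult_right_mono) auto
        also have "\<dots> \<le> W" using W2 by simp
        finally show ?thesis using \<beta>(3) by linarith
      qed
      show "runs (Seq (While (Sub (reg 10) (last_cost_expr M)) sum_body) (final_answer M)) s3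
          ((n + 1) * (aexp_factor (Sub (reg 10) (last_cost_expr M)) * \<beta> +
              time_factor sum_body * \<beta>) +
           time_factor (final_answer M) * \<beta>) (\<lambda>s'. correct_output (read_output s'))"
      proof (rule runs_Seq)
        show "runs (While (Sub (reg 10) (last_cost_expr M)) sum_body) s3
            ((n + 1) * (aexp_factor (Sub (reg 10) (last_cost_expr M)) * \<beta> +
                time_factor sum_body * \<beta>))
            (\<lambda>s'. s' 0 = In \<and> s' 1 = X \<and> s' 9 0 = (\<Sum>i\<in>{st..int n}. X i) \<and> mem_bounded \<beta> s')"
        proof (rule runs_sum[OF In_0(1) In_1 _ \<beta>(1)])
          show "st \<le> int n + 1" using st_bounds In_0(2) by simp
          show "0 \<le> X a" for a using X(1) by (simp add: feas_def)
          show "(\<Sum>i\<in>{st..int n}. X i) \<le> 2 ^ \<beta>" using slack_le unfolding range slack_part_def .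
        qed (use s3 in auto)
      next
        fix s4 assume "s4 0 = In \<and> s4 1 = X \<and> s4 9 0 = (\<Sum>i\<in>{st..int n}. X i) \<and> mem_bounded \<beta> s4"
        then have s4: "s4 0 = In" "s4 1 = X" "s4 9 0 = slack_part X" "mem_bounded \<beta> s4"
          by (auto simp: range slack_part_def)
        have lf: "loop_free (final_answer M)"
          by (simp add: final_answer_def answer_infeasible_def answer_optimal_def)
        have "correct_output (read_output (effect (final_answer M) s4))"
        proof (cases "slack_part X > 0")
          case True
          have "read_output (effect (final_answer M) s4) = [0]"
            using True s4 by (simp add: final_answer_def answer_infeasible_def read_output_def)
          then show ?thesis unfolding correct_output_def
            using minimizer_solves(1)[OF X sum W2 True] by blast
        next
          case False
          then have zero: "slack_part X = 0" using slack_part_nonneg[OF X(1)] by simp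
          define x where "x p = nat (X (2 + int p))" for p
          have x: "int (x p) = X (2 + int p)" for p using X(1) by (simp add: x_def feas_def)
          have 1: "effect (final_answer M) s4 1 = X(0 := 1 + int (M * l), 1 := 2)"
            using zero s4 In_1 by (simp add: final_answer_def answer_optimal_def
                last_cost_expr_def len_expr_def)
          have "read_output (effect (final_answer M) s4) =
              map (\<lambda>j. effect (final_answer M) s4 1 (int j + 1)) [0..<Suc (M * l)]"
            unfolding read_output_def 1 by (simp add: nat_add_distrib del: of_nat_mult upt_Suc)
          also have "\<dots> = 2 # map (\<lambda>p. int (x p)) [0..<M * l]"
            unfolding 1 by (simp add: upt_conv_Cons map_Suc_upt[symmetric] x comp_def add.commute
                del: upt_Suc map_Suc_upt)
          finally have "read_output (effect (final_answer M) s4) = 2 # map (\<lambda>p. int (x p))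
              [0..<M * l]" .
          moreover have "solves x" unfolding x_def by (rule feas_imp_solves(1)[OF X(1) zero])
          moreover have "obj x \<le> obj y" if "solves y" for y
            unfolding x_def by (rule minimizer_solves(2)[OF X(1) _ sum W2 zero that]) (rule X(2))
          ultimately show ?thesis unfolding correct_output_def by blast
        qed
        then show "runs (final_answer M) s4 (time_factor (final_answer M) * \<beta>)
            (\<lambda>s'. correct_output (read_output s'))"
          by (rule runs_loop_free[OF lf \<beta>(1) s4(4)])
      qed
    qed
  qed
qed

end

section \<open>Polynomial bounds in the input size\<close>

definition poly_fun :: "(nat \<Rightarrow> nat) \<Rightarrow> bool" where
  "poly_fun f \<longleftrightarrow> (\<exists>p. \<forall>n. poly p n = f n)"

lemma poly_fun_intros:
  "poly_fun (\<lambda>n. c)" "poly_fun (\<lambda>n. n)"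
  "poly_fun f \<Longrightarrow> poly_fun h \<Longrightarrow> poly_fun (\<lambda>n. f n + h n)"
  "poly_fun f \<Longrightarrow> poly_fun h \<Longrightarrow> poly_fun (\<lambda>n. f n * h n)"
  "poly_fun f \<Longrightarrow> poly_fun (\<lambda>n. f n ^ e)"
proof -
  show "poly_fun (\<lambda>n. c)" unfolding poly_fun_def by (intro exI[of _ "[:c:]"]) simp
  show "poly_fun (\<lambda>n. n)" unfolding poly_fun_def by (intro exI[of _ "[:0, 1:]"]) simp
  show "poly_fun (\<lambda>n. f n + h n)" if "poly_fun f" "poly_fun h"
    using that unfolding poly_fun_def by (metis poly_add)
  show "poly_fun (\<lambda>n. f n * h n)" if "poly_fun f" "poly_fun h"
    using that unfolding poly_fun_def by (metis poly_mult)
  show "poly_fun (\<lambda>n. f n ^ e)" if "poly_fun f"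
    using that unfolding poly_fun_def by (metis poly_power)
qed

lemma solver_bound_poly:
  assumes "poly_fun n" "poly_fun l" "poly_fun \<beta>"
  shows "poly_fun (\<lambda>S. solver_bound M J vss g (n S) (l S) (\<beta> S))"
  unfolding solver_bound_def finish_bound_def augment_bound_def
  by (intro poly_fun_intros assms)

lemma solver_bound_mono:
  assumes "n \<le> n'" "l \<le> l'"
  shows "solver_bound M J vss g n l \<beta> \<le> solver_bound M J vss g n' l' \<beta>"
proof -
  have "l ^ g \<le> l' ^ g" using assms(2) by (rule power_mono) simp
  then show ?thesis using assms(1) unfolding solver_bound_def finish_bound_def augment_bound_def
    by (intro add_mono mult_le_mono order_refl)
qed

lemma bits_ge:
  "1 \<le> bits x" "\<bar>x\<bar> + 1 \<le> 2 ^ (bits x - 1)"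
proof -
  show "1 \<le> bits x" by (simp add: bits_def)
  have "nat \<bar>x\<bar> < 2 ^ floorlog 2 (nat \<bar>x\<bar>)"
  proof (cases "x = 0")
    case False
    then show ?thesis using floorlog_bounds[of "nat \<bar>x\<bar>" 2] by simp
  qed (simp add: floorlog_def)
  then have "int (nat \<bar>x\<bar>) < int (2 ^ floorlog 2 (nat \<bar>x\<bar>))" by (simp only: of_nat_less_iff)
  then show "\<bar>x\<bar> + 1 \<le> 2 ^ (bits x - 1)" by (simp add: bits_def bitlen_def)
qed

text \<open>Every entry contributes a factor, which suffices for a sum because
  \<open>a + b \<le> 2 * a * b\<close> for positive integers. It is the source of the bound on
  \<open>T\<close> in terms of the input size.\<close>

lemma sum_abs_le_pow_bits:
  "1 + int (length xs) + (\<Sum>x\<leftarrow>xs. \<bar>x\<bar>) \<le> 2 ^ sum_list (map bits xs)"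
proof (induction xs)
  case (Cons x xs)
  define a b :: int where "a = 2 ^ (bits x - 1)" and "b = 2 ^ sum_list (map bits xs)"
  have "1 \<le> a" "1 \<le> b" by (simp_all add: a_def b_def)
  \<comment> \<open>Expanding the right-hand side gives \<open>2 * a * b - a - b\<close>.\<close>
  then have "0 \<le> (a - 1) * (b - 1) + (a * b - 1)" by (simp add: mult_ge1_I)
  then have "a + b \<le> 2 * a * b" by (simp add: algebra_simps)
  also have "2 * a = 2 ^ bits x" unfolding a_def using bits_ge(1)[of x] by (simp flip: power_Suc)
  also have "\<dots> * b = 2 ^ sum_list (map bits (x # xs))" by (simp add: b_def power_add)
  finally show ?case using Cons bits_ge(2)[of x] by (simp add: a_def b_def)
qed simp

lemma length_le_sum_bits: "length xs \<le> sum_list (map bits xs)"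
  by (induction xs) (use bits_ge(1) in \<open>auto intro: add_le_mono[of 1 _ _ _, simplified]\<close>)

text \<open>List positions are one below array addresses, as position 0 is stored in cell 1.\<close>

definition nfold_solves ::
    "nat \<Rightarrow> nat \<Rightarrow> (nat \<Rightarrow> nat \<Rightarrow> int) \<Rightarrow> nat \<Rightarrow> int list \<Rightarrow> (nat \<Rightarrow> nat) \<Rightarrow> bool" where
  "nfold_solves M J A l xs x \<longleftrightarrow>
     (\<forall>j<J. \<forall>k<l. (\<Sum>i<M. A j i * int (x (i * l + k))) = xs ! (1 + (M + j) * l + k)) \<and>
     (\<forall>i<M. (\<Sum>k<l. int (x (i * l + k))) = xs ! (1 + (M + J) * l + i))"

definition nfold_obj :: "nat \<Rightarrow> nat \<Rightarrow> int list \<Rightarrow> (nat \<Rightarrow> nat) \<Rightarrow> int" where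
  "nfold_obj M l xs x = (\<Sum>p<M * l. xs ! (1 + p) * int (x p))"

definition nfold_correct :: "nat \<Rightarrow> nat \<Rightarrow> (nat \<Rightarrow> nat \<Rightarrow> int) \<Rightarrow> nat \<Rightarrow> int list \<Rightarrow> int list \<Rightarrow> bool" where
  "nfold_correct M J A l xs ys \<longleftrightarrow> ys = [0] \<and> (\<forall>y. \<not> nfold_solves M J A l xs y) \<or>
     (\<exists>x. ys = 2 # map (\<lambda>p. int (x p)) [0..<M * l] \<and> nfold_solves M J A l xs x \<and>
        (\<forall>y. nfold_solves M J A l xs y \<longrightarrow> nfold_obj M l xs x \<le> nfold_obj M l xs y))"

lemma load_input_nth: "p < length xs \<Longrightarrow> load_input xs 0 (1 + int p) = xs ! p"
  by (simp add: load_input_def nat_add_distrib)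

lemma sum_load_input: "(\<Sum>i\<in>{1..int (length xs)}. f (load_input xs 0 i)) = (\<Sum>x\<leftarrow>xs. f x)"
    for f :: "int \<Rightarrow> int"
proof -
  have "(\<Sum>i\<in>{1..int (length xs)}. f (load_input xs 0 i)) = (\<Sum>p\<in>{0..<length xs}. f (xs ! p))"
    by (rule sum.reindex_bij_witness[of _ "\<lambda>p. 1 + int p" "\<lambda>i. nat (i - 1)"])
      (auto simp: load_input_def nat_diff_distrib)
  then show ?thesis by (simp add: sum_list_sum_nth)
qed

lemma load_input_cell:
  assumes "1 + (r * l + k) < length xs"
  shows "load_input xs 0 (addr l r k) = xs ! (1 + r * l + k)"
  using load_input_nth[OF assms] by (simp add: addr_def add.assoc)

lemma cell_index_less:
  assumes "r < R" "k < (l :: nat)"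
  shows "r * l + k < R * l"
proof -
  have "r * l + k < Suc r * l" using assms(2) by simp
  also have "\<dots> \<le> R * l" using assms(1) by (intro mult_le_mono1) simp
  finally show ?thesis .
qed

lemma abs_load_input_le: "\<bar>load_input xs a i\<bar> \<le> int (length xs) + (\<Sum>x\<leftarrow>xs. \<bar>x\<bar>)"
proof -
  have sum: "0 \<le> (\<Sum>x\<leftarrow>xs. \<bar>x\<bar>)" by (induction xs) auto
  show ?thesis
  proof (cases "a = 0 \<and> 1 \<le> i \<and> i \<le> int (length xs)")
    case True
    then have "\<bar>load_input xs 0 i\<bar> \<le> (\<Sum>i\<in>{1..int (length xs)}. \<bar>load_input xs 0 i\<bar>)"
      by (intro member_le_sum) auto
    then show ?thesis using True unfolding sum_load_input by simp
  next
    case False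
    then show ?thesis using sum by (auto simp: load_input_def)
  qed
qed

theorem nfold_solver:
  fixes M J :: nat and A :: "nat \<Rightarrow> nat \<Rightarrow> int"
  assumes A: "\<And>j i. 0 \<le> A j i"
  shows "\<exists>P p. \<forall>l xs. 1 \<le> l \<longrightarrow> length xs = 1 + (M + J) * l + M \<longrightarrow> xs ! 0 = int l \<longrightarrow>
    (\<exists>t ys. computes_in_time P xs t ys \<and> t \<le> poly p (l + sum_list (map bits (tl xs))) \<and>
      nfold_correct M J A l xs ys)"
proof -
  obtain vss where vss: "\<And>vs v. vs \<in> set vss \<Longrightarrow> v \<in> set vs \<Longrightarrow> in_layer_kernel M J A v"
    and dec: "\<And>l z. 1 \<le> l \<Longrightarrow> in_kernel M J A l z \<Longrightarrow> \<exists>Ls. decomposed M J vss l Ls z"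
    using decompose_kernel[of M J A] by metis
  define g where "g = sum_list (map length vss)"
  have short: "length vs \<le> g" if "vs \<in> set vss" for vs
    unfolding g_def using that by (intro member_le_sum_list) auto
  \<comment> \<open>With \<open>R = 2 ^ (S + 2)\<close> bounding \<open>T\<close>, the factor
    \<open>R ^ g\<close> covers \<open>l ^ g\<close>, and \<open>8 * R ^ 4\<close> covers
    \<open>2 * T * T * W\<close>, where \<open>W\<close> is at most \<open>3 * R ^ 2\<close>. Their
    product has this exponent.\<close>
  define B where "B S = (g + 4) * (S + 2) + 3" for S :: nat
  have "poly_fun (\<lambda>S. solver_bound M J vss g (S + 1) S (B S))"
    unfolding B_def by (intro solver_bound_poly poly_fun_intros)
  then obtain p where p: "\<And>S. poly p S = solver_bound M J vss g (S + 1) S (B S)"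
    unfolding poly_fun_def by blast
  show ?thesis
  proof (intro exI[of _ "solver M J vss g"] exI[of _ p] allI impI)
    fix l xs assume l: "1 \<le> l" and len: "length xs = 1 + (M + J) * l + M" and xs0: "xs ! 0 = int l"
    define In where "In = load_input xs 0"
    define n where "n = length xs"
    define S where "S = l + sum_list (map bits (tl xs))"
    define \<beta> where "\<beta> = B S"
    define T where "T = int n + (\<Sum>x\<leftarrow>xs. \<bar>x\<bar>)"
    define W where "W = 2 * T * T + 1"
    have n: "1 \<le> n" using len by (simp add: n_def)
    have xs: "xs = int l # tl xs" using n xs0 by (cases xs) (auto simp: n_def)
    have "n \<le> S + 1"
      using length_le_sum_bits[of "tl xs"] by (simp add: n_def S_def)
    have In_0: "In 0 = int n" by (simp add: In_def n_def load_input_def)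
    have In_1: "In 1 = int l" using xs0 n by (simp add: In_def n_def load_input_def)
    have sum_In: "(\<Sum>i\<in>{1..int n}. \<bar>In i\<bar>) = (\<Sum>x\<leftarrow>xs. \<bar>x\<bar>)"
      unfolding In_def n_def by (rule sum_load_input)
    have sum_nonneg': "0 \<le> (\<Sum>x\<leftarrow>xs. \<bar>x\<bar>)" by (induction xs) auto
    have T: "1 \<le> T" using n sum_nonneg' by (simp add: T_def)
    have In_bound: "\<bar>load_input xs a i\<bar> \<le> T" for a i
      unfolding T_def n_def by (rule abs_load_input_le)
    \<comment> \<open>The size counts the value of \<open>l\<close>, whereas the list contains
      \<open>l\<close> as an entry; this explains the \<open>2\<close> in
      \<open>S + 2\<close>.\<close>
    have "bits (int l) \<le> l + 2"
      using less_exp[of l] by (intro bits_le)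
          (metis abs_of_nat less_imp_le of_nat_le_iff of_nat_numeral of_nat_power)
    then have "sum_list (map bits xs) \<le> S + 2" by (subst xs) (simp add: S_def)
    then have "(2 :: int) ^ sum_list (map bits xs) \<le> 2 ^ (S + 2)" by (intro power_increasing) auto
    then have T_le: "T \<le> 2 ^ (S + 2)"
      using sum_abs_le_pow_bits[of xs] by (simp add: T_def n_def)
    define R :: int where "R = 2 ^ (S + 2)"
    have R: "1 \<le> R" "T \<le> R" using T_le T unfolding R_def by linarith+
    have \<beta>_eq: "(2 :: int) ^ \<beta> = R ^ g * (R ^ 4 * 8)"
    proof -
      have "\<beta> = (S + 2) * g + ((S + 2) * 4 + 3)" by (simp add: \<beta>_def B_def algebra_simps)
      then have "(2 :: int) ^ \<beta> = R ^ g * (R ^ 4 * 2 ^ 3)"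
        unfolding R_def by (simp only: power_add power_mult)
      then show ?thesis by simp
    qed
    have R4: "R ^ 4 * 8 \<le> 2 ^ \<beta>" unfolding \<beta>_eq
        using R by (simp add: mult_le_cancel_right1 one_le_power)
    have TT: "1 \<le> T * T" "T * T \<le> R ^ 2" "T \<le> T * T"
      using T R mult_mono[of 1 T 1 T] mult_mono[of T R T R] mult_mono[of 1 T T T]
      by (simp_all add: power2_eq_square)
    have "W = 2 * (T * T) + 1" by (simp add: W_def)
    then have W: "T \<le> W" "1 \<le> W" "W \<le> 3 * R ^ 2" using TT T R by linarith+
    have TTW: "2 * T * T * W \<le> 2 ^ \<beta>"
    proof -
      have "T * T * W \<le> R ^ 2 * (3 * R ^ 2)" using TT W R by (intro mult_mono) auto
      also have "\<dots> = 3 * R ^ 4" by (simp add: power4_eq_xxxx power2_eq_square)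
      finally have "2 * T * T * W \<le> 6 * R ^ 4" by simp
      also have "\<dots> \<le> R ^ 4 * 8" using R by simp
      finally show ?thesis using R4 by simp
    qed
    have "1 * W \<le> T * T * W" using TT W by (intro mult_right_mono) auto
    moreover have "2 * T * T * W = 2 * (T * T * W)" by simp
    ultimately have W_le: "W \<le> T * T * W" "T * T * W \<le> 2 * T * T * W" using W by linarith+
    have lg: "int (l ^ g) \<le> 2 ^ \<beta>"
    proof -
      have "int l \<le> R" using In_bound[of 0 1] In_1 R by (simp add: In_def)
      then have "int l ^ g \<le> R ^ g" by (intro power_mono) auto
      moreover have "1 \<le> R ^ 4 * 8" using one_le_power[OF R(1), of 4] by linarith
      then have "R ^ g * 1 \<le> R ^ g * (R ^ 4 * 8)" using R by (intro mult_left_mono) auto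
      ultimately show ?thesis unfolding \<beta>_eq by simp
    qed
    have \<beta>1: "1 \<le> \<beta>" unfolding \<beta>_def B_def by simp
    have T\<beta>: "T \<le> 2 ^ \<beta>" and W\<beta>: "W \<le> 2 ^ \<beta>" "T * T * W \<le> 2 ^ \<beta>" using W W_le TTW by linarith+
    have N_eq: "addr l (M + J) M = int n + 1" using len by (simp add: n_def addr_def)
    have In_cell: "In (addr l r k) = xs ! (1 + r * l + k)" if "r < M + J" "k < l" for r k
      unfolding In_def using cell_index_less[OF that] len by (intro load_input_cell) simp
    have In_link: "In (addr l (M + J) i) = xs ! (1 + (M + J) * l + i)" if "i < M" for i
      unfolding In_def using that len by (intro load_input_cell) simp
    have s0: "mem_bounded \<beta> (load_input xs)"
      unfolding mem_bounded_def using In_bound T\<beta> by (meson order_trans)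
    have "runs (solver M J vss g) (load_input xs) (solver_bound M J vss g n l \<beta>)
        (\<lambda>s'. nfold_correct M J A l xs (read_output s'))"
      unfolding solver_def solver_bound_def
    proof (rule runs_Seq)
      let ?s = "(load_input xs)(2 := (load_input xs 2)(0 := int n),
          10 := (load_input xs 10)(0 := int n))"
      have "\<bar>int n\<bar> \<le> 2 ^ \<beta>" using In_bound[of 0 0] T\<beta> In_0 unfolding In_def by linarith
      then have "mem_bounded \<beta> ?s" using s0 unfolding mem_bounded_def by auto
      moreover have "effect read_length (load_input xs) = ?s"
        using In_0 by (simp add: read_length_def In_def)
      ultimately show "runs read_length (load_input xs) (time_factor read_length * \<beta>)
          (\<lambda>s. s 0 = In \<and> s 1 = (\<lambda>_. 0) \<and> s 2 0 = int n \<and> s 10 0 = int n \<and> s 9 0 = 0 \<and> s 8 0 = 0 \<and>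
              mem_bounded \<beta> s)"
        by (intro runs_loop_free[OF _ \<beta>1 s0]) (auto simp: read_length_def In_def load_input_def)
    next
      fix s1 assume s1: "s1 0 = In \<and> s1 1 = (\<lambda>_. 0) \<and> s1 2 0 = int n \<and> s1 10 0 = int n \<and>
          s1 9 0 = 0 \<and>
        s1 8 0 = 0 \<and> mem_bounded \<beta> s1"
      show "runs (Seq (While (reg 10) (scan_body M)) (Cond (reg 9) answer_infeasible
         (optimize M J vss g))) s1
        ((n + 1) * (aexp_factor (reg 10) * \<beta> + time_factor (scan_body M) * \<beta>) +
        (aexp_factor (reg 9) * \<beta> + (time_factor answer_infeasible * \<beta> +
            finish_bound M J vss g n l \<beta>)))
        (\<lambda>s'. nfold_correct M J A l xs (read_output s'))"
      proof (rule runs_Seq)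
        show "runs (While (reg 10) (scan_body M)) s1
          ((n + 1) * (aexp_factor (reg 10) * \<beta> + time_factor (scan_body M) * \<beta>))
          (\<lambda>s'. s' 0 = In \<and> s' 2 0 = T \<and> s' 8 0 = 0 \<and> mem_bounded \<beta> s' \<and>
           s' 1 = (\<lambda>a. if addr l M 0 \<le> a \<and> a \<le> int n then In a else 0) \<and>
           (s' 9 0 > 0 \<longleftrightarrow> (\<exists>a. addr l M 0 \<le> a \<and> a \<le> int n \<and> In a < 0)))"
          using s1 T\<beta> by (intro runs_scan[OF In_0 In_1 _ _ \<beta>1]) (auto simp: T_def sum_In)
      next
        fix s2 assume "s2 0 = In \<and> s2 2 0 = T \<and> s2 8 0 = 0 \<and> mem_bounded \<beta> s2 \<and>
           s2 1 = (\<lambda>a. if addr l M 0 \<le> a \<and> a \<le> int n then In a else 0) \<and>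
           (s2 9 0 > 0 \<longleftrightarrow> (\<exists>a. addr l M 0 \<le> a \<and> a \<le> int n \<and> In a < 0))"
        then have s2: "s2 0 = In" "s2 2 0 = T" "s2 8 0 = 0" "mem_bounded \<beta> s2"
          "s2 1 = (\<lambda>a. if addr l M 0 \<le> a \<and> a \<le> int n then In a else 0)"
          "s2 9 0 > 0 \<longleftrightarrow> (\<exists>a. addr l M 0 \<le> a \<and> a \<le> int n \<and> In a < 0)" by blast+
        show "runs (Cond (reg 9) answer_infeasible
           (optimize M J vss g)) s2
          (aexp_factor (reg 9) * \<beta> + (time_factor answer_infeasible * \<beta> +
              finish_bound M J vss g n l \<beta>))
          (\<lambda>s'. nfold_correct M J A l xs (read_output s'))"
        proof (rule runs_Cond)
          show "acost (reg 9) s2 \<le> aexp_factor (reg 9) * \<beta>" by (rule aexp_factor(2)[OF \<beta>1 s2(4)])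
        next
          assume "aval (reg 9) s2 > 0"
          then obtain a where a: "addr l M 0 \<le> a" "a \<le> int n" "In a < 0" using s2(6) by auto
          have "2 \<le> addr l M 0" by (simp add: addr_def)
          then have "2 \<le> a" "a < addr l (M + J) M" using a N_eq by linarith+
          \<comment> \<open>The address identifies either a layer constraint or a linking
            constraint, whose left-hand side is a sum of nonnegative terms.\<close>
          have "\<not> nfold_solves M J A l xs y" for y
            using l \<open>2 \<le> a\<close> \<open>a < addr l (M + J) M\<close>
          proof (cases rule: address_cases)
            case (cell r k)
            have "\<not> r < M" using addr_less[OF cell(2), of r M] a(1) cell(3) by auto
            then obtain j where j: "r = M + j" "j < J"
                using cell(1) by (metis add_less_cancel_left le_Suc_ex not_less)
            have "0 \<le> (\<Sum>i<M. A j i * int (y (i * l + k)))" using A by (intro sum_nonneg) auto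
            then show ?thesis using a(3) j cell(2) In_cell[OF cell(1,2)]
              unfolding nfold_solves_def cell(3) by force
          next
            case (link i)
            have "0 \<le> (\<Sum>k<l. int (y (i * l + k)))" by (intro sum_nonneg) auto
            then show ?thesis using a(3) link(1) In_link[OF link(1)]
              unfolding nfold_solves_def link(2) by force
          qed
          moreover have "read_output (effect answer_infeasible s2) = [0]"
            by (simp add: answer_infeasible_def read_output_def)
          ultimately have "nfold_correct M J A l xs (read_output (effect answer_infeasible s2))"
              unfolding nfold_correct_def by blast
          then have "runs answer_infeasible s2 (time_factor answer_infeasible * \<beta>)
              (\<lambda>s'. nfold_correct M J A l xs (read_output s'))"
            by (intro runs_loop_free[OF _ \<beta>1 s2(4)]) (simp_all add: answer_infeasible_def)
          then show "runs answer_infeasible s2 (time_factor answer_infeasible * \<beta> +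
              finish_bound M J vss g n l \<beta>)
              (\<lambda>s'. nfold_correct M J A l xs (read_output s'))" by (rule runs_mono) auto
        next
          assume "\<not> aval (reg 9) s2 > 0"
          then have nonneg: "0 \<le> In a" if "addr l M 0 \<le> a" "a \<le> int n" for a
            using s2(6) that by force
          interpret augmentation M J A vss g l In T W \<beta>
          proof
            show "\<bar>In a\<bar> \<le> T" for a unfolding In_def by (rule In_bound)
            show "0 \<le> In a" if "addr l M 0 \<le> a" "a < addr l (M + J) M" for a
              using nonneg that N_eq by simp
            show "addr l (M + J) M \<le> T + 2" using N_eq sum_nonneg' by (simp add: T_def)
          qed (fact l In_1 A vss short dec[OF l] T W(1) \<beta>1 T\<beta> W\<beta> lg)+
          have N_n: "N = int n + 1" unfolding N_def by (rule N_eq)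
          have "(\<Sum>a\<in>{2..<N}. \<bar>In a\<bar>) \<le> (\<Sum>a\<in>{1..int n}. \<bar>In a\<bar>)"
            unfolding N_n by (intro sum_mono2) auto
          then have sum: "(\<Sum>a\<in>{2..<N}. \<bar>In a\<bar>) \<le> T" unfolding sum_In T_def by simp
          have "s2 1 = base" unfolding s2(5) base_def N_n by (auto simp: fun_eq_iff)
          from runs_finish[OF In_0 N_n sum W_def TTW s2(1) this s2(2,3,4)]
          have "runs (optimize M J vss g) s2
             (finish_bound M J vss g n l \<beta>) (\<lambda>s'. correct_output (read_output s'))" .
          moreover have "solves x \<longleftrightarrow> nfold_solves M J A l xs x" for x
            unfolding solves_def nfold_solves_def by (simp add: In_cell In_link)
          moreover have "obj x = nfold_obj M l xs x" for x
            unfolding obj_def nfold_obj_def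
          proof (rule sum.cong[OF refl])
            fix p assume "p \<in> {..<M * l}"
            then have "1 + p < length xs" using len by (simp add: algebra_simps)
            from load_input_nth[OF this] show
                "In (2 + int p) * int (x p) = xs ! (1 + p) * int (x p)"
              by (simp add: In_def)
          qed
          ultimately show "runs (optimize M J vss g) s2
             (time_factor answer_infeasible * \<beta> +
                 finish_bound M J vss g n l \<beta>) (\<lambda>s'. nfold_correct M J A l xs (read_output s'))"
            by (elim runs_mono) (auto simp: correct_output_def nfold_correct_def)
        qed
      qed
    qed
    then obtain t s' where t: "exec (solver M J vss g) (load_input xs) t s'"
        "t \<le> solver_bound M J vss g n l \<beta>" "nfold_correct M J A l xs (read_output s')"
      unfolding runs_def by blast
    have "l \<le> S" by (simp add: S_def)
    from solver_bound_mono[OF \<open>n \<le> S + 1\<close> this]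
    have "t \<le> poly p S" using t(2) unfolding p \<beta>_def by (meson order_trans)
    then show "\<exists>t ys. computes_in_time (solver M J vss g) xs t ys \<and>
        t \<le> poly p (l + sum_list (map bits (tl xs))) \<and>
      nfold_correct M J A l xs ys"
      using t(1,3) unfolding computes_in_time_def S_def by blast
  qed
qed

section \<open>Multiway tables\<close>

lemma set_multi_indices: "is \<in> set (multi_indices ns) \<longleftrightarrow> list_all2 (<) is ns"
  by (simp add: multi_indices_def product_lists_set list.rel_map)

lemma distinct_multi_indices: "distinct (multi_indices ns)"
  unfolding multi_indices_def by (rule distinct_product_lists) auto

text \<open>The last index varies fastest, so every cell of a layer contributes one block of length
  \<open>l\<close>, as in the layout given by \<open>addr\<close>.\<close>

lemma multi_indices_snoc:
  "multi_indices (ns @ [l]) = concat (map (\<lambda>is. map (\<lambda>k. is @ [k]) [0..<l]) (multi_indices ns))"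
proof (induction ns)
  case Nil
  have "concat (map (\<lambda>x. [[x]]) xs) = map (\<lambda>k. [k]) xs" for xs :: "nat list" by (induction xs) auto
  then show ?case by (simp add: multi_indices_def)
next
  case (Cons n ns)
  have "concat (map (\<lambda>x. map ((#) x) (concat (map (\<lambda>is. map (\<lambda>k. is @ [k]) [0..<l]) L))) xs) =
      concat (map (\<lambda>is. map (\<lambda>k. is @ [k]) [0..<l]) (concat (map (\<lambda>x. map ((#) x) L) xs)))"
    for L :: "nat list list" and xs :: "nat list"
    by (induction xs) (simp_all add: map_concat comp_def)
  then show ?case using Cons by (simp add: multi_indices_def)
qed

lemma set_multi_indices_snoc:
  "is \<in> set (multi_indices (ns @ [l])) \<longleftrightarrow>
     (\<exists>js k. js \<in> set (multi_indices ns) \<and> k < l \<and> is = js @ [k])"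
  unfolding multi_indices_snoc by (simp add: image_iff) (auto simp: Bex_def)

lemma length_concat_blocks: "length (concat (map (\<lambda>x. map (f x) [0..<l]) L)) = length L * l"
  by (induction L) auto

lemma nth_concat_blocks:
  assumes "i < length L" "k < l"
  shows "concat (map (\<lambda>x. map (f x) [0..<l]) L) ! (i * l + k) = f (L ! i) k"
  using assms(1)
proof (induction L arbitrary: i)
  case (Cons x L)
  show ?case
  proof (cases i)
    case 0
    then show ?thesis using assms(2) by (simp add: nth_append)
  next
    case (Suc i')
    then show ?thesis using Cons by (simp add: nth_append)
  qed
qed simp

lemma length_multi_index: "is \<in> set (multi_indices ns) \<Longrightarrow> length is = length ns"
  by (simp add: set_multi_indices list_all2_lengthD)

lemma delete_at_snoc: "t < length ns \<Longrightarrow> delete_at t (ns @ [l]) = delete_at t ns @ [l]"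
  by (simp add: delete_at_def)

lemma delete_at_last: "delete_at (length ns) (ns @ [l]) = ns"
  by (simp add: delete_at_def)

lemma length_delete_at: "t < length ns \<Longrightarrow> length (delete_at t ns) = length ns - 1"
  by (simp add: delete_at_def)

lemma insert_at_snoc: "t \<le> length js \<Longrightarrow> insert_at t m (js @ [k]) = insert_at t m js @ [k]"
  by (simp add: insert_at_def)

lemma insert_at_length: "insert_at (length js) k js = js @ [k]"
  by (simp add: insert_at_def)

lemma delete_at_insert_at: "t \<le> length js \<Longrightarrow> delete_at t (insert_at t m js) = js"
  by (simp add: delete_at_def insert_at_def)

lemma insert_at_delete_at: "t < length is \<Longrightarrow> insert_at t (is ! t) (delete_at t is) = is"
  by (simp add: delete_at_def insert_at_def min_def id_take_nth_drop[symmetric])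

lemma nth_insert_at: "t \<le> length js \<Longrightarrow> insert_at t m js ! t = m"
  by (simp add: insert_at_def nth_append)

lemma insert_at_multi_index:
  assumes t: "t < length ns" and js: "js \<in> set (multi_indices (delete_at t ns))" and m: "m < ns ! t"
  shows "insert_at t m js \<in> set (multi_indices ns)"
proof -
  have "list_all2 (<) js (take t ns @ drop (Suc t) ns)"
    using js by (simp add: set_multi_indices delete_at_def)
  then obtain as bs where js_eq: "js = as @ bs" "length as = t" "list_all2 (<) as (take t ns)"
      "list_all2 (<) bs (drop (Suc t) ns)"
    using t by (auto simp: list_all2_append2)
  then have "list_all2 (<) (as @ m # bs) (take t ns @ ns ! t # drop (Suc t) ns)"
    using m by (intro list_all2_appendI) auto
  then show ?thesis using t js_eq
      by (simp add: set_multi_indices insert_at_def id_take_nth_drop[symmetric])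
qed

lemma delete_at_multi_index:
  assumes t: "t < length ns" and "is \<in> set (multi_indices ns)"
  shows "is ! t < ns ! t"
  using assms list_all2_nthD2[of "(<)" "is" ns t] by (simp add: set_multi_indices)

text \<open>A line becomes a row of a 0-1 matrix: the multi-indices that leave \<open>js\<close>
  after deleting position \<open>t\<close> are exactly the insertions of some \<open>m\<close> at
  \<open>t\<close> into \<open>js\<close>.\<close>

lemma line_sum_eq:
  fixes f :: "nat list \<Rightarrow> int"
  assumes t: "t < length ns" and js: "js \<in> set (multi_indices (delete_at t ns))"
  shows "(\<Sum>m<ns ! t. f (insert_at t m js)) =
    (\<Sum>i<length (multi_indices ns). (if delete_at t (multi_indices ns ! i) = js then 1 else 0)
        * f (multi_indices ns ! i))"
proof -
  have len: "t \<le> length js"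
    using length_multi_index[OF js] length_delete_at[OF t] t by simp
  have "(\<Sum>i<length (multi_indices ns). (if delete_at t (multi_indices ns ! i) = js then 1 else 0)
      * f (multi_indices ns ! i)) =
      (\<Sum>is\<in>set (multi_indices ns). (if delete_at t is = js then 1 else 0) * f is)"
    using distinct_multi_indices[of ns]
    by (intro sum.reindex_bij_betw bij_betw_nth) auto
  also have "\<dots> = (\<Sum>is\<in>{is \<in> set (multi_indices ns). delete_at t is = js}. f is)"
    by (rule sum.mono_neutral_cong_right) auto
  also have "\<dots> = (\<Sum>m<ns ! t. f (insert_at t m js))"
  proof (rule sum.reindex_bij_witness[of _ "\<lambda>m. insert_at t m js" "\<lambda>is. is ! t"])
    fix "is" assume idx: "is \<in> {is \<in> set (multi_indices ns). delete_at t is = js}"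
    then have "t < length is" using length_multi_index t by auto
    then show *: "insert_at t (is ! t) js = is" using idx insert_at_delete_at by auto
    show "is ! t \<in> {..<ns ! t}" using idx delete_at_multi_index[OF t] by auto
    show "f (insert_at t (is ! t) js) = f is" using * by simp
  next
    fix m assume "m \<in> {..<ns ! t}"
    then show "insert_at t m js ! t = m"
      and "insert_at t m js \<in> {is \<in> set (multi_indices ns). delete_at t is = js}"
      using len insert_at_multi_index[OF t js] by (auto simp: nth_insert_at delete_at_insert_at)
  qed
  finally show ?thesis ..
qed

text \<open>The constraints of a single layer; the line-sums in the last direction link the layers.\<close>

definition layer_lines :: "nat list \<Rightarrow> (nat \<times> nat list) list" where
  "layer_lines ms = concat (map (\<lambda>t. map (Pair t) (multi_indices (delete_at t ms)))
      [0..<length ms])"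

text \<open>Rows are the lines of a layer, columns its cells. The matrix depends on
  \<open>ms\<close> alone, so everything derived from it may be built into the program.\<close>

definition incidence :: "nat list \<Rightarrow> nat \<Rightarrow> nat \<Rightarrow> int" where
  "incidence ms j i =
     (if delete_at (fst (layer_lines ms ! j)) (multi_indices ms ! i) = snd (layer_lines ms ! j)
         then 1 else 0)"

lemma set_layer_lines:
  "(t, js) \<in> set (layer_lines ms) \<longleftrightarrow> t < length ms \<and> js \<in> set (multi_indices (delete_at t ms))"
  by (auto simp: layer_lines_def)

text \<open>The prescribed order of the input already is the block layout of the n-fold program:
  costs, line-sums within layers, line-sums across layers. No rearrangement takes place at run
  time.\<close>

lemma transport_data_snoc:
  "transport_data (ms @ [l]) c u =
     concat (map (\<lambda>is. map (\<lambda>k. c (is @ [k])) [0..<l]) (multi_indices ms)) @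
     concat (map (\<lambda>p. map (\<lambda>k. u (fst p) (snd p @ [k])) [0..<l]) (layer_lines ms)) @
     map (u (length ms)) (multi_indices ms)"
proof -
  have "concat (map (\<lambda>t. map (u t) (multi_indices (delete_at t (ms @ [l])))) [0..<length ms]) =
      concat (map (\<lambda>p. map (\<lambda>k. u (fst p) (snd p @ [k])) [0..<l]) (layer_lines ms))"
  proof -
    have "map (\<lambda>t. map (u t) (multi_indices (delete_at t (ms @ [l])))) [0..<length ms] =
        map (\<lambda>t. concat (map (\<lambda>js. map (\<lambda>k. u t (js @ [k])) [0..<l])
            (multi_indices (delete_at t ms)))) [0..<length ms]"
      by (simp add: delete_at_snoc multi_indices_snoc map_concat comp_def)
    moreover have "concat (map (\<lambda>t. concat (map (\<lambda>js. map (\<lambda>k. u t (js @ [k])) [0..<l]) (g t)))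
        ts) =
        concat (map (\<lambda>p. map (\<lambda>k. u (fst p) (snd p @ [k])) [0..<l]) (concat (map (\<lambda>t. map (Pair t)
            (g t)) ts)))"
      for g :: "nat \<Rightarrow> nat list list" and ts
      by (induction ts) (simp_all add: comp_def)
    ultimately show ?thesis unfolding layer_lines_def by (simp only:)
  qed
  then show ?thesis
    unfolding transport_data_def
        by (simp add: multi_indices_snoc map_concat comp_def delete_at_last)
qed

theorem corollary2p4:
  fixes d :: nat and ms :: "nat list"
  assumes "d \<ge> 2" and "length ms = d - 1" and "\<forall>m\<in>set ms. m \<ge> 1"
  shows "\<exists>(P :: com) (p :: nat poly).
    \<forall>(l :: nat) (c :: nat list \<Rightarrow> int) (u :: nat \<Rightarrow> nat list \<Rightarrow> int). l \<ge> 1 \<longrightarrow>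
      (\<exists>t answer.
         computes_in_time P (long_transport_input ms l c u) t (encode_answer (ms @ [l]) answer) \<and>
         t \<le> poly p (long_transport_size ms l c u) \<and>
         correct_answer (transport_feasible (ms @ [l]) u) (transport_cost (ms @ [l]) c) answer)"
proof -
  define I where "I = multi_indices ms"
  define M where "M = length I"
  define J where "J = length (layer_lines ms)"
  have "0 \<le> incidence ms j i" for j i by (simp add: incidence_def)
  from nfold_solver[where A = "incidence ms" and M = M and J = J, OF this]
  obtain P p where solver: "\<And>l xs. 1 \<le> l \<Longrightarrow> length xs = 1 + (M + J) * l + M \<Longrightarrow> xs ! 0 = int l \<Longrightarrow>
    (\<exists>t ys. computes_in_time P xs t ys \<and> t \<le> poly p (l + sum_list (map bits (tl xs))) \<and>
      nfold_correct M J (incidence ms) l xs ys)"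
    by blast
  show ?thesis
  proof (intro exI[of _ P] exI[of _ p] allI impI)
    fix l :: nat and c :: "nat list \<Rightarrow> int" and u :: "nat \<Rightarrow> nat list \<Rightarrow> int"
    assume l: "1 \<le> l"
    define xs where "xs = long_transport_input ms l c u"
    define C where "C = concat (map (\<lambda>is. map (\<lambda>k. c (is @ [k])) [0..<l]) I)"
    define U where "U = concat (map (\<lambda>p. map (\<lambda>k. u (fst p) (snd p @ [k])) [0..<l])
        (layer_lines ms))"
    have xs: "xs = int l # C @ U @ map (u (length ms)) I"
      by (simp add: xs_def long_transport_input_def transport_data_snoc C_def U_def I_def)
    have len: "length C = M * l" "length U = J * l"
      unfolding C_def U_def M_def J_def by (rule length_concat_blocks)+
    define mi where "mi = multi_indices (ms @ [l])"
    have mi: "length mi = M * l" "distinct mi"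
      unfolding mi_def M_def I_def multi_indices_snoc
      using length_concat_blocks distinct_multi_indices[of "ms @ [l]"]
          by (auto simp: multi_indices_snoc)
    have mi_nth: "mi ! (i * l + k) = I ! i @ [k]" if "i < M" "k < l" for i k
      using nth_concat_blocks[of i I k l "\<lambda>is k. is @ [k]"] that
      by (simp add: mi_def multi_indices_snoc I_def M_def)
    have xs_cost: "xs ! (1 + p) = c (mi ! p)" if "p < M * l" for p
    proof -
      have "C = map c mi" unfolding C_def mi_def multi_indices_snoc I_def
          by (simp add: map_concat comp_def)
      then show ?thesis using that len mi by (simp add: xs nth_append)
    qed
    have xs_line: "xs ! (1 + (M + j) * l +
        k) = u (fst (layer_lines ms ! j)) (snd (layer_lines ms ! j) @ [k])"
      if "j < J" "k < l" for j k
    proof -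
      have "j * l + k < J * l" by (rule cell_index_less[OF that])
      then have "xs ! (1 + (M + j) * l + k) = U ! (j * l + k)"
        using len by (simp add: xs nth_append algebra_simps)
      also have "\<dots> = u (fst (layer_lines ms ! j)) (snd (layer_lines ms ! j) @ [k])"
        unfolding U_def using that unfolding J_def by (intro nth_concat_blocks)
      finally show ?thesis .
    qed
    have xs_link: "xs ! (1 + (M + J) * l + i) = u (length ms) (I ! i)" if "i < M" for i
      using that len by (simp add: xs nth_append algebra_simps M_def)
    define flat where "flat x p = x (mi ! p)" for x :: "nat list \<Rightarrow> nat" and p
    \<comment> \<open>Inverse to \<open>flat\<close> on the valid multi-indices; elsewhere the
      choice yields an arbitrary value, which neither feasibility nor cost inspects.\<close>
    define table where "table y is = y (SOME p. p < M * l \<and> mi ! p = is)"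
        for y :: "nat \<Rightarrow> nat" and "is"
    have table: "table y (mi ! p) = y p" if "p < M * l" for y p
    proof -
      have "(SOME p'. p' < M * l \<and> mi ! p' = mi ! p) = p"
        using that mi by (intro some_equality) (auto simp: nth_eq_iff_index_eq)
      then show ?thesis by (simp add: table_def)
    qed
    \<comment> \<open>Stated for any agreeing pair, it serves both directions: for
      \<open>flat x\<close> with a given table, and for \<open>table y\<close> with a given
      solution.\<close>
    have feasible: "x \<in> transport_feasible (ms @ [l]) u \<longleftrightarrow> nfold_solves M J (incidence ms) l xs y"
      if xy: "\<And>p. p < M * l \<Longrightarrow> x (mi ! p) = y p" for x y
    proof -
      have y: "y (i * l + k) = x (I ! i @ [k])" if "i < M" "k < l" for i k
        using xy[of "i * l + k"] cell_index_less[OF that] mi_nth[OF that] by simp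
      have line: "(\<Sum>m<ms ! t. int (x (insert_at t m (js @ [k])))) =
          (\<Sum>i<M. incidence ms j i * int (y (i * l + k)))"
        if "j < J" "k < l" "layer_lines ms ! j = (t, js)" for j k t js
      proof -
        have "(t, js) \<in> set (layer_lines ms)" using that(1,3) nth_mem unfolding J_def by metis
        then have t: "t < length ms" and js: "js \<in> set (multi_indices (delete_at t ms))"
          by (auto simp: set_layer_lines)
        have "t \<le> length js" using length_multi_index[OF js] length_delete_at[OF t] t by simp
        then have "(\<Sum>m<ms ! t. int (x (insert_at t m (js @ [k])))) =
            (\<Sum>m<ms ! t. int (x (insert_at t m js @ [k])))"
          by (simp add: insert_at_snoc)
        also have "\<dots> = (\<Sum>i<M. (if delete_at t (I ! i) = js then 1 else 0) * int (x (I ! i @ [k])))"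
          unfolding M_def I_def using line_sum_eq[OF t js, of "\<lambda>is. int (x (is @ [k]))"] .
        also have "\<dots> = (\<Sum>i<M. incidence ms j i * int (y (i * l + k)))"
          using that by (intro sum.cong) (auto simp: incidence_def I_def[symmetric] y)
        finally show ?thesis .
      qed
      have link: "(\<Sum>k<l. int (x (insert_at (length ms) k (I ! i)))) = (\<Sum>k<l. int (y (i * l + k)))"
        if "i < M" for i
      proof -
        have "length (I ! i) = length ms"
            using that unfolding I_def M_def by (intro length_multi_index) simp
        then have "insert_at (length ms) k (I ! i) = I ! i @ [k]" for k
            using insert_at_length by metis
        then show ?thesis using that by (intro sum.cong) (auto simp: y)
      qed
      show ?thesis
      proof
        assume x: "x \<in> transport_feasible (ms @ [l]) u"
        have x_line: "(\<Sum>m<(ms @ [l]) ! t. int (x (insert_at t m js))) = u t js"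
          if "js \<in> set (multi_indices (delete_at t (ms @ [l])))" "t < length (ms @ [l])" for t js
          using x that unfolding transport_feasible_def by blast
        show "nfold_solves M J (incidence ms) l xs y"
          unfolding nfold_solves_def
        proof (intro conjI allI impI)
          fix j k assume jk: "j < J" "k < l"
          obtain t js where tjs: "layer_lines ms ! j = (t, js)" by (cases "layer_lines ms ! j")
          have "(t, js) \<in> set (layer_lines ms)" using jk(1) tjs nth_mem unfolding J_def by metis
          then have t: "t < length ms" and js: "js \<in> set (multi_indices (delete_at t ms))"
            by (auto simp: set_layer_lines)
          have "js @ [k] \<in> set (multi_indices (delete_at t (ms @ [l])))"
            using js jk(2) unfolding delete_at_snoc[OF t] set_multi_indices_snoc by blast
          then have "(\<Sum>m<(ms @ [l]) ! t. int (x (insert_at t m (js @ [k])))) = u t (js @ [k])"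
            using t by (intro x_line; simp)
          then show "(\<Sum>i<M. incidence ms j i * int (y (i * l + k))) = xs ! (1 + (M + j) * l + k)"
            using line[OF jk tjs] xs_line[OF jk] t tjs by (simp add: nth_append)
        next
          fix i assume i: "i < M"
          then have "I ! i \<in> set (multi_indices (delete_at (length ms) (ms @ [l])))"
            by (simp add: delete_at_last I_def M_def)
          then have "(\<Sum>m<(ms @ [l]) ! length ms. int (x (insert_at (length ms) m (I ! i)))) =
              u (length ms) (I ! i)"
            by (intro x_line; simp)
          then show "(\<Sum>k<l. int (y (i * l + k))) = xs ! (1 + (M + J) * l + i)"
            using link[OF i] xs_link[OF i] by simp
        qed
      next
        assume s: "nfold_solves M J (incidence ms) l xs y"
        show "x \<in> transport_feasible (ms @ [l]) u"
          unfolding transport_feasible_def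
        proof (intro CollectI allI impI ballI)
          fix t js' assume t: "t < length (ms @ [l])" and js':
              "js' \<in> set (multi_indices (delete_at t (ms @ [l])))"
          show "(\<Sum>m<(ms @ [l]) ! t. int (x (insert_at t m js'))) = u t js'"
          proof (cases "t < length ms")
            case True
            obtain js k where js: "js \<in> set (multi_indices (delete_at t ms))" "k < l"
                "js' = js @ [k]"
              using js' unfolding delete_at_snoc[OF True] set_multi_indices_snoc by blast
            then have "(t, js) \<in> set (layer_lines ms)" using True by (simp add: set_layer_lines)
            then obtain j where j: "j < J" "layer_lines ms ! j = (t, js)"
                by (auto simp: in_set_conv_nth J_def)
            have "(\<Sum>i<M. incidence ms j i * int (y (i * l + k))) = xs ! (1 + (M + j) * l + k)"
              using s j(1) js(2) unfolding nfold_solves_def by blast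
            then show ?thesis
              using line[OF j(1) js(2) j(2)] xs_line[OF j(1) js(2)] True j(2) js(3)
                  by (simp add: nth_append)
          next
            case False
            then have t: "t = length ms" using t by simp
            then have "js' \<in> set I" using js' by (simp add: delete_at_last I_def)
            then obtain i where i: "i < M" "js' = I ! i" by (auto simp: in_set_conv_nth M_def)
            have "(\<Sum>k<l. int (y (i * l + k))) = xs ! (1 + (M + J) * l + i)"
              using s i(1) unfolding nfold_solves_def by blast
            then show ?thesis using link[OF i(1)] xs_link[OF i(1)] t i(2) by simp
          qed
        qed
      qed
    qed
    have cost: "transport_cost (ms @ [l]) c x = nfold_obj M l xs y"
      if xy: "\<And>p. p < M * l \<Longrightarrow> x (mi ! p) = y p" for x y
    proof -
      have "transport_cost (ms @ [l]) c x = (\<Sum>p<M * l. c (mi ! p) * int (x (mi ! p)))"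
        unfolding transport_cost_def mi_def[symmetric] using mi
        by (intro sum.reindex_bij_betw[symmetric] bij_betw_nth) auto
      also have "\<dots> = nfold_obj M l xs y"
        unfolding nfold_obj_def using xy xs_cost by (intro sum.cong) auto
      finally show ?thesis .
    qed
    have "length xs = 1 + (M + J) * l + M" using len by (simp add: xs M_def algebra_simps)
    from solver[OF l this] obtain t ys where t: "computes_in_time P xs t ys"
      "t \<le> poly p (l + sum_list (map bits (tl xs)))"
      and ys: "nfold_correct M J (incidence ms) l xs ys"
      by (auto simp: xs)
    have size: "l + sum_list (map bits (tl xs)) = long_transport_size ms l c u"
      by (simp add: xs_def long_transport_input_def long_transport_size_def)
    have flat_feasible: "x \<in> transport_feasible (ms @ [l]) u \<longleftrightarrow>
        nfold_solves M J (incidence ms) l xs (flat x)"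
      and flat_cost: "transport_cost (ms @ [l]) c x = nfold_obj M l xs (flat x)" for x
      by (rule feasible cost; simp add: flat_def)+
    have "\<exists>answer. encode_answer (ms @ [l]) answer = ys \<and>
        correct_answer (transport_feasible (ms @ [l]) u) (transport_cost (ms @ [l]) c) answer"
      using ys unfolding nfold_correct_def
    proof (elim disjE exE conjE)
      assume "ys = [0]" "\<forall>y. \<not> nfold_solves M J (incidence ms) l xs y"
      then show ?thesis using flat_feasible by (intro exI[of _ Infeasible]) auto
    next
      fix y assume y: "ys = 2 # map (\<lambda>p. int (y p)) [0..<M * l]"
          "nfold_solves M J (incidence ms) l xs y"
        "\<forall>z. nfold_solves M J (incidence ms) l xs z \<longrightarrow> nfold_obj M l xs y \<le> nfold_obj M l xs z"
      have "map (\<lambda>i. int (table y i)) mi = map (\<lambda>p. int (y p)) [0..<M * l]"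
        using mi by (intro nth_equalityI) (auto simp: table)
      moreover have "table y \<in> transport_feasible (ms @ [l]) u"
        using y(2) feasible[of "table y" y, OF table] by blast
      moreover have "transport_cost (ms @ [l]) c (table y) \<le> transport_cost (ms @ [l]) c x"
        if "x \<in> transport_feasible (ms @ [l]) u" for x
        using that y(3) cost[of "table y" y, OF table]
            unfolding flat_feasible flat_cost[of x] by simp
      ultimately show ?thesis using y(1) by (intro exI[of _ "Optimal (table y)"]) (simp add: mi_def)
    qed
    then show "\<exists>t answer.
         computes_in_time P (long_transport_input ms l c u) t (encode_answer (ms @ [l]) answer) \<and>
         t \<le> poly p (long_transport_size ms l c u) \<and>
         correct_answer (transport_feasible (ms @ [l]) u) (transport_cost (ms @ [l]) c) answer"
      using t unfolding xs_def[symmetric] size by blast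
  qed
qed

end
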